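(* For every fixed integer $\ell\ge1$, as $x\to\infty$, $$Z_\ell(x)=\left(\frac1{\sqrt2}+O_\ell(x^{-1/2})\right)E(x)-\frac{\sqrt\ell}{\log x}+O_\ell\!\left(\frac1{\log^2x}\right).$$ Moreover, unconditionally, this simplifies to $$Z_\ell(x)=\frac1{\sqrt2}E(x)-\frac{\sqrt\ell}{\log x}+O_\ell\!\left(\frac1{\log^2x}\right)\qquad(x\to\infty).$$
   Context: For an integer $\ell\ge1$ and $n\ge 1$ put $L_n^{(\ell)}=\frac{n(\ell(n-1)+2)}{2}$ and $h_n^{(\ell)}=L_{n+1}^{(\ell)}-L_n^{(\ell)}=1+\ell n$. For real $x$ let $\nu_\ell(x)=\frac{\sqrt{8\ell x+(\ell-2)^2}+\ell-2}{2\ell}$ and $n_x^{(\ell)}=\lceil \nu_\ell(x)\rceil$ (so with $n=n_x^{(\ell)}$ one has $L_{n-1}^{(\ell)}<x\le L_n^{(\ell)}$). For $j\ge1$ let $s_j^{(\ell)}=h_j^{(\ell)}/\log L_{j+1}^{(\ell)}$ and $\Sigma_n^{(\ell)}=\sum_{j=1}^{n-1}s_j^{(\ell)}$. For $x\ge L_2^{(\ell)}$ define $$\widehat S_\ell(x)=\Sigma_{n_x^{(\ell)}}^{(\ell)}-\frac{L_{n_x^{(\ell)}}^{(\ell)}-x}{\log L_{n_x^{(\ell)}}^{(\ell)}},\qquad q_\ell(x)=\frac{h_{n_x^{(\ell)}-1}^{(\ell)}}{\sqrt{\ell}\,\log L_{n_x^{(\ell)}}^{(\ell)}}.$$ With $\pi(x)$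 the number of primes $p\le x$ and $\operatorname{li}(x)=\mathrm{PV}\!\int_0^x\frac{dt}{\log t}$ (principal value), put $$Z_\ell(x)=\frac{\widehat S_\ell(x)-\pi(x)}{q_\ell(x)},\qquad E(x)=\frac{\log x}{\sqrt x}\bigl(\operatorname{li}(x)-\pi(x)\bigr).$$ Implied constants in $O_\ell$ may depend on $\ell$ but not on $x$. "Unconditionally" means no form of the Riemann hypothesis is assumed. *)

theory Defs
  imports
    "HOL-Analysis.Analysis"
    "HOL-Library.Landau_Symbols"
    "HOL-Computational_Algebra.Primes"
begin

definition L_seq :: "nat \<Rightarrow> nat \<Rightarrow> real" where
  "L_seq l n = real n * (real l * (real n - 1) + 2) / 2"

definition h_seq :: "nat \<Rightarrow> nat \<Rightarrow> real" where
  "h_seq l n = L_seq l (n + 1) - L_seq l n"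

lemma h_seq_eq: "h_seq l n = 1 + real l * real n"
  by (simp add: h_seq_def L_seq_def field_simps)

definition nu :: "nat \<Rightarrow> real \<Rightarrow> real" where
  "nu l x = (sqrt (8 * real l * x + (real l - 2)\<^sup>2) + real l - 2) / (2 * real l)"

definition n_idx :: "nat \<Rightarrow> real \<Rightarrow> nat" where
  "n_idx l x = nat \<lceil>nu l x\<rceil>"

definition s_seq :: "nat \<Rightarrow> nat \<Rightarrow> real" where
  "s_seq l j = h_seq l j / ln (L_seq l (j + 1))"

definition Sigma_seq :: "nat \<Rightarrow> nat \<Rightarrow> real" where
  "Sigma_seq l n = (\<Sum>j=1..<n. s_seq l j)"

(* S_hat, q_fun and Z_fun are meant for x \<ge> L_seq l 2 (so that n_idx l x \<ge> 2);
   their values for smaller x carry no meaning. *)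
definition S_hat :: "nat \<Rightarrow> real \<Rightarrow> real" where
  "S_hat l x = Sigma_seq l (n_idx l x)
     - (L_seq l (n_idx l x) - x) / ln (L_seq l (n_idx l x))"

definition q_fun :: "nat \<Rightarrow> real \<Rightarrow> real" where
  "q_fun l x = h_seq l (n_idx l x - 1) / (sqrt (real l) * ln (L_seq l (n_idx l x)))"

definition prime_pi :: "real \<Rightarrow> nat" where
  "prime_pi x = card {p::nat. prime p \<and> real p \<le> x}"

(* Principal value at the singularity t = 1: the symmetric window of radius e around 1 is
   removed and e tends to 0 from above.  At t = 0 the integrand takes the value 1 / ln 0 = 0,
   which does not affect the integral. *)
definition li :: "real \<Rightarrow> real" where
  "li x = Lim (at_right 0) (\<lambda>e. integral ({0..x} - {1 - e<..<1 + e}) (\<lambda>t. 1 / ln t))"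

definition Z_fun :: "nat \<Rightarrow> real \<Rightarrow> real" where
  "Z_fun l x = (S_hat l x - real (prime_pi x)) / q_fun l x"

definition E_fun :: "real \<Rightarrow> real" where
  "E_fun x = ln x / sqrt x * (li x - real (prime_pi x))"

end

theory Submission
  imports Defs "HOL-Complex_Analysis.Complex_Analysis" "HOL-Number_Theory.Prime_Powers"
    "HOL-Real_Asymp.Real_Asymp"
begin

text \<open>The partial sums \<open>S_hat\<close> are right-endpoint sums for \<open>li\<close>. One step of them is too small by
  \<open>h ^ 2 / (2 * L * ln L ^ 2)\<close>, which is \<open>l / ln L ^ 2\<close> up to lower order, so that
  \<open>li x - S_hat l x = l * n / ln x ^ 2 + O(n / ln x ^ 3)\<close>. Division by \<open>q_fun\<close> turns this into the term
  \<open>sqrt l / ln x\<close>, and \<open>sqrt x / (ln x * q_fun l x)\<close> is \<open>1 / sqrt 2 + O(x powr (-1/2))\<close>.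

  The second claim needs \<open>li x - prime_pi x = O(x / ln x ^ 3)\<close>. On \<open>Re s > 1\<close> the 3-4-1 inequality
  bounds \<open>1 / zeta\<close> by a small power of \<open>\<bar>Im s\<bar>\<close>. With Cauchy's estimate, the fourth derivative of
  \<open>- zeta' / zeta - zeta\<close> is then \<open>O(\<bar>Im s\<bar> powr (1/2))\<close> uniformly up to the line \<open>Re s = 1\<close>. Integrated
  against the kernel \<open>x powr s / (s * (s + 1))\<close> on \<open>Re s = 1 + 1 / ln x\<close>, this gives
  \<open>(\<Sum>n\<le>x. (mangoldt n - 1) * ln n ^ 4 * (x - n)) = O(x ^ 2)\<close>. Differencing with step \<open>x / ln x ^ 2\<close> and
  partial summation remove the smoothing and the weight \<open>ln n ^ 4\<close>.\<close>

section \<open>Dirichlet series and the 3-4-1 inequality\<close>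

text \<open>The exponents are forced from the end backwards. \<open>A\<close> has size
  \<open>x powr (-1/2)\<close>, so absorbing \<open>A x * E_fun x\<close> into the error term asks
  for \<open>li x - prime_pi x = O(x / ln x ^ 3)\<close>; the bare prime number theorem is too weak.
  With weight \<open>ln n ^ k\<close> and step \<open>H\<close>, unsmoothing costs
  \<open>x ^ 2 / H + H * ln x ^ k\<close>, which is least, of order
  \<open>x * ln x ^ (k / 2)\<close>, at \<open>H = x / ln x ^ (k / 2)\<close>. Dividing by
  \<open>ln x ^ (k + 1)\<close> leaves \<open>x / ln x ^ (k / 2 + 1)\<close>, hence
  \<open>k = 4\<close>.

  Differentiation takes the place of a classical zero-free region: the Dirichlet series is
  integrated only to the right of \<open>Re s = 1\<close>, and the powers of the logarithm come from
  the weight. On that line a bound by a power of \<open>\<bar>Im s\<bar>\<close> below 1 suffices,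
  since the kernel decays quadratically. Subtracting \<open>zeta\<close> removes the pole of
  \<open>- zeta' / zeta\<close>, so the line may approach \<open>Re s = 1\<close> also at height 0.

  The first formula is independent of all this: \<open>E_fun\<close> is kept as it stands, and only
  explicit sums and integrals are estimated.\<close>

text \<open>The term \<open>n = 0\<close> vanishes because \<open>0 powr z = 0\<close>.\<close>
definition dser :: "(nat \<Rightarrow> complex) \<Rightarrow> complex \<Rightarrow> complex" where
  "dser a s = (\<Sum>n. a n * of_nat n powr (-s))"

text \<open>Growth below every positive power. The class contains \<open>mangoldt\<close>, is stable
  under multiplication by powers of \<open>ln\<close>, and gives absolute convergence on
  \<open>Re s > 1\<close>, so all derivatives of these series stay inside it.\<close>

definition subpoly :: "(nat \<Rightarrow> complex) \<Rightarrow> bool" where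
  "subpoly a \<longleftrightarrow> (\<forall>e>0. \<exists>C. \<forall>n\<ge>1. norm (a n) \<le> C * real n powr e)"

lemma norm_of_nat_powr: "norm (of_nat n powr s :: complex) = real n powr Re s"
  by (cases "n = 0") (auto simp: norm_powr_real_powr)

lemma subpolyD:
  assumes "subpoly a" "e > 0"
  obtains C where "C \<ge> 0" "\<And>n. n \<ge> 1 \<Longrightarrow> norm (a n) \<le> C * real n powr e"
proof -
  obtain C where C: "\<And>n. n \<ge> 1 \<Longrightarrow> norm (a n) \<le> C * real n powr e"
    using assms unfolding subpoly_def by blast
  have "0 \<le> C" using order.trans[OF norm_ge_zero C[of 1]] by simp
  with C that show ?thesis by blast
qed

lemma ln_le_powr:
  assumes "e > 0" "n \<ge> (1::nat)"
  shows "ln (real n) \<le> real n powr e / e"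
proof -
  have "e * ln (real n) = ln (real n powr e)" using assms by (simp add: ln_powr)
  also have "\<dots> \<le> real n powr e" using assms by (intro order.trans[OF ln_le_minus_one]) auto
  finally show ?thesis using assms by (simp add: field_simps)
qed

lemma subpoly_mult_ln: "subpoly a \<Longrightarrow> subpoly (\<lambda>n. a n * of_real (ln (real n)))"
  unfolding subpoly_def
proof (intro allI impI)
  fix e :: real assume a: "\<forall>e>0. \<exists>C. \<forall>n\<ge>1. norm (a n) \<le> C * real n powr e" and e: "e > 0"
  then have "subpoly a" unfolding subpoly_def by simp
  then obtain C where C: "C \<ge> 0" "\<And>n. n \<ge> 1 \<Longrightarrow> norm (a n) \<le> C * real n powr (e/2)"
    using subpolyD[of a "e/2"] e by auto
  have "norm (a n * of_real (ln (real n))) \<le> 2 * C / e * real n powr e" if "n \<ge> 1" for n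
  proof -
    have "norm (a n * of_real (ln (real n))) = norm (a n) * ln (real n)"
      using that by (simp add: norm_mult)
    also have "\<dots> \<le> (C * real n powr (e/2)) * (real n powr (e/2) / (e/2))"
      using that e C by (intro mult_mono ln_le_powr) auto
    also have "\<dots> = 2 * C / e * (real n powr (e/2) * real n powr (e/2))" by simp
    also have "real n powr (e/2) * real n powr (e/2) = real n powr e"
      by (simp flip: powr_add)
    finally show ?thesis .
  qed
  then show "\<exists>C. \<forall>n\<ge>1. norm (a n * of_real (ln (real n))) \<le> C * real n powr e" by blast
qed

lemma subpoly_mult_ln_power:
  "subpoly a \<Longrightarrow> subpoly (\<lambda>n. a n * of_real (ln (real n)) ^ k)"
proof (induction k)
  case (Suc k)
  then have "subpoly (\<lambda>n. (a n * of_real (ln (real n)) ^ k) * of_real (ln (real n)))"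
    by (intro subpoly_mult_ln) auto
  then show ?case by (simp add: mult_ac)
qed simp

lemma subpoly_const: "subpoly (\<lambda>n. c)"
  unfolding subpoly_def
proof (intro allI impI)
  fix e :: real assume "e > 0"
  then have "norm c \<le> norm c * real n powr e" if "n \<ge> 1" for n
    using that mult_left_mono[of 1 "real n powr e" "norm c"] ge_one_powr_ge_zero[of "real n" e] by auto
  then show "\<exists>C. \<forall>n\<ge>1. norm c \<le> C * real n powr e" by blast
qed

lemma subpoly_mono:
  assumes "subpoly b" "\<And>n. n \<ge> 1 \<Longrightarrow> norm (a n) \<le> norm (b n)"
  shows "subpoly a"
  using assms unfolding subpoly_def by (meson order.trans)

lemma subpoly_diff:
  assumes "subpoly a" "subpoly b"
  shows "subpoly (\<lambda>n. a n - b n)"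
  unfolding subpoly_def
proof (intro allI impI)
  fix e :: real assume e: "e > 0"
  obtain C where C: "\<And>n. n \<ge> 1 \<Longrightarrow> norm (a n) \<le> C * real n powr e"
    using subpolyD[OF assms(1) e] by blast
  obtain D where D: "\<And>n. n \<ge> 1 \<Longrightarrow> norm (b n) \<le> D * real n powr e"
    using subpolyD[OF assms(2) e] by blast
  have "norm (a n - b n) \<le> (C + D) * real n powr e" if "n \<ge> 1" for n
    using C[OF that] D[OF that] norm_triangle_ineq4[of "a n" "b n"] by (simp add: algebra_simps)
  then show "\<exists>C. \<forall>n\<ge>1. norm (a n - b n) \<le> C * real n powr e" by blast
qed

text \<open>The majorant depends on \<open>\<sigma>\<close> only, so it serves both absolute
  convergence and the locally uniform convergence behind termwise differentiation. With
  \<open>e\<close> half of \<open>\<sigma> - 1\<close> the exponent \<open>e - \<sigma>\<close> is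
  still below -1.\<close>

lemma dser_term_bound:
  assumes "subpoly a" "\<sigma> > 1"
  obtains h where "summable h" "\<And>n. h n \<ge> (0::real)"
    "\<And>n s. Re s \<ge> \<sigma> \<Longrightarrow> norm (a n * of_nat n powr (-s)) \<le> h n"
proof -
  define e where "e = (\<sigma> - 1) / 2"
  have e: "e > 0" using assms by (simp add: e_def)
  obtain C where C: "C \<ge> 0" "\<And>n. n \<ge> 1 \<Longrightarrow> norm (a n) \<le> C * real n powr e"
    using subpolyD[OF assms(1) e] by blast
  have "summable (\<lambda>n. C * real n powr (e - \<sigma>))"
    using assms by (intro summable_mult) (simp add: summable_real_powr_iff e_def field_simps)
  moreover have "norm (a n * of_nat n powr (-s)) \<le> C * real n powr (e - \<sigma>)"
    if "Re s \<ge> \<sigma>" for n s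
  proof (cases "n = 0")
    case False
    then have n: "n \<ge> 1" by simp
    have "norm (a n * of_nat n powr (-s)) = norm (a n) * real n powr (- Re s)"
      by (simp add: norm_mult norm_of_nat_powr)
    also have "\<dots> \<le> (C * real n powr e) * real n powr (-\<sigma>)"
      using that n C by (intro mult_mono powr_mono) auto
    also have "\<dots> = C * real n powr (e - \<sigma>)" by (simp add: powr_add powr_diff powr_minus field_simps)
    finally show ?thesis .
  qed (use C in auto)
  ultimately show ?thesis using that[of "\<lambda>n. C * real n powr (e - \<sigma>)"] C by auto
qed

lemma dser_abs_summable:
  assumes "subpoly a" "Re s > 1"
  shows "summable (\<lambda>n. norm (a n * of_nat n powr (-s)))"
proof -
  obtain h where h: "summable h" "\<And>n. h n \<ge> (0::real)"
    "\<And>n s'. Re s' \<ge> Re s \<Longrightarrow> norm (a n * of_nat n powr (-s')) \<le> h n"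
    using dser_term_bound[OF assms] by blast
  show ?thesis by (rule summable_comparison_test'[OF h(1), of 0]) (use h(3)[of s] in auto)
qed

lemma dser_sums:
  assumes "subpoly a" "Re s > 1"
  shows "(\<lambda>n. a n * of_nat n powr (-s)) sums dser a s"
  unfolding dser_def using summable_norm_cancel[OF dser_abs_summable[OF assms]] by (simp add: summable_sums)

lemma has_field_derivative_dser:
  assumes a: "subpoly a" and s: "Re s > 1"
  shows "(dser a has_field_derivative - dser (\<lambda>n. a n * of_real (ln (real n))) s) (at s)"
proof -
  let ?S = "{s. Re s > 1}"
  define f' where "f' = (\<lambda>n s. - (a n * of_real (ln (real n)) * of_nat n powr (-s)))"
  have "\<exists>g g'. \<forall>x\<in>?S. ((\<lambda>n. a n * of_nat n powr (-x)) sums g x) \<and>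
          ((\<lambda>n. f' n x) sums g' x) \<and> (g has_field_derivative g' x) (at x)"
  proof (rule series_and_derivative_comparison_complex)
    show "open ?S" by (rule open_halfspace_Re_gt)
    show "((\<lambda>x. a n * of_nat n powr (-x)) has_field_derivative f' n x) (at x)" for n x
      by (cases "n = 0")
         (auto simp: f'_def has_field_derivative_powr_right algebra_simps intro!: derivative_eq_intros
            DERIV_chain2[OF has_field_derivative_powr_right])
  next
    fix x assume x: "x \<in> ?S"
    define \<sigma> where "\<sigma> = (Re x + 1) / 2"
    have "\<sigma> > 1" using x by (simp add: \<sigma>_def)
    then obtain h where h: "summable h" "\<And>n. h n \<ge> (0::real)"
      "\<And>n s. Re s \<ge> \<sigma> \<Longrightarrow> norm (a n * of_nat n powr (-s)) \<le> h n"
      using dser_term_bound[OF a] by blast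
    have *: "Re y \<ge> \<sigma>" if "y \<in> ball x ((Re x - 1) / 2)" for y
    proof -
      have "Re x - Re y \<le> norm (x - y)" using complex_Re_le_cmod[of "x - y"] by simp
      then show ?thesis using that by (simp add: dist_norm \<sigma>_def field_simps)
    qed
    show "\<exists>d h. 0 < d \<and> summable h \<and> range h \<subseteq> \<real>\<^sub>\<ge>\<^sub>0 \<and>
      (\<forall>\<^sub>F n in sequentially. \<forall>y\<in>ball x d \<inter> ?S. cmod (a n * of_nat n powr (-y)) \<le> cmod (h n))"
      by (rule exI[of _ "(Re x - 1) / 2"], rule exI[of _ "\<lambda>n. of_real (h n)"])
         (use x h * in \<open>auto intro!: summable_of_real eventuallyI\<close>)
  qed
  then obtain g g' where g: "\<And>x. Re x > 1 \<Longrightarrow> (\<lambda>n. a n * of_nat n powr (-x)) sums g x"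
    "\<And>x. Re x > 1 \<Longrightarrow> (\<lambda>n. f' n x) sums g' x"
    "\<And>x. Re x > 1 \<Longrightarrow> (g has_field_derivative g' x) (at x)" by blast
  have eq: "g x = dser a x" if "Re x > 1" for x
    using g(1)[OF that] dser_sums[OF a that] sums_unique2 by blast
  have "(\<lambda>n. f' n s) sums - dser (\<lambda>n. a n * of_real (ln (real n))) s"
    unfolding f'_def by (intro sums_minus dser_sums subpoly_mult_ln a s)
  then have g's: "g' s = - dser (\<lambda>n. a n * of_real (ln (real n))) s"
    using g(2)[OF s] sums_unique2 by blast
  show ?thesis
    using has_field_derivative_transform_within_open[OF g(3)[OF s] open_halfspace_Re_gt[of 1]] eq s g's by auto
qed

lemma higher_deriv_dser:
  assumes a: "subpoly a" and s: "Re s > 1"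
  shows "(deriv ^^ k) (dser a) s = (-1) ^ k * dser (\<lambda>n. a n * of_real (ln (real n)) ^ k) s"
  using s
proof (induction k arbitrary: s)
  case (Suc k)
  let ?b = "\<lambda>n. a n * of_real (ln (real n)) ^ k"
  have "\<forall>\<^sub>F z in nhds s. z \<in> {z. Re z > 1}"
    using Suc.prems open_halfspace_Re_gt by (intro eventually_nhds_in_open) auto
  then have "\<forall>\<^sub>F z in nhds s. (deriv ^^ k) (dser a) z = (-1) ^ k * dser ?b z"
    by eventually_elim (use Suc.IH in auto)
  then have "(deriv ^^ Suc k) (dser a) s = deriv (\<lambda>z. (-1) ^ k * dser ?b z) s"
    by (simp add: deriv_cong_ev)
  also have "\<dots> = (-1) ^ k * (- dser (\<lambda>n. ?b n * of_real (ln (real n))) s)"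
    by (intro DERIV_imp_deriv DERIV_cmult has_field_derivative_dser subpoly_mult_ln_power a Suc.prems)
  finally show ?case by (simp add: mult_ac)
qed simp

text \<open>Absolute convergence lets the double series over pairs be regrouped by product, with
  \<open>(n, d)\<close> corresponding to \<open>(d, n div d)\<close>. Index 0 is removed first:
  every \<open>d\<close> divides 0, so the regrouping would break there.\<close>

lemma dser_mult:
  assumes "subpoly a" "subpoly b" and s: "Re s > 1"
    and c: "\<And>n. n \<ge> 1 \<Longrightarrow> c n = (\<Sum>d | d dvd n. a d * b (n div d))"
  shows "(\<lambda>n. c n * of_nat n powr (-s)) sums (dser a s * dser b s)"
proof -
  define A where "A = (\<lambda>n. a n * of_nat n powr (-s))"
  define B where "B = (\<lambda>n. b n * of_nat n powr (-s))"
  have hs: "(f has_sum suminf f) {0<..}" and abs: "(\<lambda>n. norm (f n)) summable_on {0<..}"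
    if "f 0 = 0" "summable (\<lambda>n. norm (f n))" for f :: "nat \<Rightarrow> complex"
  proof -
    have "(f has_sum suminf f) UNIV" 
      using that by (intro norm_summable_imp_has_sum) (auto simp: summable_sums summable_norm_cancel)
    then show "(f has_sum suminf f) {0<..}"
      by (rule has_sum_cong_neutral[THEN iffD1, rotated -1])
         (use that(1) in auto)
    have "(\<lambda>n. norm (f n)) summable_on UNIV"
      using that by (intro norm_summable_imp_summable_on) auto
    then show "(\<lambda>n. norm (f n)) summable_on {0<..}" by (rule summable_on_subset_banach) auto
  qed
  have A: "(A has_sum dser a s) {0<..}" "(\<lambda>n. norm (A n)) summable_on {0<..}"
    using hs[of A] abs[of A] dser_abs_summable[OF assms(1) s] by (simp_all add: A_def dser_def)
  have B: "(B has_sum dser b s) {0<..}" "(\<lambda>n. norm (B n)) summable_on {0<..}"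
    using hs[of B] abs[of B] dser_abs_summable[OF assms(2) s] by (simp_all add: B_def dser_def)
  have AB: "((\<lambda>(x, y). A x * B y) has_sum dser a s * dser b s) ({0<..} \<times> {0<..})"
  proof -
    have 1: "(\<lambda>y. norm (A x * B y)) summable_on {0<..}" for x
      using B(2) by (simp add: norm_mult summable_on_cmult_right)
    have "(\<lambda>x. \<Sum>\<^sub>\<infinity>y\<in>{0<..}. norm (A x * B y)) = (\<lambda>x. norm (A x) * (\<Sum>\<^sub>\<infinity>y\<in>{0<..}. norm (B y)))"
      by (simp add: norm_mult infsum_cmult_right')
    moreover have "(\<lambda>x. norm (norm (A x) * (\<Sum>\<^sub>\<infinity>y\<in>{0<..}. norm (B y)))) summable_on {0<..}"
      using A(2) by (simp add: abs_mult summable_on_cmult_left)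
    ultimately have "(\<lambda>x. norm (\<Sum>\<^sub>\<infinity>y\<in>{0<..}. norm (A x * B y))) summable_on {0<..}"
      by metis
    then have "(\<lambda>p. norm (case p of (x, y) \<Rightarrow> A x * B y)) summable_on ({0<..} \<times> {0<..})"
      using 1 by (subst Infinite_Sum.abs_summable_on_Sigma_iff) simp
    then have sm: "(\<lambda>(x, y). A x * B y) summable_on ({0<..} \<times> {0<..})"
      by (rule abs_summable_summable)
    have "(\<Sum>\<^sub>\<infinity>(x, y)\<in>{0<..} \<times> {0<..}. A x * B y) = (\<Sum>\<^sub>\<infinity>x\<in>{0<..}. \<Sum>\<^sub>\<infinity>y\<in>{0<..}. A x * B y)"
      by (rule infsum_Sigma'_banach[OF sm, symmetric])
    also have "\<dots> = dser a s * dser b s"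
      using infsumI[OF A(1)] infsumI[OF B(1)] by (simp add: infsum_cmult_right' infsum_cmult_left')
    finally show ?thesis using has_sum_infsum[OF sm] by simp
  qed
  have bij: "bij_betw (\<lambda>(n::nat, d). (d, n div d)) (SIGMA n:{0<..}. {d. d dvd n}) ({0<..} \<times> {0<..})"
    by (rule bij_betwI[where g = "\<lambda>(d, m). (d * m, d)"])
       (auto elim!: dvdE)
  have "((\<lambda>(n, d). A d * B (n div d)) has_sum dser a s * dser b s) (SIGMA n:{0<..}. {d. d dvd n})"
    using has_sum_reindex_bij_betw[OF bij, of "\<lambda>(x, y). A x * B y"] AB
    by (simp add: case_prod_unfold)
  then have "((\<lambda>n. \<Sum>d | d dvd n. A d * B (n div d)) has_sum dser a s * dser b s) {0<..}"
    by (rule has_sum_SigmaD) (auto intro!: has_sum_finite)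
  also have "?this \<longleftrightarrow> ((\<lambda>n. c n * of_nat n powr (-s)) has_sum dser a s * dser b s) UNIV"
  proof (rule has_sum_cong_neutral)
    fix n :: nat assume "n \<in> {0<..} \<inter> UNIV"
    then have n: "n \<ge> 1" by simp
    have "A d * B (n div d) = a d * b (n div d) * of_nat n powr (-s)" if "d dvd n" for d
    proof -
      from that obtain m where m: "n = d * m" by (elim dvdE)
      with n have "d > 0" "m > 0" by (auto intro!: Nat.gr0I)
      then have "of_nat n powr (-s) = (of_nat d powr (-s) * of_nat m powr (-s) :: complex)"
        unfolding m by (simp add: powr_times_real)
      with m \<open>d > 0\<close> show ?thesis by (simp add: A_def B_def)
    qed
    then show "(\<Sum>d | d dvd n. A d * B (n div d)) = c n * of_nat n powr (-s)"
      unfolding c[OF n] sum_distrib_right by (intro sum.cong) auto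
  qed auto
  finally show ?thesis by (rule has_sum_imp_sums)
qed

section \<open>The zeta function, the von Mangoldt series and the logarithm of zeta\<close>

abbreviation zeta :: "complex \<Rightarrow> complex" where
  "zeta \<equiv> dser (\<lambda>_. 1)"

lemma subpoly_mangoldt: "subpoly mangoldt"
proof (rule subpoly_mono[OF subpoly_mult_ln[OF subpoly_const[of 1]]])
  show "norm (mangoldt n :: complex) \<le> norm (1 * of_real (ln (real n)) :: complex)" if "n \<ge> 1" for n
    using mangoldt_le[of n] that by simp
qed

lemma zeta_times_mangoldt:
  assumes "Re s > 1"
  shows "dser mangoldt s * zeta s = dser (\<lambda>n. of_real (ln (real n))) s"
proof (rule sums_unique2)
  show "(\<lambda>n. of_real (ln (real n)) * of_nat n powr (-s)) sums (dser mangoldt s * zeta s)"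
    by (intro dser_mult subpoly_mangoldt subpoly_const assms) (simp add: mangoldt_sum)
  show "(\<lambda>n. of_real (ln (real n)) * of_nat n powr (-s)) sums dser (\<lambda>n. of_real (ln (real n))) s"
    using dser_sums[OF subpoly_mult_ln[OF subpoly_const[of 1]] assms] by simp
qed

lemma deriv_zeta:
  assumes "Re s > 1"
  shows "(zeta has_field_derivative - (dser mangoldt s * zeta s)) (at s)"
  using has_field_derivative_dser[OF subpoly_const[of 1] assms] by (simp add: zeta_times_mangoldt[OF assms])

lemma dser_Re_sums:
  assumes "subpoly (\<lambda>n. of_real (a n))" "\<sigma> > 1"
  shows "(\<lambda>n. a n * real n powr (-\<sigma>) * cos (t * ln (real n))) sums Re (dser (\<lambda>n. of_real (a n)) (Complex \<sigma> t))"
proof -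
  have eq: "Re (of_real (a n) * of_nat n powr (- Complex \<sigma> t)) = a n * real n powr (-\<sigma>) * cos (t * ln (real n))" for n
  proof (cases "n = 0")
    case False
    then have "of_nat n powr (- Complex \<sigma> t) = exp (- Complex \<sigma> t * of_real (ln (real n)))"
      by (simp add: powr_def Ln_of_nat)
    also have "Re \<dots> = real n powr (-\<sigma>) * cos (t * ln (real n))"
      using False by (simp add: Re_exp powr_def)
    finally show ?thesis by simp
  qed simp
  have "(\<lambda>n. Re (of_real (a n) * of_nat n powr (- Complex \<sigma> t))) sums Re (dser (\<lambda>n. of_real (a n)) (Complex \<sigma> t))"
    by (intro sums_Re dser_sums assms) (use assms(2) in auto)
  then show ?thesis by (simp only: eq)
qed

text \<open>The constant in \<open>zeta_eq_exp\<close> needs one point where \<open>zeta\<close> is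
  nonzero. At 2 all terms are nonnegative and \<open>n = 1\<close> alone contributes 1.\<close>

lemma zeta_2_nonzero: "zeta 2 \<noteq> 0"
proof -
  have sm: "(\<lambda>n. 1 * real n powr (-2) * cos (0 * ln (real n))) sums Re (dser (\<lambda>n. of_real 1) (Complex 2 0))"
    using dser_Re_sums[of "\<lambda>_. 1" 2 0] subpoly_const[of 1] by simp
  have "(\<Sum>n\<in>{1}. 1 * real n powr (-2) * cos (0 * ln (real n))) \<le> Re (dser (\<lambda>n. of_real 1) (Complex 2 0))"
    using sm sum_le_suminf[of "\<lambda>n. 1 * real n powr (-2) * cos (0 * ln (real n))" "{1}"]
    by (auto simp: sums_iff)
  moreover have "Complex 2 0 = 2" by (simp add: complex_eq_iff)
  ultimately show ?thesis by auto
qed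

text \<open>The value is \<open>1 / k\<close> at a prime power \<open>p ^ k\<close> and 0 elsewhere
  (at 0 and 1 by division by zero): the coefficients of the logarithm of
  \<open>zeta\<close>.\<close>

definition mlog :: "nat \<Rightarrow> real" where
  "mlog n = mangoldt n / ln (real n)"

lemma mlog_nonneg: "mlog n \<ge> 0"
  using mangoldt_nonneg[of n] by (cases "n = 0") (auto simp: mlog_def)

lemma mlog_mult_ln: "mlog n * ln (real n) = mangoldt n"
  by (cases "n \<le> 1") (auto simp: mlog_def le_Suc_eq)

lemma subpoly_mlog: "subpoly (\<lambda>n. of_real (mlog n))"
proof (rule subpoly_mono[OF subpoly_const[of 1]])
  show "norm (of_real (mlog n) :: complex) \<le> norm (1::complex)" if "n \<ge> 1" for n
    using mangoldt_le[of n] mangoldt_nonneg[of n] that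
    by (cases "n = 1") (auto simp: mlog_def norm_divide divide_le_eq_1)
qed

text \<open>This stands in for the Euler product. The series with coefficients \<open>mlog\<close>
  has derivative \<open>- dser mangoldt\<close>, and \<open>zeta' = - dser mangoldt * zeta\<close>,
  so the quotient of the two sides has derivative 0 on a convex set.\<close>

lemma zeta_eq_exp:
  obtains C where "C \<noteq> 0" "\<And>s. Re s > 1 \<Longrightarrow> zeta s = C * exp (dser (\<lambda>n. of_real (mlog n)) s)"
proof -
  let ?a = "\<lambda>n. of_real (mlog n) :: complex"
  have eq: "?a n * of_real (ln (real n)) = mangoldt n" for n
    unfolding of_real_mult[symmetric] mlog_mult_ln by simp
  have d: "(dser ?a has_field_derivative - dser mangoldt s) (at s)" if "Re s > 1" for s
    using has_field_derivative_dser[OF subpoly_mlog that] unfolding eq by simp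
  let ?g = "\<lambda>s. zeta s * exp (- dser ?a s)"
  have "\<exists>c. \<forall>s\<in>{s. Re s > 1}. ?g s = c"
  proof (rule has_field_derivative_zero_constant)
    show "convex {s. Re s > 1}" by (rule convex_halfspace_Re_gt)
    show "(?g has_field_derivative 0) (at s within {s. Re s > 1})" if "s \<in> {s. Re s > 1}" for s
      by (rule has_field_derivative_at_within)
         (use that in \<open>auto intro!: derivative_eq_intros deriv_zeta d\<close>)
  qed
  then obtain C where C: "\<And>s. Re s > 1 \<Longrightarrow> ?g s = C" by blast
  show thesis
  proof (rule that)
    show "C \<noteq> 0" using C[of 2] zeta_2_nonzero by auto
    show "zeta s = C * exp (dser ?a s)" if "Re s > 1" for s
      using C[OF that] by (auto simp: exp_minus field_simps)
  qed
qed

lemma zeta_nonzero: "Re s > 1 \<Longrightarrow> zeta s \<noteq> 0"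
  using zeta_eq_exp by (metis exp_not_eq_zero no_zero_divisors)

text \<open>The logarithm of the product is, up to a constant, a series with coefficients
  \<open>mlog n \<ge> 0\<close> times \<open>3 + 4 * cos \<theta> + cos (2 * \<theta>) = 2 * (1 +
  cos \<theta>) ^ 2\<close>. The constant is \<open>norm C ^ 8\<close> with 8 = 3 + 4 + 1.\<close>

lemma zeta_341:
  obtains c where "c > 0" "\<And>\<sigma> t. \<sigma> > 1 \<Longrightarrow>
    c \<le> norm (zeta (of_real \<sigma>)) ^ 3 * norm (zeta (Complex \<sigma> t)) ^ 4 * norm (zeta (Complex \<sigma> (2 * t)))"
proof -
  let ?a = "\<lambda>n. of_real (mlog n) :: complex"
  obtain C where C: "C \<noteq> 0" "\<And>s. Re s > 1 \<Longrightarrow> zeta s = C * exp (dser ?a s)"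
    using zeta_eq_exp by metis
  have "norm C ^ 8 \<le> norm (zeta (of_real \<sigma>)) ^ 3 * norm (zeta (Complex \<sigma> t)) ^ 4 * norm (zeta (Complex \<sigma> (2 * t)))"
    if \<sigma>: "\<sigma> > 1" for \<sigma> t
  proof -
    define f where "f = (\<lambda>t n. mlog n * real n powr (-\<sigma>) * cos (t * ln (real n)))"
    have f: "f t sums Re (dser ?a (Complex \<sigma> t))" for t
      unfolding f_def by (rule dser_Re_sums[OF subpoly_mlog \<sigma>])
    let ?R = "3 * Re (dser ?a (Complex \<sigma> 0)) + 4 * Re (dser ?a (Complex \<sigma> t)) + Re (dser ?a (Complex \<sigma> (2 * t)))"
    have "0 \<le> ?R"
    proof (rule sums_le[OF _ sums_zero])
      show "(\<lambda>n. 3 * f 0 n + 4 * f t n + f (2 * t) n) sums ?R"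
        by (intro sums_add sums_mult f)
      fix n
      have "3 * f 0 n + 4 * f t n + f (2 * t) n
          = mlog n * real n powr (-\<sigma>) * (3 + 4 * cos (t * ln (real n)) + cos (2 * (t * ln (real n))))"
        by (simp add: f_def algebra_simps)
      also have "\<dots> = mlog n * real n powr (-\<sigma>) * (2 * (1 + cos (t * ln (real n)))\<^sup>2)"
        unfolding cos_double_cos by (simp add: power2_eq_square algebra_simps)
      also have "\<dots> \<ge> 0"
        using mlog_nonneg[of n] by auto
      finally show "0 \<le> 3 * f 0 n + 4 * f t n + f (2 * t) n" .
    qed
    have z: "norm (zeta (Complex \<sigma> t)) = norm C * exp (Re (dser ?a (Complex \<sigma> t)))" for t
      using C(2)[of "Complex \<sigma> t"] \<sigma> by (simp add: norm_mult norm_exp_eq_Re)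
    have "of_real \<sigma> = Complex \<sigma> 0" by (simp add: complex_eq_iff)
    then have "norm (zeta (of_real \<sigma>)) ^ 3 * norm (zeta (Complex \<sigma> t)) ^ 4 * norm (zeta (Complex \<sigma> (2 * t)))
      = norm C ^ 8 * exp ?R"
      by (simp add: z power_mult_distrib exp_add exp_of_nat_mult[symmetric] mult_ac flip: power_add)
        (simp add: eval_nat_numeral)
    also have "\<dots> \<ge> norm C ^ 8 * 1"
      using \<open>0 \<le> ?R\<close> by (intro mult_left_mono) auto
    finally show ?thesis by simp
  qed
  with C(1) that[of "norm C ^ 8"] show thesis by simp
qed

section \<open>Bounds for the zeta function near the line Re s = 1\<close>

definition gterm :: "nat \<Rightarrow> complex \<Rightarrow> complex" where
  "gterm n s = (s - 1) * of_nat n powr (-s) + of_nat (Suc n) powr (1 - s) - of_nat n powr (1 - s)"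

text \<open>The continuation of \<open>(s - 1) * zeta s\<close> to \<open>Re s > 0\<close>: the telescoping powers in \<open>gterm n s\<close> subtract
  \<open>(s - 1)\<close> times the integral of \<open>u powr (-s)\<close> over \<open>{n..n + 1}\<close>.\<close>
definition gz :: "complex \<Rightarrow> complex" where
  "gz s = 1 + (\<Sum>m. gterm (Suc m) s)"

lemma closed_segment_nat:
  fixes n :: nat
  assumes "n \<ge> 1" "z \<in> closed_segment (of_nat n :: complex) (of_nat (Suc n))"
  obtains u where "z = of_real u" "real n \<le> u" "u \<le> real n + 1" "u > 0"
proof -
  from assms(2) obtain v where v: "0 \<le> v" "v \<le> 1" "z = (1 - v) *\<^sub>R of_nat n + v *\<^sub>R of_nat (Suc n)"
    by (auto simp: closed_segment_def)
  have z: "z = of_real (real n + v)" unfolding v(3) by (simp add: scaleR_conv_of_real algebra_simps)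
  show thesis by (rule that[OF z]) (use v assms(1) in auto)
qed

text \<open>The right-hand side interpolates between the trivial bound (\<open>\<theta> = 0\<close>) and the mean value bound
  (\<open>\<theta> = 1\<close>).\<close>
lemma powr_diff_bound:
  assumes n: "n \<ge> (1::nat)" and s: "Re s \<ge> 0" and t: "0 \<le> \<theta>" "\<theta> \<le> 1"
    and z: "z \<in> closed_segment (of_nat n :: complex) (of_nat (Suc n))"
  shows "norm (of_nat n powr (-s) - z powr (-s)) \<le> 2 * real n powr (- Re s) * (norm s / real n) powr \<theta>"
proof (cases "norm s / real n \<le> 1")
  case True
  let ?S = "closed_segment (of_nat n :: complex) (of_nat (Suc n))"
  have "norm (of_nat n powr (-s) - z powr (-s)) \<le> (norm s * real n powr (- Re s - 1)) * norm (of_nat n - z)"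
  proof (rule field_differentiable_bound[of ?S _ "\<lambda>w. -s * w powr (-s-1)"])
    fix w assume "w \<in> ?S"
    then obtain u where u: "w = of_real u" "real n \<le> u" "u \<le> real n + 1" "u > 0"
      using closed_segment_nat[OF n] by metis
    show "((\<lambda>z. z powr (-s)) has_field_derivative -s * w powr (-s-1)) (at w within ?S)"
      by (rule has_field_derivative_at_within, rule has_field_derivative_powr) (use u in auto)
    have "norm (w powr (-s-1)) = u powr (- Re s - 1)" using u by (simp add: norm_powr_real_powr)
    also have "\<dots> \<le> real n powr (- Re s - 1)" using u n s by (intro powr_mono2') auto
    finally show "norm (-s * w powr (-s-1)) \<le> norm s * real n powr (- Re s - 1)"
      by (simp add: norm_mult mult_left_mono)
  qed (use z in auto)
  also have "\<dots> \<le> (norm s * real n powr (- Re s - 1)) * 1"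
  proof (intro mult_left_mono)
    obtain u where u: "z = of_real u" "real n \<le> u" "u \<le> real n + 1" "u > 0"
      using closed_segment_nat[OF n z] by metis
    have "norm (of_nat n - z) = \<bar>real n - u\<bar>" unfolding u(1) by (metis norm_of_real of_real_diff of_real_of_nat_eq)
    then show "norm (of_nat n - z) \<le> 1" using u by simp
  qed auto
  also have "\<dots> = real n powr (- Re s) * (norm s / real n) powr 1"
    using n by (simp add: powr_diff)
  also have "\<dots> \<le> real n powr (- Re s) * (norm s / real n) powr \<theta>"
    by (rule mult_left_mono, rule powr_mono') (use True t in auto)
  also have "\<dots> \<le> 2 * \<dots>" by simp
  finally show ?thesis by (simp add: mult_ac)
next
  case False
  obtain u where u: "z = of_real u" "real n \<le> u" "u \<le> real n + 1" "u > 0"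
    using closed_segment_nat[OF n z] by metis
  have "norm (of_nat n powr (-s) - z powr (-s)) \<le> real n powr (- Re s) + u powr (- Re s)"
    using norm_triangle_ineq4[of "of_nat n powr (-s)" "z powr (-s)"] u
    by (simp add: norm_of_nat_powr norm_powr_real_powr)
  also have "u powr (- Re s) \<le> real n powr (- Re s)" using u n s by (intro powr_mono2') auto
  also have "real n powr (- Re s) + real n powr (- Re s) = 2 * real n powr (- Re s) * 1" by simp
  also have "\<dots> \<le> 2 * real n powr (- Re s) * (norm s / real n) powr \<theta>"
    using False t by (intro mult_left_mono ge_one_powr_ge_zero) auto
  finally show ?thesis by simp
qed

text \<open>\<open>gterm n s\<close> is the increment of \<open>?f\<close> over
  \<open>{n..n + 1}\<close>, and the derivative of \<open>?f\<close> is \<open>s - 1\<close> times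
  the difference bounded in \<open>powr_diff_bound\<close>. The free \<open>\<theta>\<close> has two
  uses: 1 for convergence on \<open>Re s > 0\<close>, a small value for slow growth in
  \<open>Im s\<close>.\<close>

lemma norm_gterm_le:
  assumes n: "n \<ge> (1::nat)" and s: "Re s \<ge> 0" and t: "0 \<le> \<theta>" "\<theta> \<le> 1"
  shows "norm (gterm n s) \<le> norm (s - 1) * (2 * real n powr (- Re s) * (norm s / real n) powr \<theta>)"
proof -
  let ?S = "closed_segment (of_nat n :: complex) (of_nat (Suc n))"
  let ?f = "\<lambda>z. (s - 1) * (z - of_nat n) * of_nat n powr (-s) + z powr (1 - s)"
  let ?B = "norm (s - 1) * (2 * real n powr (- Re s) * (norm s / real n) powr \<theta>)"
  have "norm (?f (of_nat (Suc n)) - ?f (of_nat n)) \<le> ?B * norm (of_nat (Suc n) - of_nat n :: complex)"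
  proof (rule field_differentiable_bound[of ?S ?f "\<lambda>w. (s - 1) * (of_nat n powr (-s) - w powr (-s))" ?B])
    fix w assume w: "w \<in> ?S"
    then obtain u where u: "w = of_real u" "real n \<le> u" "u \<le> real n + 1" "u > 0"
      using closed_segment_nat[OF n] by metis
    have "((\<lambda>z. z powr (1-s)) has_field_derivative (1-s) * w powr (1-s-1)) (at w)"
      by (rule has_field_derivative_powr) (use u in auto)
    then have "(?f has_field_derivative (s - 1) * of_nat n powr (-s) + (1-s) * w powr (1-s-1)) (at w)"
      by (intro DERIV_add) (auto intro!: derivative_eq_intros)
    also have "(s - 1) * of_nat n powr (-s) + (1-s) * w powr (1-s-1) = (s - 1) * (of_nat n powr (-s) - w powr (-s))"
      by (simp add: algebra_simps)
    finally show "(?f has_field_derivative (s - 1) * (of_nat n powr (-s) - w powr (-s))) (at w within ?S)"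
      by (rule has_field_derivative_at_within)
    show "norm ((s - 1) * (of_nat n powr (-s) - w powr (-s))) \<le> ?B"
      unfolding norm_mult by (intro mult_left_mono powr_diff_bound n s t w) auto
  qed auto
  then show ?thesis by (simp add: gterm_def algebra_simps)
qed

lemma gterm_sums_gz:
  assumes "Re s > 0"
  shows "(\<lambda>m. gterm (Suc m) s) sums (gz s - 1)" "gz holomorphic_on {s. Re s > 0}"
proof -
  let ?S = "{s. Re s > 0}"
  obtain g where g: "\<forall>x\<in>?S. ((\<lambda>m. gterm (Suc m) x) sums g x) \<and> g field_differentiable (at x)"
  proof (rule series_differentiable_comparison_complex[of ?S "\<lambda>m. gterm (Suc m)"])
    show "open ?S" by (rule open_halfspace_Re_gt)
    fix n x
    have "(\<lambda>s. of_nat (Suc m) powr (c - s)) field_differentiable at x" for m and c :: complex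
      by (rule holomorphic_on_imp_differentiable_at[OF _ open_UNIV]) (auto intro!: holomorphic_intros)
    from this[of n 0] this[of "Suc n" 1] this[of n 1]
    show "gterm (Suc n) field_differentiable at x"
      unfolding gterm_def[abs_def] by (intro derivative_intros) (simp_all del: of_nat_Suc)
  next
    fix x assume x: "x \<in> ?S"
    define \<sigma> where "\<sigma> = Re x / 2"
    \<comment> \<open>\<open>M\<close> bounds both \<open>norm y\<close> and
      \<open>norm (y - 1)\<close> on the ball. With \<open>\<theta> = 1\<close> the terms are of
      order \<open>n powr (- \<sigma> - 1)\<close>.\<close>
    define M where "M = norm x + \<sigma> + 1"
    define h where "h = (\<lambda>n. M * (2 * real (Suc n) powr (- \<sigma> - 1) * M))"
    have \<sigma>: "\<sigma> > 0" using x by (simp add: \<sigma>_def)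
    have M: "M > 0" using \<sigma> by (simp add: M_def add_nonneg_pos)
    have "summable (\<lambda>n. real n powr (- \<sigma> - 1))" using \<sigma> by (simp add: summable_real_powr_iff)
    then have "summable (\<lambda>n. real (Suc n) powr (- \<sigma> - 1))" by (subst summable_Suc_iff)
    then have h: "summable h" unfolding h_def by (intro summable_mult summable_mult2)
    have h0: "h n \<ge> 0" for n using M by (simp add: h_def)
    have "norm (gterm (Suc n) y) \<le> h n" if "y \<in> ball x \<sigma>" for n y
    proof -
      have xy: "norm (x - y) < \<sigma>" using that by (simp add: dist_norm)
      have ny: "norm y \<le> norm x + \<sigma>" using norm_triangle_ineq4[of x "x - y"] xy by simp
      have Re: "Re y \<ge> \<sigma>" using complex_Re_le_cmod[of "x - y"] xy by (simp add: \<sigma>_def)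
      have ny1: "norm (y - 1) \<le> M" using norm_triangle_ineq4[of y 1] ny by (simp add: M_def)
      have "norm (gterm (Suc n) y) \<le> norm (y - 1) * (2 * real (Suc n) powr (- Re y) * (norm y / real (Suc n)) powr 1)"
        using \<sigma> Re by (intro norm_gterm_le) auto
      also have "\<dots> = norm (y - 1) * (2 * real (Suc n) powr (- Re y - 1) * norm y)"
        by (simp add: powr_diff)
      also have "\<dots> \<le> M * (2 * real (Suc n) powr (- \<sigma> - 1) * M)"
        using \<sigma> Re ny ny1 M by (intro mult_mono powr_mono) (auto simp: M_def)
      finally show ?thesis by (simp add: h_def)
    qed
    then show "\<exists>d h. 0 < d \<and> summable h \<and> range h \<subseteq> \<real>\<^sub>\<ge>\<^sub>0 \<and>
       (\<forall>\<^sub>F n in sequentially. \<forall>y\<in>ball x d \<inter> ?S. cmod (gterm (Suc n) y) \<le> cmod (h n))"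
      by (intro exI[of _ \<sigma>] exI[of _ "\<lambda>n. of_real (h n)"])
         (use \<sigma> h h0 in \<open>auto intro!: summable_of_real eventuallyI\<close>)
  qed blast
  have eq: "g x = gz x - 1" if "x \<in> ?S" for x
    using g that by (auto simp: gz_def sums_iff)
  show "(\<lambda>m. gterm (Suc m) s) sums (gz s - 1)" using g eq[of s] assms by auto
  have "gz field_differentiable (at x)" if x: "x \<in> ?S" for x
  proof -
    have "(\<lambda>x. g x + 1) field_differentiable (at x)" using g x by (intro derivative_intros) auto
    then obtain D where "((\<lambda>x. g x + 1) has_field_derivative D) (at x)"
      by (auto simp: field_differentiable_def)
    then have "(gz has_field_derivative D) (at x)"
      by (rule has_field_derivative_transform_within_open[OF _ open_halfspace_Re_gt[of 0]])
         (use x eq in auto)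
    then show ?thesis by (auto simp: field_differentiable_def)
  qed
  then show "gz holomorphic_on ?S"
    by (auto simp: holomorphic_on_def intro: field_differentiable_at_within)
qed

lemma gz_1 [simp]: "gz 1 = 1"
  by (simp add: gz_def gterm_def del: of_nat_Suc)

text \<open>For \<open>Re s > 1\<close> the telescoping powers sum to -1, which the leading 1 in
  \<open>gz\<close> cancels.\<close>

lemma gz_eq_zeta:
  assumes s: "Re s > 1"
  shows "gz s = (s - 1) * zeta s"
proof -
  have "(\<lambda>n. 1 * of_nat n powr (-s)) sums zeta s"
    by (rule dser_sums[OF subpoly_const s])
  then have "(\<lambda>m. of_nat (Suc m) powr (-s)) sums zeta s"
    using sums_Suc_iff[of "\<lambda>n. of_nat n powr (-s)" "zeta s"] by (simp del: of_nat_Suc)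
  then have 1: "(\<lambda>m. (s - 1) * of_nat (Suc m) powr (-s)) sums ((s - 1) * zeta s)"
    by (rule sums_mult)
  have "(\<lambda>m. norm (of_nat (Suc m) powr (1 - s) :: complex)) \<longlonglongrightarrow> 0"
  proof -
    have "(\<lambda>m. real m powr (1 - Re s)) \<longlonglongrightarrow> 0" using s by real_asymp
    then have "(\<lambda>m. real (Suc m) powr (1 - Re s)) \<longlonglongrightarrow> 0" by (rule LIMSEQ_Suc)
    then show ?thesis by (simp add: norm_of_nat_powr del: of_nat_Suc)
  qed
  then have "(\<lambda>m. of_nat (Suc m) powr (1 - s) :: complex) \<longlonglongrightarrow> 0"
    by (rule tendsto_norm_zero_cancel)
  from telescope_sums[OF this]
  have 2: "(\<lambda>m. of_nat (Suc (Suc m)) powr (1 - s) - of_nat (Suc m) powr (1 - s)) sums (-1 :: complex)"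
    by simp
  have "(\<lambda>m. gterm (Suc m) s) sums ((s - 1) * zeta s + (-1))"
    using sums_add[OF 1 2] by (simp add: gterm_def algebra_simps)
  then have "gz s - 1 = (s - 1) * zeta s + (-1)"
    using gterm_sums_gz(1)[of s] s sums_unique2 by fastforce
  then show ?thesis by simp
qed

text \<open>The continuation of \<open>zeta\<close> to \<open>Re s > 0\<close>. At the pole the
  value is 0 by division by zero, so 1 is excluded wherever analyticity is used.\<close>

definition zt :: "complex \<Rightarrow> complex" where "zt s = gz s / (s - 1)"

lemma zt_eq_zeta: "Re s > 1 \<Longrightarrow> zt s = zeta s"
  by (auto simp: zt_def gz_eq_zeta)

lemma zt_holomorphic: "zt holomorphic_on {s. Re s > 0} - {1}"
  unfolding zt_def
  by (intro holomorphic_intros holomorphic_on_subset[OF gterm_sums_gz(2)[of 1]]) auto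

text \<open>Doubling the height, moving it by at most 1, or passing from \<open>Im s\<close> to
  \<open>norm s\<close> in a strip of bounded width costs at most a factor 2.\<close>

lemma powr_shift_bound:
  assumes "0 \<le> (x::real)" "x \<le> 2 * (2 + \<bar>t\<bar>)"
  shows "x powr (1/50) \<le> 2 * (2 + \<bar>t\<bar>) powr (1/50)"
proof -
  have "x powr (1/50) \<le> (2 * (2 + \<bar>t\<bar>)) powr (1/50)" using assms by (intro powr_mono2) auto
  also have "\<dots> = 2 powr (1/50) * (2 + \<bar>t\<bar>) powr (1/50)" by (rule powr_mult)
  also have "\<dots> \<le> 2 powr 1 * (2 + \<bar>t\<bar>) powr (1/50)" by (intro mult_right_mono powr_mono) auto
  finally show ?thesis by simp
qed

text \<open>With \<open>\<theta> = 1/50\<close> the terms of \<open>gz\<close> decay with exponent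
  at most \<open>-99/100 - 1/50 = -101/100\<close>, so the series still converges to the left of 1,
  at the price \<open>norm s powr (1/50)\<close>. The exponent is this small because the 25th power
  of the bound is taken in \<open>higher_deriv_logderiv_diff_bound_far\<close>.\<close>

lemma zt_bound:
  assumes \<tau>: "\<tau> > 0"
  obtains C where "C > 0" "\<And>s. 99/100 \<le> Re s \<Longrightarrow> Re s \<le> 3 \<Longrightarrow> \<tau> \<le> \<bar>Im s\<bar> \<Longrightarrow>
    norm (zt s) \<le> C * (2 + \<bar>Im s\<bar>) powr (1/50)"
proof -
  define K where "K = (\<Sum>m. real (Suc m) powr (-101/100))"
  have smK: "summable (\<lambda>m. real (Suc m) powr (-101/100))"
    by (subst summable_Suc_iff) (simp add: summable_real_powr_iff)
  have K: "K \<ge> 0" unfolding K_def by (intro suminf_nonneg smK) auto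
  have "norm (zt s) \<le> (1 / \<tau> + 4 * K) * (2 + \<bar>Im s\<bar>) powr (1/50)"
    if s: "99/100 \<le> Re s" "Re s \<le> 3" "\<tau> \<le> \<bar>Im s\<bar>" for s
  proof -
    have s1: "norm (s - 1) \<ge> \<tau>" using abs_Im_le_cmod[of "s - 1"] s by simp
    have gt: "norm (gterm (Suc m) s) \<le> (norm (s - 1) * 2 * norm s powr (1/50)) * real (Suc m) powr (-101/100)" for m
    proof -
      have "norm (gterm (Suc m) s) \<le> norm (s - 1) * (2 * real (Suc m) powr (- Re s) * (norm s / real (Suc m)) powr (1/50))"
        using s by (intro norm_gterm_le) auto
      also have "\<dots> = (norm (s - 1) * 2 * norm s powr (1/50)) * (real (Suc m) powr (- Re s) * real (Suc m) powr (- (1/50)))"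
        by (simp add: powr_divide powr_minus_divide)
      also have "real (Suc m) powr (- Re s) * real (Suc m) powr (- (1/50)) = real (Suc m) powr (- Re s - 1/50)"
        by (simp flip: powr_add)
      also have "\<dots> \<le> real (Suc m) powr (-101/100)"
        using s by (intro powr_mono) auto
      finally show ?thesis by (simp add: mult_left_mono)
    qed
    have "norm (gz s - 1) \<le> (norm (s - 1) * 2 * norm s powr (1/50)) * K"
    proof -
      have "norm (\<Sum>m. gterm (Suc m) s) \<le> (\<Sum>m. (norm (s - 1) * 2 * norm s powr (1/50)) * real (Suc m) powr (-101/100))"
        by (intro norm_suminf_le gt summable_mult smK)
      then show ?thesis
        using suminf_mult[OF smK, of "norm (s - 1) * 2 * norm s powr (1/50)"]
        unfolding K_def by (simp add: gz_def del: of_nat_Suc)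
    qed
    moreover have "norm (gz s) \<le> 1 + norm (gz s - 1)" using norm_triangle_ineq[of 1 "gz s - 1"] by simp
    ultimately have "norm (zt s) \<le> (1 + (norm (s - 1) * 2 * norm s powr (1/50)) * K) / norm (s - 1)"
      unfolding zt_def norm_divide by (intro divide_right_mono) auto
    also have "\<dots> = 1 / norm (s - 1) + 2 * K * norm s powr (1/50)"
    proof -
      have "norm (s - 1) \<noteq> 0" using s1 \<tau> by linarith
      then show ?thesis by (simp add: add_divide_distrib)
    qed
    also have "\<dots> \<le> 1 / \<tau> * (2 + \<bar>Im s\<bar>) powr (1/50) + 2 * K * (2 * (2 + \<bar>Im s\<bar>) powr (1/50))"
    proof (intro add_mono mult_left_mono)
      have "1 / norm (s - 1) \<le> 1 / \<tau> * 1" using s1 \<tau> by (simp add: frac_le)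
      also have "\<dots> \<le> 1 / \<tau> * (2 + \<bar>Im s\<bar>) powr (1/50)"
        using \<tau> by (intro mult_left_mono ge_one_powr_ge_zero) auto
      finally show "1 / norm (s - 1) \<le> 1 / \<tau> * (2 + \<bar>Im s\<bar>) powr (1/50)" .
      have "norm s \<le> 2 * (2 + \<bar>Im s\<bar>)" using cmod_le[of s] s by simp
      then show "norm s powr (1/50) \<le> 2 * (2 + \<bar>Im s\<bar>) powr (1/50)" by (intro powr_shift_bound) auto
    qed (use K in auto)
    finally show ?thesis by (simp add: algebra_simps)
  qed
  with \<tau> K that[of "1 / \<tau> + 4 * K"] show thesis by (simp add: add_pos_nonneg)
qed

lemma zt_deriv_bound:
  assumes \<tau>: "\<tau> > 0"
  obtains C where "C > 0"
    "\<And>s. 199/200 \<le> Re s \<Longrightarrow> Re s \<le> 2 \<Longrightarrow> \<tau> \<le> \<bar>Im s\<bar> \<Longrightarrow> norm (zt s) \<le> C * (2 + \<bar>Im s\<bar>) powr (1/50)"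
    "\<And>s. 199/200 \<le> Re s \<Longrightarrow> Re s \<le> 2 \<Longrightarrow> \<tau> \<le> \<bar>Im s\<bar> \<Longrightarrow> norm (deriv zt s) \<le> C * (2 + \<bar>Im s\<bar>) powr (1/50)"
proof -
  obtain C where C: "C > 0" "\<And>s. 99/100 \<le> Re s \<Longrightarrow> Re s \<le> 3 \<Longrightarrow> \<tau>/2 \<le> \<bar>Im s\<bar> \<Longrightarrow>
    norm (zt s) \<le> C * (2 + \<bar>Im s\<bar>) powr (1/50)"
    using zt_bound[of "\<tau>/2"] \<tau> by auto
  \<comment> \<open>The disc about \<open>s\<close> must stay in \<open>Re z \<ge> 99/100\<close>,
    which needs 1/200, and away from the pole, which needs \<open>\<tau> / 2\<close>.\<close>
  define r where "r = min (1/200) (\<tau>/2)"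
  have r: "r > 0" "r \<le> 1/200" "r \<le> \<tau>/2" using \<tau> by (auto simp: r_def)
  have d: "norm (deriv zt s) \<le> (2 * C / r) * (2 + \<bar>Im s\<bar>) powr (1/50)"
    if s: "199/200 \<le> Re s" "Re s \<le> 2" "\<tau> \<le> \<bar>Im s\<bar>" for s
  proof -
    have in_cball: "99/100 \<le> Re z \<and> Re z \<le> 3 \<and> \<tau>/2 \<le> \<bar>Im z\<bar> \<and> \<bar>Im z\<bar> \<le> \<bar>Im s\<bar> + 1"
      if "z \<in> cball s r" for z
      using that abs_Re_le_cmod[of "s - z"] abs_Im_le_cmod[of "s - z"] r s by (auto simp: dist_norm)
    have sub: "cball s r \<subseteq> {s. Re s > 0} - {1}"
    proof
      fix z assume "z \<in> cball s r"
      from in_cball[OF this] \<tau> show "z \<in> {s. Re s > 0} - {1}" by auto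
    qed
    have "norm ((deriv ^^ 1) zt s) \<le> fact 1 * (2 * C * (2 + \<bar>Im s\<bar>) powr (1/50)) / r ^ 1"
    proof (rule Cauchy_inequality)
      show "zt holomorphic_on ball s r"
        by (rule holomorphic_on_subset[OF zt_holomorphic]) (use sub ball_subset_cball in blast)
      show "continuous_on (cball s r) zt"
        by (rule holomorphic_on_imp_continuous_on, rule holomorphic_on_subset[OF zt_holomorphic sub])
      fix z assume "norm (s - z) = r"
      then have "z \<in> cball s r" by (simp add: dist_norm)
      note z = in_cball[OF this]
      have "norm (zt z) \<le> C * (2 + \<bar>Im z\<bar>) powr (1/50)" using z by (intro C) auto
      also have "\<dots> \<le> C * (2 * (2 + \<bar>Im s\<bar>) powr (1/50))"
        using z C(1) by (intro mult_left_mono powr_shift_bound) auto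
      finally show "norm (zt z) \<le> 2 * C * (2 + \<bar>Im s\<bar>) powr (1/50)" by simp
    qed (use r in auto)
    then show ?thesis by simp
  qed
  show thesis
  proof (rule that[of "max C (2 * C / r)"])
    fix s assume s: "199/200 \<le> Re s" "Re s \<le> 2" "\<tau> \<le> \<bar>Im s\<bar>"
    have "norm (zt s) \<le> C * (2 + \<bar>Im s\<bar>) powr (1/50)" using s \<tau> by (intro C) auto
    also have "\<dots> \<le> max C (2 * C / r) * (2 + \<bar>Im s\<bar>) powr (1/50)" by (intro mult_right_mono) auto
    finally show "norm (zt s) \<le> max C (2 * C / r) * (2 + \<bar>Im s\<bar>) powr (1/50)" .
    have "norm (deriv zt s) \<le> (2 * C / r) * (2 + \<bar>Im s\<bar>) powr (1/50)" using s by (rule d)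
    also have "\<dots> \<le> max C (2 * C / r) * (2 + \<bar>Im s\<bar>) powr (1/50)" by (intro mult_right_mono) auto
    finally show "norm (deriv zt s) \<le> max C (2 * C / r) * (2 + \<bar>Im s\<bar>) powr (1/50)" .
  qed (use C in auto)
qed

section \<open>Lower bounds for zeta and nonvanishing on the line Re s = 1\<close>

lemma zeta_real_bound:
  obtains M where "M > 0" "\<And>\<sigma>. 1 < \<sigma> \<Longrightarrow> \<sigma> \<le> 2 \<Longrightarrow> norm (zeta (of_real \<sigma>)) \<le> M / (\<sigma> - 1)"
proof -
  have cont: "continuous_on {s. Re s > 0} gz"
    by (rule holomorphic_on_imp_continuous_on[OF gterm_sums_gz(2)[of 1]]) auto
  have "continuous_on {1..2} (\<lambda>\<sigma>::real. gz (of_real \<sigma>))"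
    by (rule continuous_on_compose2[OF cont]) (auto intro!: continuous_intros)
  then have "bounded ((\<lambda>\<sigma>::real. gz (of_real \<sigma>)) ` {1..2})"
    by (intro compact_imp_bounded compact_continuous_image) auto
  then obtain M where M: "M > 0" "\<And>\<sigma>. \<sigma> \<in> {1..2::real} \<Longrightarrow> norm (gz (of_real \<sigma>)) \<le> M"
    unfolding bounded_pos by auto
  have "norm (zeta (of_real \<sigma>)) \<le> M / (\<sigma> - 1)" if "1 < \<sigma>" "\<sigma> \<le> 2" for \<sigma>
  proof -
    have "norm (gz (of_real \<sigma>)) = norm (of_real (\<sigma> - 1) * zeta (of_real \<sigma>))"
      using gz_eq_zeta[of "of_real \<sigma>"] that by simp
    also have "\<dots> = (\<sigma> - 1) * norm (zeta (of_real \<sigma>))"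
      unfolding norm_mult norm_of_real using that by simp
    finally have "norm (gz (of_real \<sigma>)) = (\<sigma> - 1) * norm (zeta (of_real \<sigma>))" .
    then show ?thesis using M(2)[of \<sigma>] that by (simp add: field_simps)
  qed
  with M(1) that show thesis by blast
qed

text \<open>The parameters balance the two ways of bounding \<open>zt\<close> from below: the 3-4-1 inequality at
  abscissa \<open>1 + \<delta>\<close> with \<open>\<delta> = c / (16 * V ^ 5)\<close> gives \<open>2 * V * \<delta>\<close>, and moving left from there
  by at most \<open>3/2 * \<delta>\<close> costs at most \<open>3/2 * V * \<delta>\<close>.\<close>
lemma zt_lower_bound:
  assumes \<tau>: "\<tau> > 0"
  obtains C c where "C \<ge> 1" "0 < c" "c \<le> 1/10"
    "\<And>s V. V \<ge> C * (2 + \<bar>Im s\<bar>) powr (1/50) \<Longrightarrow> 1 - c / (32 * V ^ 5) \<le> Re s \<Longrightarrow> Re s \<le> 3/2 \<Longrightarrow> \<tau> \<le> \<bar>Im s\<bar> \<Longrightarrow>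
      norm (zt s) \<le> V \<and> norm (deriv zt s) \<le> V \<and> norm (zt s) \<ge> c / (32 * V ^ 4)"
proof -
  obtain C0 where C0: "C0 > 0"
    "\<And>s. 199/200 \<le> Re s \<Longrightarrow> Re s \<le> 2 \<Longrightarrow> \<tau> \<le> \<bar>Im s\<bar> \<Longrightarrow> norm (zt s) \<le> C0 * (2 + \<bar>Im s\<bar>) powr (1/50)"
    "\<And>s. 199/200 \<le> Re s \<Longrightarrow> Re s \<le> 2 \<Longrightarrow> \<tau> \<le> \<bar>Im s\<bar> \<Longrightarrow> norm (deriv zt s) \<le> C0 * (2 + \<bar>Im s\<bar>) powr (1/50)"
    using zt_deriv_bound[OF \<tau>] by metis
  obtain M where M: "M > 0" "\<And>\<sigma>. 1 < \<sigma> \<Longrightarrow> \<sigma> \<le> 2 \<Longrightarrow> norm (zeta (of_real \<sigma>)) \<le> M / (\<sigma> - 1)"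
    using zeta_real_bound by metis
  obtain c0 where c0: "c0 > 0" "\<And>\<sigma> t. \<sigma> > 1 \<Longrightarrow>
    c0 \<le> norm (zeta (of_real \<sigma>)) ^ 3 * norm (zeta (Complex \<sigma> t)) ^ 4 * norm (zeta (Complex \<sigma> (2 * t)))"
    using zeta_341 by metis
  \<comment> \<open>The factor 2 in \<open>C\<close> pays for the doubled height in the 3-4-1
    inequality. The bound \<open>c \<le> 1/10\<close> gives \<open>\<delta> \<le> 1/160\<close>, so
    that \<open>1 - \<delta> / 2\<close> stays to the right of 199/200; the other bound on
    \<open>c\<close> absorbs the constants of the pole and of the 3-4-1 inequality.\<close>
  define C where "C = max 1 (2 * C0)"
  define c where "c = min (1/10) (c0 / M ^ 3)"
  have c: "0 < c" "c \<le> 1/10" "c \<le> c0 / M ^ 3"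
  proof -
    show "0 < c" using M c0 by (simp add: c_def)
  qed (unfold c_def, rule min.cobounded1, rule min.cobounded2)
  have "norm (zt s) \<le> V \<and> norm (deriv zt s) \<le> V \<and> norm (zt s) \<ge> c / (32 * V ^ 4)"
    if V: "V \<ge> C * (2 + \<bar>Im s\<bar>) powr (1/50)" and s: "1 - c / (32 * V ^ 5) \<le> Re s" "Re s \<le> 3/2" "\<tau> \<le> \<bar>Im s\<bar>" for s V
  proof -
    define t where "t = Im s"
    define \<delta> where "\<delta> = c / (16 * V ^ 5)"
    have V1: "V \<ge> 1"
    proof -
      have "1 * 1 \<le> C * (2 + \<bar>Im s\<bar>) powr (1/50)"
        by (intro mult_mono ge_one_powr_ge_zero) (auto simp: C_def)
      with V show ?thesis by linarith
    qed
    have V2: "2 * C0 * (2 + \<bar>t\<bar>) powr (1/50) \<le> V"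
    proof -
      have "2 * C0 * (2 + \<bar>t\<bar>) powr (1/50) \<le> C * (2 + \<bar>t\<bar>) powr (1/50)"
        by (intro mult_right_mono) (auto simp: C_def)
      with V show ?thesis by (simp add: t_def)
    qed
    have V3: "C0 * (2 + \<bar>t\<bar>) powr (1/50) \<le> V"
    proof -
      have "C0 * (2 + \<bar>t\<bar>) powr (1/50) \<ge> 0" using C0(1) by simp
      with V2 show ?thesis by linarith
    qed
    have \<delta>: "\<delta> > 0" "\<delta> \<le> 1/160"
    proof -
      show "\<delta> > 0" using c V1 by (simp add: \<delta>_def)
      have "V ^ 5 \<ge> 1" using V1 by simp
      then have "\<delta> \<le> c / (16 * 1)" unfolding \<delta>_def using c V1 by (intro divide_left_mono mult_left_mono) auto
      then show "\<delta> \<le> 1/160" using c by simp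
    qed
    have c_eq: "c = 16 * V ^ 5 * \<delta>" using V1 by (simp add: \<delta>_def)
    have s': "1 - \<delta> / 2 \<le> Re s" using s by (simp add: \<delta>_def)
    have ub: "norm (zt (Complex \<sigma> t)) \<le> V" "norm (deriv zt (Complex \<sigma> t)) \<le> V"
      if "199/200 \<le> \<sigma>" "\<sigma> \<le> 2" for \<sigma>
      using C0(2,3)[of "Complex \<sigma> t"] that V3 s by (auto simp: t_def)
    have ub2: "norm (zt (Complex \<sigma> (2 * t))) \<le> V" if "199/200 \<le> \<sigma>" "\<sigma> \<le> 2" for \<sigma>
    proof -
      have "norm (zt (Complex \<sigma> (2 * t))) \<le> C0 * (2 + \<bar>2 * t\<bar>) powr (1/50)"
        using C0(2)[of "Complex \<sigma> (2 * t)"] that s \<tau> by (auto simp: t_def)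
      also have "\<dots> \<le> C0 * (2 * (2 + \<bar>t\<bar>) powr (1/50))"
        using C0(1) by (intro mult_left_mono powr_shift_bound) auto
      finally show ?thesis using V2 by simp
    qed
    have right: "norm (zt (Complex \<sigma> t)) \<ge> 2 * V * \<delta>" if \<sigma>: "1 + \<delta> \<le> \<sigma>" "\<sigma> \<le> 2" for \<sigma>
    proof -
      have \<sigma>1: "\<sigma> > 1" "\<sigma> - 1 > 0" using \<sigma> \<delta> by auto
      let ?z = "norm (zt (Complex \<sigma> t))"
      have "c0 \<le> norm (zeta (of_real \<sigma>)) ^ 3 * ?z ^ 4 * norm (zt (Complex \<sigma> (2 * t)))"
        using c0(2)[OF \<sigma>1(1), of t] \<sigma>1 by (simp add: zt_eq_zeta)
      also have "\<dots> \<le> (M / (\<sigma> - 1)) ^ 3 * ?z ^ 4 * V"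
        using \<sigma> \<sigma>1 M by (intro mult_mono power_mono ub2 order.refl) auto
      also have "\<dots> \<le> (M / \<delta>) ^ 3 * ?z ^ 4 * V"
        using \<sigma> \<sigma>1 M \<delta> V1 by (intro mult_right_mono power_mono divide_left_mono) auto
      finally have "c0 \<le> M ^ 3 * (?z ^ 4 * V) / \<delta> ^ 3" by (simp add: power_divide mult_ac)
      then have "c0 / M ^ 3 \<le> ?z ^ 4 * V / \<delta> ^ 3"
        using M \<delta> by (simp add: field_simps)
      then have "c \<le> ?z ^ 4 * V / \<delta> ^ 3" using c by linarith
      \<comment> \<open>Since \<open>c = 16 * V ^ 5 * \<delta>\<close>, the left side is
        \<open>(2 * V * \<delta>) ^ 4 * V\<close>. This is what makes \<open>\<delta>\<close> a
        multiple of \<open>1 / V ^ 5\<close>.\<close>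
      then have "16 * V ^ 5 * \<delta> * \<delta> ^ 3 \<le> ?z ^ 4 * V"
        using \<delta> unfolding c_eq by (simp add: field_simps)
      then have "(2 * V * \<delta>) ^ 4 * V \<le> ?z ^ 4 * V"
        by (simp add: power_mult_distrib eval_nat_numeral mult_ac)
      then have "(2 * V * \<delta>) ^ 4 \<le> ?z ^ 4" using V1 by simp
      then show ?thesis using power_le_imp_le_base[of "2 * V * \<delta>" 3 ?z] by (simp add: numeral_eq_Suc)
    qed
    have low: "norm (zt s) \<ge> V * \<delta> / 2"
    proof (cases "Re s \<ge> 1 + \<delta>")
      case True
      have "norm (zt s) \<ge> 2 * V * \<delta>" using right[of "Re s"] True s by (simp add: t_def)
      moreover have "V * \<delta> \<ge> 0" using V1 \<delta> by simp
      ultimately show ?thesis by linarith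
    next
      case False
      let ?w = "Complex (1 + \<delta>) t"
      have seg: "\<exists>\<sigma>. z = Complex \<sigma> t \<and> 199/200 \<le> \<sigma> \<and> \<sigma> \<le> 2" if "z \<in> closed_segment s ?w" for z
      proof -
        obtain u where u: "0 \<le> u" "u \<le> 1" "z = (1 - u) *\<^sub>R s + u *\<^sub>R ?w"
          using \<open>z \<in> closed_segment s ?w\<close> by (auto simp: closed_segment_def)
        have "Im z = t" by (simp add: u t_def algebra_simps)
        have Rez: "Re z = (1 - u) * Re s + u * (1 + \<delta>)" by (simp add: u algebra_simps)
        have "199/200 = (1 - u) * (199/200) + u * (199/200)" by algebra
        also have "\<dots> \<le> (1 - u) * Re s + u * (1 + \<delta>)"
          using u \<delta> s' by (intro add_mono mult_left_mono) auto
        finally have "199/200 \<le> Re z" using Rez by simp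
        have "Re z \<le> (1 - u) * 2 + u * 2"
          unfolding Rez using u \<delta> s' s by (intro add_mono mult_left_mono) auto
        then have "Re z \<le> 2" by simp
        with \<open>Im z = t\<close> \<open>199/200 \<le> Re z\<close> show ?thesis by (intro exI[of _ "Re z"]) (auto simp: complex_eq_iff)
      qed
      have "norm (zt ?w - zt s) \<le> V * norm (?w - s)"
      proof (rule field_differentiable_bound[of "closed_segment s ?w" zt "deriv zt" V])
        fix z assume "z \<in> closed_segment s ?w"
        then obtain \<sigma> where \<sigma>: "z = Complex \<sigma> t" "199/200 \<le> \<sigma>" "\<sigma> \<le> 2" using seg by blast
        show "norm (deriv zt z) \<le> V" using ub(2) \<sigma> by simp
        have "z \<noteq> 1" using \<sigma> s \<tau> by (auto simp: t_def complex_eq_iff)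
        then have "(zt has_field_derivative deriv zt z) (at z)"
          using \<sigma> by (intro holomorphic_derivI[OF zt_holomorphic])
            (auto intro!: open_Diff open_halfspace_Re_gt)
        then show "(zt has_field_derivative deriv zt z) (at z within closed_segment s ?w)"
          by (rule has_field_derivative_at_within)
      qed auto
      also have "norm (?w - s) = \<bar>1 + \<delta> - Re s\<bar>"
      proof -
        have "?w - s = of_real (1 + \<delta> - Re s)" by (simp add: complex_eq_iff t_def)
        then show ?thesis by (metis norm_of_real)
      qed
      also have "V * \<bar>1 + \<delta> - Re s\<bar> \<le> V * (3/2 * \<delta>)"
        using V1 s' False by (intro mult_left_mono) auto
      finally have "norm (zt ?w - zt s) \<le> 3/2 * (V * \<delta>)" by simp
      moreover have "norm (zt ?w) \<ge> 2 * V * \<delta>" using \<delta> by (intro right) auto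
      moreover have "norm (zt ?w) \<le> norm (zt ?w - zt s) + norm (zt s)"
        using norm_triangle_ineq[of "zt ?w - zt s" "zt s"] by simp
      ultimately show ?thesis by linarith
    qed
    have "V * \<delta> / 2 = c / (32 * V ^ 4)"
      using V1 by (simp add: \<delta>_def field_simps eval_nat_numeral)
    moreover have "s = Complex (Re s) t" by (simp add: t_def)
    moreover have "199/200 \<le> Re s" "Re s \<le> 2" using s' s \<delta> by auto
    ultimately show ?thesis using low ub[of "Re s"] by metis
  qed
  with c show thesis by (intro that[of C c]) (auto simp: C_def)
qed

text \<open>On \<open>Re s = 1\<close> away from 1, nonvanishing is read off from the quantitative
  lower bound with \<open>\<tau> = \<bar>Im s\<bar>\<close>; to the right of the line it comes from
  the exponential representation.\<close>

lemma gz_nonzero: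
  assumes "Re s \<ge> 1"
  shows "gz s \<noteq> 0"
proof (cases "Re s > 1")
  case True
  then have "s \<noteq> 1" by auto
  with True show ?thesis by (simp add: gz_eq_zeta zeta_nonzero)
next
  case False
  with assms have re: "Re s = 1" by simp
  show ?thesis
  proof (cases "s = 1")
    case False
    with re have im: "\<bar>Im s\<bar> > 0" by (auto simp: complex_eq_iff)
    from zt_lower_bound[OF im] obtain C c where *: "C \<ge> 1" "0 < c"
      "\<And>z V. V \<ge> C * (2 + \<bar>Im z\<bar>) powr (1/50) \<Longrightarrow> 1 - c / (32 * V ^ 5) \<le> Re z \<Longrightarrow> Re z \<le> 3/2 \<Longrightarrow> \<bar>Im s\<bar> \<le> \<bar>Im z\<bar> \<Longrightarrow>
      norm (zt z) \<le> V \<and> norm (deriv zt z) \<le> V \<and> norm (zt z) \<ge> c / (32 * V ^ 4)"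
      by metis
    define V where "V = C * (2 + \<bar>Im s\<bar>) powr (1/50)"
    have V: "V > 0" using *(1) by (simp add: V_def)
    have "norm (zt s) \<ge> c / (32 * V ^ 4)"
      using *(3)[of s V] V *(2) re by (simp add: V_def)
    moreover have "c / (32 * V ^ 4) > 0" using V *(2) by simp
    ultimately have "zt s \<noteq> 0" by auto
    then show ?thesis by (auto simp: zt_def)
  qed simp
qed

section \<open>The logarithmic derivative of zeta with its pole removed\<close>

text \<open>This is \<open>- zeta' / zeta - zeta\<close>, written in terms of \<open>gz\<close> so that the poles at \<open>1\<close> cancel.\<close>
definition logderiv_diff :: "complex \<Rightarrow> complex" where
  "logderiv_diff s = - deriv gz s / gz s - (if s = 1 then deriv gz 1 else (gz s - gz 1) / (s - 1))"

lemma open_gz_domain: "open ({s. Re s > 0} \<inter> {s. gz s \<noteq> 0})"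
proof -
  have "continuous_on {s. Re s > 0} gz"
    by (rule holomorphic_on_imp_continuous_on[OF gterm_sums_gz(2)[of 1]]) auto
  then have "open ({s. Re s > 0} \<inter> gz -` (- {0}))"
    by (rule continuous_open_preimage) (auto intro: open_halfspace_Re_gt)
  then show ?thesis by (simp add: vimage_def)
qed

lemma logderiv_diff_holomorphic: "logderiv_diff holomorphic_on ({s. Re s > 0} \<inter> {s. gz s \<noteq> 0})"
proof -
  have g: "gz holomorphic_on {s. Re s > 0}" by (rule gterm_sums_gz(2)[of 1]) auto
  have o: "open {s::complex. Re s > 0}" by (rule open_halfspace_Re_gt)
  have "deriv gz holomorphic_on {s. Re s > 0}" by (rule holomorphic_deriv[OF g o])
  moreover note pole_lemma_open[OF g o, of 1]
  ultimately show ?thesis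
    unfolding logderiv_diff_def[abs_def] using g
    by (intro holomorphic_on_diff holomorphic_on_divide holomorphic_on_minus)
       (auto elim: holomorphic_on_subset)
qed

text \<open>Here \<open>zt' / zt = gz' / gz - 1 / (s - 1)\<close>, while \<open>gz 1 = 1\<close>
  makes the difference quotient equal to \<open>zt s - 1 / (s - 1)\<close>. The two polar terms
  cancel.\<close>

lemma logderiv_diff_eq_zt:
  assumes "Re s > 0" "s \<noteq> 1" "gz s \<noteq> 0"
  shows "logderiv_diff s = - deriv zt s / zt s - zt s"
proof -
  have "(gz has_field_derivative deriv gz s) (at s)"
    using assms(1) by (intro holomorphic_derivI[OF gterm_sums_gz(2)[of 1] open_halfspace_Re_gt]) auto
  then have "((\<lambda>s. gz s / (s - 1)) has_field_derivative (deriv gz s * (s - 1) - gz s) / ((s - 1) * (s - 1))) (at s)"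
    using assms(2) by (auto intro!: derivative_eq_intros)
  then have "deriv zt s = (deriv gz s * (s - 1) - gz s) / ((s - 1) * (s - 1))"
    unfolding zt_def[abs_def] by (rule DERIV_imp_deriv)
  moreover have "(D * w - G) / (w * w) / (G / w) = D / G - 1 / w" if "w \<noteq> 0" "G \<noteq> 0" for D G w :: complex
    using that by (simp add: divide_simps)
  ultimately have "deriv zt s / zt s = deriv gz s / gz s - 1 / (s - 1)"
    using assms(2,3) by (simp add: zt_def)
  then show ?thesis
    using assms(2) by (simp add: logderiv_diff_def zt_def diff_divide_distrib)
qed

lemma logderiv_diff_eq_dser:
  assumes "Re s > 1"
  shows "logderiv_diff s = dser (\<lambda>n. mangoldt n - 1) s"
proof -
  have "(\<lambda>n. (mangoldt n - 1) * of_nat n powr (-s)) sums (dser mangoldt s - zeta s)"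
    using sums_diff[OF dser_sums[OF subpoly_mangoldt assms] dser_sums[OF subpoly_const[of 1] assms]]
    by (simp add: algebra_simps)
  then have 1: "dser (\<lambda>n. mangoldt n - 1) s = dser mangoldt s - zeta s"
    by (simp add: dser_def sums_iff)
  have "(zt has_field_derivative - (dser mangoldt s * zeta s)) (at s)"
    by (rule has_field_derivative_transform_within_open[OF deriv_zeta[OF assms] open_halfspace_Re_gt[of 1]])
       (use assms zt_eq_zeta in auto)
  then have "deriv zt s = - (dser mangoldt s * zeta s)" by (rule DERIV_imp_deriv)
  moreover have "s \<noteq> 1" "Re s > 0" "gz s \<noteq> 0" using assms gz_nonzero[of s] by auto
  ultimately show ?thesis
    using 1 zeta_nonzero[OF assms] assms by (simp add: logderiv_diff_eq_zt zt_eq_zeta)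
qed

text \<open>The estimates for \<open>zt\<close> need \<open>\<bar>Im s\<bar>\<close> bounded below,
  so the stretch next to the pole is covered by compactness. The rectangle may touch
  \<open>Re s = 1\<close> because \<open>gz\<close> does not vanish there.\<close>

lemma higher_deriv_logderiv_diff_bound_compact:
  obtains B where "\<And>s. 1 \<le> Re s \<Longrightarrow> Re s \<le> 3/2 \<Longrightarrow> \<bar>Im s\<bar> \<le> 1 \<Longrightarrow> norm ((deriv ^^ k) logderiv_diff s) \<le> B"
proof -
  let ?K = "cbox (Complex 1 (-1)) (Complex (3/2) 1)"
  let ?S = "{s. Re s > 0} \<inter> {s. gz s \<noteq> 0}"
  have "(deriv ^^ k) logderiv_diff holomorphic_on ?S"
    by (rule holomorphic_higher_deriv[OF logderiv_diff_holomorphic open_gz_domain])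
  moreover have "?K \<subseteq> ?S" using gz_nonzero by (auto simp: in_cbox_complex_iff)
  ultimately have "continuous_on ?K ((deriv ^^ k) logderiv_diff)"
    by (metis holomorphic_on_imp_continuous_on holomorphic_on_subset)
  then have "bounded ((deriv ^^ k) logderiv_diff ` ?K)"
    by (intro compact_imp_bounded compact_continuous_image) auto
  then obtain B where "\<And>s. s \<in> ?K \<Longrightarrow> norm ((deriv ^^ k) logderiv_diff s) \<le> B"
    unfolding bounded_iff by auto
  then have "norm ((deriv ^^ k) logderiv_diff s) \<le> B"
    if "1 \<le> Re s" "Re s \<le> 3/2" "\<bar>Im s\<bar> \<le> 1" for s
    using that by (auto simp: in_cbox_complex_iff abs_le_iff)
  then show thesis by (rule that)
qed

text \<open>Cauchy's estimate on a disc of radius \<open>c / (32 * V ^ 5)\<close>, the distance to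
  which the lower bound reaches left of \<open>Re s = 1\<close>. There \<open>zt' / zt\<close> is of
  order \<open>V ^ 5\<close>, and four derivatives cost \<open>V ^ 20\<close>. The total
  \<open>V ^ 25\<close> is a constant times
  \<open>(2 + \<bar>Im s\<bar>) powr (1/2)\<close>.\<close>

lemma higher_deriv_logderiv_diff_bound_far:
  obtains K where "\<And>s. 1 \<le> Re s \<Longrightarrow> Re s \<le> 5/4 \<Longrightarrow> \<bar>Im s\<bar> \<ge> 1 \<Longrightarrow>
    norm ((deriv ^^ 4) logderiv_diff s) \<le> K * (2 + \<bar>Im s\<bar>) powr (1/2)"
proof -
  obtain C c where C: "C \<ge> 1" and c: "0 < c" "c \<le> 1/10" and
    lb: "\<And>s V. V \<ge> C * (2 + \<bar>Im s\<bar>) powr (1/50) \<Longrightarrow> 1 - c / (32 * V ^ 5) \<le> Re s \<Longrightarrow> Re s \<le> 3/2 \<Longrightarrow> 1/2 \<le> \<bar>Im s\<bar> \<Longrightarrow>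
      norm (zt s) \<le> V \<and> norm (deriv zt s) \<le> V \<and> norm (zt s) \<ge> c / (32 * V ^ 4)"
    using zt_lower_bound[of "1/2"] by (metis half_gt_zero zero_less_one)
  define K where "K = fact 4 * (33 / c) * (32 / c) ^ 4 * (2 * C) ^ 25"
  show thesis
  proof (rule that[of K])
    fix s assume s: "1 \<le> Re s" "Re s \<le> 5/4" "\<bar>Im s\<bar> \<ge> 1"
    \<comment> \<open>The extra factor 2 makes one value of \<open>V\<close> admissible at all
      points of the disc, whose heights differ from that of \<open>s\<close>. For this reason
      \<open>V\<close> is a free parameter in \<open>zt_lower_bound\<close>.\<close>
    define V where "V = 2 * C * (2 + \<bar>Im s\<bar>) powr (1/50)"
    have V1: "V \<ge> 1"
    proof -
      have "1 * 1 \<le> (2 * C) * (2 + \<bar>Im s\<bar>) powr (1/50)"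
        using C by (intro mult_mono ge_one_powr_ge_zero) auto
      then show ?thesis by (simp add: V_def)
    qed
    define r where "r = c / (32 * V ^ 5)"
    have r: "r > 0" "r \<le> 1/320"
    proof -
      show "r > 0" using c V1 by (simp add: r_def)
      have "V ^ 5 \<ge> 1" using V1 by simp
      then have "r \<le> c / (32 * 1)" unfolding r_def using c V1 by (intro divide_left_mono mult_left_mono) auto
      then show "r \<le> 1/320" using c by simp
    qed
    have near: "norm (zt z) \<le> V \<and> norm (deriv zt z) \<le> V \<and> norm (zt z) \<ge> c / (32 * V ^ 4)"
      and near2: "Re z > 0" "z \<noteq> 1" if "z \<in> cball s r" for z
    proof -
      have z: "\<bar>Re s - Re z\<bar> \<le> r" "\<bar>Im s - Im z\<bar> \<le> r"
        using that abs_Re_le_cmod[of "s - z"] abs_Im_le_cmod[of "s - z"] by (auto simp: dist_norm)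
      have "C * (2 + \<bar>Im z\<bar>) powr (1/50) \<le> C * (2 * (2 + \<bar>Im s\<bar>) powr (1/50))"
        using C z r by (intro mult_left_mono powr_shift_bound) auto
      then have "C * (2 + \<bar>Im z\<bar>) powr (1/50) \<le> V" by (simp add: V_def mult_ac)
      moreover have "1 - c / (32 * V ^ 5) \<le> Re z" "Re z \<le> 3/2" "1/2 \<le> \<bar>Im z\<bar>"
        unfolding r_def[symmetric] using z r s by linarith+
      ultimately show "norm (zt z) \<le> V \<and> norm (deriv zt z) \<le> V \<and> norm (zt z) \<ge> c / (32 * V ^ 4)"
        by (rule lb)
      show "Re z > 0" "z \<noteq> 1" using z r s by auto
    qed
    have nz: "gz z \<noteq> 0" if "z \<in> cball s r" for z
    proof -
      have "c / (32 * V ^ 4) > 0" using c V1 by simp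
      then show ?thesis using near[OF that] by (auto simp: zt_def)
    qed
    have bd: "norm (logderiv_diff z) \<le> 33 / c * V ^ 5" if z: "z \<in> cball s r" for z
    proof -
      have "norm (logderiv_diff z) \<le> norm (deriv zt z / zt z) + norm (zt z)"
        using norm_triangle_ineq4[of "- deriv zt z / zt z" "zt z"] z
        by (simp add: logderiv_diff_eq_zt near2 nz norm_divide)
      also have "\<dots> \<le> V / (c / (32 * V ^ 4)) + V"
        unfolding norm_divide using near[OF z] c V1 by (intro add_mono frac_le) auto
      also have "V / (c / (32 * V ^ 4)) = 32 / c * V ^ 5" by (simp add: eval_nat_numeral)
      finally have "norm (logderiv_diff z) \<le> 32 / c * V ^ 5 + V" .
      moreover have "V \<le> 1 / c * V ^ 5"
      proof -
        have "1 * V ^ 1 \<le> 1 / c * V ^ 5" using c V1 by (intro mult_mono power_increasing) auto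
        then show ?thesis by simp
      qed
      moreover have "32 / c * V ^ 5 + 1 / c * V ^ 5 = 33 / c * V ^ 5" by (simp add: field_simps)
      ultimately show ?thesis by linarith
    qed
    have sub: "cball s r \<subseteq> {s. Re s > 0} \<inter> {s. gz s \<noteq> 0}" using near2 nz by auto
    have "norm ((deriv ^^ 4) logderiv_diff s) \<le> fact 4 * (33 / c * V ^ 5) / r ^ 4"
    proof (rule Cauchy_inequality)
      show "logderiv_diff holomorphic_on ball s r"
        by (rule holomorphic_on_subset[OF logderiv_diff_holomorphic]) (use sub ball_subset_cball in blast)
      show "continuous_on (cball s r) logderiv_diff"
        by (rule holomorphic_on_imp_continuous_on, rule holomorphic_on_subset[OF logderiv_diff_holomorphic sub])
      show "norm (logderiv_diff z) \<le> 33 / c * V ^ 5" if "norm (s - z) = r" for z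
        using that by (intro bd) (simp add: dist_norm)
    qed (use r in auto)
    also have "\<dots> = fact 4 * (33 / c) * (32 / c) ^ 4 * V ^ 25"
      using c V1 by (simp add: r_def power_divide power_mult_distrib field_simps flip: power_mult power_add)
    also have "V ^ 25 = (2 * C) ^ 25 * ((2 + \<bar>Im s\<bar>) powr (1/50)) ^ 25"
      by (simp only: V_def power_mult_distrib)
    also have "((2 + \<bar>Im s\<bar>) powr (1/50)) ^ 25 = (2 + \<bar>Im s\<bar>) powr (1/2)"
      by (subst powr_realpow[symmetric]) (auto simp: powr_powr)
    finally show "norm ((deriv ^^ 4) logderiv_diff s) \<le> K * (2 + \<bar>Im s\<bar>) powr (1/2)"
      by (simp add: K_def mult_ac)
  qed
qed

definition pnt_coeff :: "nat \<Rightarrow> real" where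
  "pnt_coeff n = (mangoldt n - 1) * ln (real n) ^ 4"

lemma subpoly_pnt_coeff: "subpoly (\<lambda>n. of_real (pnt_coeff n))"
  using subpoly_mult_ln_power[OF subpoly_diff[OF subpoly_mangoldt subpoly_const[of 1]], of 4]
  by (simp add: pnt_coeff_def)

lemma pnt_dser_bound:
  obtains K where "K \<ge> 0" "\<And>s. 1 < Re s \<Longrightarrow> Re s \<le> 5/4 \<Longrightarrow>
    norm (dser (\<lambda>n. of_real (pnt_coeff n)) s) \<le> K * (2 + \<bar>Im s\<bar>) powr (1/2)"
proof -
  obtain B where B: "\<And>s. 1 \<le> Re s \<Longrightarrow> Re s \<le> 3/2 \<Longrightarrow> \<bar>Im s\<bar> \<le> 1 \<Longrightarrow> norm ((deriv ^^ 4) logderiv_diff s) \<le> B"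
    using higher_deriv_logderiv_diff_bound_compact by metis
  obtain K where K: "\<And>s. 1 \<le> Re s \<Longrightarrow> Re s \<le> 5/4 \<Longrightarrow> \<bar>Im s\<bar> \<ge> 1 \<Longrightarrow>
    norm ((deriv ^^ 4) logderiv_diff s) \<le> K * (2 + \<bar>Im s\<bar>) powr (1/2)"
    using higher_deriv_logderiv_diff_bound_far by metis
  have "norm (dser (\<lambda>n. of_real (pnt_coeff n)) s) \<le> max B (max K 0) * (2 + \<bar>Im s\<bar>) powr (1/2)"
    if s: "1 < Re s" "Re s \<le> 5/4" for s
  proof -
    have sp: "subpoly (\<lambda>n. mangoldt n - 1)" by (intro subpoly_diff subpoly_mangoldt subpoly_const)
    have "(deriv ^^ 4) logderiv_diff s = (deriv ^^ 4) (dser (\<lambda>n. mangoldt n - 1)) s"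
    proof (rule higher_deriv_cong_ev)
      have "\<forall>\<^sub>F z in nhds s. z \<in> {z. Re z > 1}"
        using s open_halfspace_Re_gt by (intro eventually_nhds_in_open) auto
      then show "\<forall>\<^sub>F z in nhds s. logderiv_diff z = dser (\<lambda>n. mangoldt n - 1) z"
        by eventually_elim (simp add: logderiv_diff_eq_dser)
    qed simp
    also have "\<dots> = (-1) ^ 4 * dser (\<lambda>n. (mangoldt n - 1) * of_real (ln (real n)) ^ 4) s"
      by (rule higher_deriv_dser[OF sp s(1)])
    finally have eq: "dser (\<lambda>n. of_real (pnt_coeff n)) s = (deriv ^^ 4) logderiv_diff s"
      by (simp add: pnt_coeff_def)
    show ?thesis
    proof (cases "\<bar>Im s\<bar> \<ge> 1")
      case True
      have "norm ((deriv ^^ 4) logderiv_diff s) \<le> K * (2 + \<bar>Im s\<bar>) powr (1/2)" using s True by (intro K) auto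
      also have "\<dots> \<le> max B (max K 0) * (2 + \<bar>Im s\<bar>) powr (1/2)" by (intro mult_right_mono) auto
      finally show ?thesis unfolding eq .
    next
      case False
      have "norm ((deriv ^^ 4) logderiv_diff s) \<le> B" using s False by (intro B) auto
      also have "B \<le> max B (max K 0) * 1" by simp
      also have "\<dots> \<le> max B (max K 0) * (2 + \<bar>Im s\<bar>) powr (1/2)"
        by (intro mult_left_mono ge_one_powr_ge_zero) auto
      finally show ?thesis unfolding eq .
    qed
  qed
  then show thesis by (intro that[of "max B (max K 0)"]) auto
qed

section \<open>Perron's formula\<close>

text \<open>The exponent is -2 from the kernel plus 1/2 from \<open>pnt_dser_bound\<close>. The two
  half-lines are covered by \<open>?g\<close> shifted by 2 and by its mirror image.\<close>

lemma integrable_powr_abs: "integrable lborel (\<lambda>t::real. (2 + \<bar>t\<bar>) powr (-3/2))"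
proof -
  let ?g = "\<lambda>t::real. indicator {2..} t *\<^sub>R t powr (-3/2)"
  have "(\<lambda>t::real. t powr (-3/2)) integrable_on {2..}"
    using has_integral_powr_to_inf[of "-3/2" 2] by (auto simp: integrable_on_def)
  then have "(\<lambda>t::real. t powr (-3/2)) absolutely_integrable_on {2..}"
    by (rule nonnegative_absolutely_integrable_1) auto
  then have "integrable lebesgue ?g" by (simp add: set_integrable_def)
  then have g: "integrable lborel ?g" by (subst (asm) integrable_completion) auto
  have "integrable lborel (\<lambda>t. ?g (2 + 1 * t) + ?g (2 + (-1) * t))"
    using lborel_integrable_real_affine_iff[of 1 ?g 2] lborel_integrable_real_affine_iff[of "-1" ?g 2] g
    by (intro Bochner_Integration.integrable_add) auto
  then show ?thesis
  proof (rule Bochner_Integration.integrable_bound)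
    show "AE t in lborel. norm ((2 + \<bar>t\<bar>) powr (-3/2)) \<le> norm (?g (2 + 1 * t) + ?g (2 + (-1) * t))"
      by (intro AE_I2) (auto simp: abs_if indicator_def)
  qed auto
qed

text \<open>The extra factor \<open>s + 1\<close> makes the integral over a vertical line absolutely
  convergent and turns the sharp cutoff \<open>n \<le> x\<close> into the weight
  \<open>1 - n / x\<close>.\<close>

definition perron :: "real \<Rightarrow> complex \<Rightarrow> complex" where
  "perron y s = of_real y powr s / (s * (s + 1))"

lemma perron_holomorphic:
  assumes "y > 0" "0 \<notin> S" "-1 \<notin> S"
  shows "perron y holomorphic_on S"
  using assms unfolding perron_def[abs_def]
  by (intro holomorphic_intros) (auto simp: add_eq_0_iff2)

lemma norm_perron: "y > 0 \<Longrightarrow> norm (perron y s) = y powr Re s / (norm s * norm (s + 1))"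
  by (simp add: perron_def norm_divide norm_mult norm_powr_real_powr)

lemma norm_perron_line_le:
  assumes "c \<ge> 1" "y > 0"
  shows "norm (perron y (Complex c t)) \<le> 9 * y powr c * (2 + \<bar>t\<bar>) powr (-2)"
proof -
  have *: "norm (Complex d t) \<ge> (2 + \<bar>t\<bar>) / 3" if "d \<ge> 1" for d
    using abs_Re_le_cmod[of "Complex d t"] abs_Im_le_cmod[of "Complex d t"] that by simp
  have "Complex c t + 1 = Complex (c + 1) t" by (simp add: complex_eq_iff)
  then have "norm (perron y (Complex c t)) = y powr c / (norm (Complex c t) * norm (Complex (c + 1) t))"
    using assms by (simp add: norm_perron)
  also have "\<dots> \<le> y powr c / ((2 + \<bar>t\<bar>) / 3 * ((2 + \<bar>t\<bar>) / 3))"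
    using assms *[of c] *[of "c + 1"] by (intro divide_left_mono mult_mono mult_pos_pos) auto
  also have "\<dots> = 9 * y powr c * (2 + \<bar>t\<bar>) powr (-2)"
    by (simp add: powr_minus powr_numeral power2_eq_square field_simps)
  finally show ?thesis .
qed

lemma perron_line_continuous:
  assumes "c > 0" "y > 0"
  shows "continuous_on UNIV (\<lambda>t. perron y (Complex c t))"
proof (rule continuous_on_compose2[of "{s. Re s > 0}" "perron y"])
  show "continuous_on {s. Re s > 0} (perron y)"
    by (intro holomorphic_on_imp_continuous_on perron_holomorphic) (use assms in auto)
  show "continuous_on UNIV (Complex c)"
    unfolding Complex_eq by (intro continuous_intros)
qed (use assms in auto)

lemma perron_integrable:
  assumes "c \<ge> 1" "y > 0"
  shows "integrable lborel (\<lambda>t. perron y (Complex c t))"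
proof (rule Bochner_Integration.integrable_bound)
  show "integrable lborel (\<lambda>t. 9 * y powr c * (2 + \<bar>t\<bar>) powr (-3/2))"
    by (intro integrable_mult_right integrable_powr_abs)
  show "(\<lambda>t. perron y (Complex c t)) \<in> borel_measurable lborel"
    using borel_measurable_continuous_onI[OF perron_line_continuous[of c y]] assms by simp
  show "AE t in lborel. norm (perron y (Complex c t)) \<le> norm (9 * y powr c * (2 + \<bar>t\<bar>) powr (-3/2))"
  proof (rule AE_I2)
    fix t
    have "norm (perron y (Complex c t)) \<le> 9 * y powr c * (2 + \<bar>t\<bar>) powr (-2)"
      by (rule norm_perron_line_le[OF assms])
    also have "\<dots> \<le> 9 * y powr c * (2 + \<bar>t\<bar>) powr (-3/2)"
      by (intro mult_left_mono powr_mono) auto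
    finally show "norm (perron y (Complex c t)) \<le> norm (9 * y powr c * (2 + \<bar>t\<bar>) powr (-3/2))" by simp
  qed
qed

text \<open>The chord from \<open>Complex c (-T)\<close> to \<open>Complex c T\<close> and the arc
  to its right, on the circle about 0 through both endpoints, lie in \<open>Re s > 0\<close>, where
  the kernel has no pole. Here \<open>\<alpha>\<close> is half the opening angle.\<close>

lemma perron_arc:
  assumes c: "c \<ge> 1" and y: "y > 0" and T: "T > 0"
  defines "\<rho> \<equiv> norm (Complex c T)" and "\<alpha> \<equiv> Arg (Complex c T)"
  shows "contour_integral (part_circlepath 0 \<rho> (-\<alpha>) \<alpha>) (perron y)
       = \<i> * integral {-T..T} (\<lambda>t. perron y (Complex c t))"
    and "0 < \<alpha>" "\<alpha> < pi / 2" "\<rho> * cos \<alpha> = c" "\<rho> > 1"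
proof -
  have rc: "Complex c T = rcis \<rho> \<alpha>" by (simp add: \<rho>_def \<alpha>_def rcis_cmod_Arg)
  show \<alpha>: "0 < \<alpha>" using T Arg_lt_pi[of "Complex c T"] by (simp add: \<alpha>_def)
  show \<alpha>2: "\<alpha> < pi / 2" using Arg_Re_pos[of "Complex c T"] c by (simp add: \<alpha>_def)
  have Re: "\<rho> * cos \<alpha> = c" using arg_cong[OF rc, of Re] by simp
  then show "\<rho> * cos \<alpha> = c" .
  have "\<rho> > \<bar>c\<bar>" unfolding \<rho>_def cmod_def using T by (simp add: real_less_rsqrt)
  then show \<rho>: "\<rho> > 1" using c by simp
  have e1: "\<rho> * exp (\<i> * \<alpha>) = Complex c T" "\<rho> * exp (\<i> * of_real (-\<alpha>)) = Complex c (-T)"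
  proof -
    show 1: "\<rho> * exp (\<i> * \<alpha>) = Complex c T" using rc by (simp add: rcis_def cis_conv_exp)
    then have "cnj (\<rho> * exp (\<i> * \<alpha>)) = cnj (Complex c T)" by simp
    then show "\<rho> * exp (\<i> * of_real (-\<alpha>)) = Complex c (-T)" by (simp add: exp_cnj complex_eq_iff)
  qed
  let ?L = "linepath (Complex c (-T)) (Complex c T)"
  let ?A = "part_circlepath 0 \<rho> \<alpha> (-\<alpha>)"
  let ?S = "{s. Re s > 0}"
  have hol: "perron y holomorphic_on ?S" using y by (intro perron_holomorphic) auto
  have imL: "path_image ?L \<subseteq> ?S"
  proof -
    have "closed_segment (Complex c (-T)) (Complex c T) \<subseteq> ?S"
      using c by (intro closed_segment_subset convex_halfspace_Re_gt) auto
    then show ?thesis by simp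
  qed
  have imA: "path_image (part_circlepath 0 \<rho> (-\<alpha>) \<alpha>) \<subseteq> ?S"
  proof
    fix z assume "z \<in> path_image (part_circlepath 0 \<rho> (-\<alpha>) \<alpha>)"
    then obtain x where x: "-\<alpha> \<le> x" "x \<le> \<alpha>" "z = \<rho> * cis x"
      using \<alpha> by (auto simp: path_image_part_circlepath' closed_segment_eq_real_ivl)
    have "cos \<bar>x\<bar> \<ge> cos \<alpha>" using x \<alpha>2 by (subst cos_mono_le_eq) auto
    then have "\<rho> * cos x \<ge> c" using \<rho> Re by (metis cos_abs_real less_trans mult_left_mono order_less_imp_le zero_less_one)
    then show "z \<in> ?S" using x c by simp
  qed
  have imA': "path_image ?A \<subseteq> ?S"
    using imA by (metis path_image_reversepath reversepath_part_circlepath)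
  have "(perron y has_contour_integral 0) (?L +++ ?A)"
    by (rule Cauchy_theorem_convex_simple[OF hol convex_halfspace_Re_gt])
       (use imL imA' e1 in \<open>auto simp: path_image_join\<close>)
  then have "contour_integral (?L +++ ?A) (perron y) = 0" by (rule contour_integral_unique)
  moreover have iL: "perron y contour_integrable_on ?L"
    by (rule contour_integrable_continuous_linepath)
       (use imL hol in \<open>auto intro: holomorphic_on_imp_continuous_on holomorphic_on_subset\<close>)
  moreover have iA: "perron y contour_integrable_on ?A"
    by (rule contour_integrable_continuous_part_circlepath)
       (use imA' hol in \<open>auto intro: holomorphic_on_imp_continuous_on holomorphic_on_subset\<close>)
  ultimately have "contour_integral ?L (perron y) + contour_integral ?A (perron y) = 0"
    by (simp add: e1)
  moreover have "contour_integral ?A (perron y) = - contour_integral (part_circlepath 0 \<rho> (-\<alpha>) \<alpha>) (perron y)"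
    using contour_integral_reversepath[of "part_circlepath 0 \<rho> (-\<alpha>) \<alpha>" "perron y"] by simp
  moreover have "contour_integral ?L (perron y) = \<i> * integral {-T..T} (\<lambda>t. perron y (Complex c t))"
    using T by (intro contour_integral_linepath_same_Re) auto
  ultimately show "contour_integral (part_circlepath 0 \<rho> (-\<alpha>) \<alpha>) (perron y)
       = \<i> * integral {-T..T} (\<lambda>t. perron y (Complex c t))" by (simp add: add_eq_0_iff)
qed

text \<open>Partial fractions: \<open>1 / (s * (s + 1)) = 1 / s - 1 / (s + 1)\<close>. The condition
  \<open>\<rho> > 1\<close> puts both poles inside, with residues \<open>y powr 0\<close> and
  \<open>- (y powr (-1))\<close>.\<close>

lemma perron_circle:
  assumes y: "y > 0" and \<rho>: "\<rho> > 1"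
  shows "(perron y has_contour_integral (2 * pi * \<i> * (1 - 1 / y))) (circlepath 0 \<rho>)"
proof -
  have hol: "(\<lambda>s. of_real y powr s) holomorphic_on UNIV"
    by (intro holomorphic_on_powr_right holomorphic_on_ident)
  have c1: "continuous_on (cball 0 \<rho>) (\<lambda>s. of_real y powr s :: complex)"
    by (rule holomorphic_on_imp_continuous_on, rule holomorphic_on_subset[OF hol]) simp
  have c2: "(\<lambda>s. of_real y powr s) holomorphic_on ball 0 \<rho>"
    by (rule holomorphic_on_subset[OF hol]) simp
  have A: "((\<lambda>u. of_real y powr u / (u - 0)) has_contour_integral (2 * of_real pi * \<i> * of_real y powr 0)) (circlepath 0 \<rho>)"
    by (rule Cauchy_integral_circlepath[OF c1 c2]) (use \<rho> in auto)
  have B: "((\<lambda>u. of_real y powr u / (u - (-1))) has_contour_integral (2 * of_real pi * \<i> * of_real y powr (-1))) (circlepath 0 \<rho>)"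
    by (rule Cauchy_integral_circlepath[OF c1 c2]) (use \<rho> in auto)
  have "((\<lambda>u. of_real y powr u / (u - 0) - of_real y powr u / (u - (-1))) has_contour_integral
     (of_real (2 * pi) * \<i> * (1 - 1 / of_real y))) (circlepath 0 \<rho>)"
    using has_contour_integral_diff[OF A B] y by (simp add: powr_minus field_simps)
  then show ?thesis
  proof (rule has_contour_integral_eq)
    fix x assume "x \<in> path_image (circlepath 0 \<rho>)"
    then have "norm x = \<rho>" using \<rho> by simp
    then have "x \<noteq> 0" "x \<noteq> -1" using \<rho> by auto
    then have "x + 1 \<noteq> 0" by (simp add: add_eq_0_iff2)
    then show "of_real y powr x / (x - 0) - of_real y powr x / (x - (-1)) = perron y x"
      using \<open>x \<noteq> 0\<close> by (simp add: perron_def field_simps)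
  qed
qed

lemma norm_perron_sphere_le:
  assumes "y > 0" "norm z = \<rho>" "\<rho> > 1" "y powr Re z \<le> B"
  shows "norm (perron y z) \<le> B / (\<rho> * (\<rho> - 1))"
proof -
  have "norm (z + 1) \<ge> \<rho> - 1" using norm_triangle_ineq4[of "z + 1" 1] assms by simp
  moreover have "B \<ge> 0" using assms(4) order.trans[OF powr_ge_zero] by blast
  ultimately show ?thesis
    unfolding norm_perron[OF assms(1)] using assms by (intro frac_le mult_mono) auto
qed

text \<open>The chord is compared with the arc on which \<open>y powr Re z \<le> y powr c\<close>:
  the right one for \<open>y \<le> 1\<close>, the left one for \<open>y > 1\<close>. The left arc is
  the full circle minus the right arc, so the residues enter only in the second case.\<close>

lemma perron_truncated:
  assumes c: "c \<ge> 1" and y: "y > 0" and T: "T > 0"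
  defines "\<rho> \<equiv> norm (Complex c T)"
  shows "norm (integral {-T..T} (\<lambda>t. perron y (Complex c t)) - of_real (2 * pi * max 0 (1 - 1 / y)))
       \<le> 2 * pi * y powr c / (\<rho> - 1)"
proof -
  define \<alpha> where "\<alpha> = Arg (Complex c T)"
  note arc = perron_arc[OF c y T, folded \<rho>_def \<alpha>_def]
  define I where "I = integral {-T..T} (\<lambda>t. perron y (Complex c t))"
  have bnd: "norm (contour_integral (part_circlepath 0 \<rho> a b) (perron y)) \<le> 2 * pi * y powr c / (\<rho> - 1)"
    if ab: "a \<le> b" "b - a \<le> 2 * pi" and le: "\<And>x. a \<le> x \<Longrightarrow> x \<le> b \<Longrightarrow> y powr (\<rho> * cos x) \<le> y powr c" for a b
  proof -
    have im: "norm z = \<rho>" "y powr Re z \<le> y powr c" if "z \<in> path_image (part_circlepath 0 \<rho> a b)" for z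
      using that arc(5) ab le by (auto simp: path_image_part_circlepath' closed_segment_eq_real_ivl norm_mult)
    have "perron y contour_integrable_on part_circlepath 0 \<rho> a b"
    proof (intro contour_integrable_continuous_part_circlepath holomorphic_on_imp_continuous_on perron_holomorphic y)
      show "0 \<notin> path_image (part_circlepath 0 \<rho> a b)" "-1 \<notin> path_image (part_circlepath 0 \<rho> a b)"
        using im(1)[of 0] im(1)[of "-1"] arc(5) by auto
    qed
    then have "norm (contour_integral (part_circlepath 0 \<rho> a b) (perron y))
      \<le> y powr c / (\<rho> * (\<rho> - 1)) * \<rho> * \<bar>b - a\<bar>"
      using arc(5) im y by (intro contour_integral_bound_part_circlepath norm_perron_sphere_le) auto
    also have "\<dots> \<le> y powr c / (\<rho> * (\<rho> - 1)) * \<rho> * (2 * pi)"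
      using ab arc(5) by (intro mult_left_mono) auto
    finally show ?thesis using arc(5) by (simp add: mult_ac)
  qed
  show ?thesis
  proof (cases "y \<le> 1")
    case True
    then have "1 - 1 / y \<le> 0" using y by simp
    then have [simp]: "max 0 (1 - 1 / y) = 0" by simp
    have "norm (contour_integral (part_circlepath 0 \<rho> (-\<alpha>) \<alpha>) (perron y)) \<le> 2 * pi * y powr c / (\<rho> - 1)"
    proof (rule bnd)
      fix x assume x: "-\<alpha> \<le> x" "x \<le> \<alpha>"
      have "cos \<bar>x\<bar> \<ge> cos \<alpha>" using x arc(2,3) by (subst cos_mono_le_eq) auto
      then have "\<rho> * cos x \<ge> \<rho> * cos \<alpha>" using arc(5) by (intro mult_left_mono) auto
      then show "y powr (\<rho> * cos x) \<le> y powr c" using True y arc(4) by (intro powr_mono') auto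
    qed (use arc in auto)
    then show ?thesis by (simp add: arc(1) norm_mult)
  next
    case False
    then have "1 - 1 / y \<ge> 0" using y by simp
    then have [simp]: "max 0 (1 - 1 / y) = 1 - 1 / y" by simp
    define F where "F = (\<lambda>t. perron y (0 + of_real \<rho> * cis t) * of_real \<rho> * \<i> * cis t)"
    have contF: "continuous_on A F" for A
    proof -
      have "continuous_on (sphere 0 \<rho>) (perron y)"
        by (intro holomorphic_on_imp_continuous_on perron_holomorphic y) (use arc(5) in auto)
      then have "continuous_on A (\<lambda>t. perron y (0 + of_real \<rho> * cis t))"
        by (rule continuous_on_compose2) (use arc(5) in \<open>auto intro!: continuous_intros simp: norm_mult\<close>)
      then show ?thesis unfolding F_def by (intro continuous_intros)
    qed
    have iF: "F integrable_on {a..b}" for a b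
      by (intro integrable_continuous_interval contF)
    have eq: "contour_integral (part_circlepath 0 \<rho> a b) (perron y) = integral {a..b} F" if "a < b" for a b
      using contour_integral_part_circlepath_eq[OF that] by (simp add: F_def)
    have per: "F (t + 2 * pi) = F t" for t
      by (simp add: F_def cis_mult[symmetric])
    have "contour_integral (circlepath 0 \<rho>) (perron y) = integral {0..2 * pi} F"
      unfolding circlepath_def by (rule eq) simp
    then have full: "integral {0..2 * pi} F = 2 * pi * \<i> * (1 - 1 / y)"
      using contour_integral_unique[OF perron_circle[OF y arc(5)]] by simp
    \<comment> \<open>The circle is parametrised from angle 0, so the right arc is split between
      both ends of \<open>{0..2 * pi}\<close>; periodicity joins the pieces.\<close>
    have "integral {2 * pi - \<alpha>..2 * pi} F = integral {-\<alpha>..0} (\<lambda>t. F (t + 2 * pi))"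
      using integral_shift_Icc_real[of "-\<alpha>" 0 F "2 * pi"] by (simp add: o_def add.commute)
    also have "\<dots> = integral {-\<alpha>..0} F" by (simp add: per)
    finally have shift: "integral {2 * pi - \<alpha>..2 * pi} F = integral {-\<alpha>..0} F" .
    have "integral {0..\<alpha>} F + integral {\<alpha>..2 * pi} F = integral {0..2 * pi} F"
      by (rule Henstock_Kurzweil_Integration.integral_combine) (use arc iF in auto)
    moreover have "integral {\<alpha>..2 * pi - \<alpha>} F + integral {2 * pi - \<alpha>..2 * pi} F = integral {\<alpha>..2 * pi} F"
      by (rule Henstock_Kurzweil_Integration.integral_combine) (use arc iF in auto)
    moreover have "integral {-\<alpha>..0} F + integral {0..\<alpha>} F = integral {-\<alpha>..\<alpha>} F"
      by (rule Henstock_Kurzweil_Integration.integral_combine) (use arc iF in auto)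
    ultimately have "integral {-\<alpha>..\<alpha>} F = 2 * pi * \<i> * (1 - 1 / y) - integral {\<alpha>..2 * pi - \<alpha>} F"
      using shift full by algebra
    moreover have "integral {-\<alpha>..\<alpha>} F = \<i> * I" using arc(1,2) eq[of "-\<alpha>" \<alpha>] by (simp add: I_def)
    ultimately have "\<i> * (I - 2 * pi * (1 - 1 / y)) = - integral {\<alpha>..2 * pi - \<alpha>} F"
      by (simp add: algebra_simps)
    then have "norm (\<i> * (I - 2 * pi * (1 - 1 / y))) = norm (integral {\<alpha>..2 * pi - \<alpha>} F)"
      by (metis norm_minus_cancel)
    then have "norm (I - 2 * pi * (1 - 1 / y)) = norm (integral {\<alpha>..2 * pi - \<alpha>} F)"
      by (simp add: norm_mult)
    also have "\<dots> = norm (contour_integral (part_circlepath 0 \<rho> \<alpha> (2 * pi - \<alpha>)) (perron y))"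
      using arc by (subst eq) auto
    also have "\<dots> \<le> 2 * pi * y powr c / (\<rho> - 1)"
    proof (rule bnd)
      fix x assume x: "\<alpha> \<le> x" "x \<le> 2 * pi - \<alpha>"
      have "cos x \<le> cos \<alpha>"
      proof (cases "x \<le> pi")
        case True
        then show ?thesis using x arc by (subst cos_mono_le_eq) auto
      next
        case False
        have "cos (2 * pi - x) \<le> cos \<alpha>" using x arc False by (subst cos_mono_le_eq) auto
        then show ?thesis by (simp add: cos_diff)
      qed
      then have "\<rho> * cos x \<le> \<rho> * cos \<alpha>" using arc(5) by (intro mult_left_mono) auto
      then show "y powr (\<rho> * cos x) \<le> y powr c" using False y arc(4) by (intro powr_mono) auto
    qed (use arc in auto)
    finally show ?thesis by (simp add: I_def)
  qed
qed

theorem perron_formula: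
  assumes c: "c \<ge> 1" and y: "y > 0"
  shows "(\<integral>t. perron y (Complex c t) \<partial>lborel) = of_real (2 * pi * max 0 (1 - 1 / y))"
proof -
  let ?f = "\<lambda>t. perron y (Complex c t)"
  note int = perron_integrable[OF c y]
  have "(\<lambda>n. \<integral>t. indicator {-real n..real n} t *\<^sub>R ?f t \<partial>lborel) \<longlonglongrightarrow> (\<integral>t. ?f t \<partial>lborel)"
  proof (rule integral_dominated_convergence[where w = "\<lambda>t. norm (?f t)"])
    show "AE t in lborel. (\<lambda>n. indicator {-real n..real n} t *\<^sub>R ?f t) \<longlonglongrightarrow> ?f t"
    proof (rule AE_I2, rule tendsto_eventually)
      fix t :: real
      show "\<forall>\<^sub>F n in sequentially. indicator {-real n..real n} t *\<^sub>R ?f t = ?f t"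
        using eventually_ge_at_top[of "nat \<lceil>\<bar>t\<bar>\<rceil>"]
        by eventually_elim (auto simp: indicator_def)
    qed
  qed (use int in \<open>auto simp: indicator_def\<close>)
  moreover have "(\<integral>t. indicator {-real n..real n} t *\<^sub>R ?f t \<partial>lborel) = integral {-real n..real n} ?f" for n
  proof -
    have "set_integrable lborel {-real n..real n} ?f"
      using int unfolding set_integrable_def by (intro integrable_mult_indicator) auto
    from set_borel_integral_eq_integral(2)[OF this] show ?thesis by (simp add: set_lebesgue_integral_def)
  qed
  ultimately have 1: "(\<lambda>n. integral {-real n..real n} ?f) \<longlonglongrightarrow> (\<integral>t. ?f t \<partial>lborel)" by simp
  have "(\<lambda>n. integral {-real n..real n} ?f - of_real (2 * pi * max 0 (1 - 1 / y))) \<longlonglongrightarrow> 0"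
  proof (rule Lim_null_comparison)
    have "norm (integral {-real n..real n} ?f - of_real (2 * pi * max 0 (1 - 1 / y))) \<le> 2 * pi * y powr c / (real n - 1)"
      if "n \<ge> 2" for n
    proof -
      have "real n \<le> norm (Complex c (real n))" using abs_Im_le_cmod[of "Complex c (real n)"] by simp
      then have "2 * pi * y powr c / (norm (Complex c (real n)) - 1) \<le> 2 * pi * y powr c / (real n - 1)"
        using that by (intro divide_left_mono) auto
      then show ?thesis using perron_truncated[OF c y, of "real n"] that by simp
    qed
    then show "\<forall>\<^sub>F n in sequentially. norm (integral {-real n..real n} ?f - of_real (2 * pi * max 0 (1 - 1 / y)))
      \<le> 2 * pi * y powr c / (real n - 1)"
      using eventually_ge_at_top[of 2] by (rule eventually_mono[rotated])
    show "(\<lambda>n. 2 * pi * y powr c / (real n - 1)) \<longlonglongrightarrow> 0" by real_asymp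
  qed
  then have "(\<lambda>n. integral {-real n..real n} ?f) \<longlonglongrightarrow> of_real (2 * pi * max 0 (1 - 1 / y))"
    by (simp add: LIM_zero_iff)
  with 1 show ?thesis using LIMSEQ_unique by blast
qed

section \<open>Sums over the von Mangoldt function\<close>

text \<open>A big-O form of Stolz-Cesaro: increments are summed from \<open>N\<close> on, and the
  constant left over from below \<open>N\<close> is absorbed because \<open>g\<close> is unbounded.
  It is always applied with \<open>g n = n / ln n ^ 3\<close>, whose increments have order
  \<open>1 / ln n ^ 3\<close>.\<close>

lemma stolz_bigo:
  fixes f g :: "nat \<Rightarrow> real"
  assumes "(\<lambda>n. f (Suc n) - f n) \<in> O(\<lambda>n. g (Suc n) - g n)"
    and mono: "\<forall>\<^sub>F n in sequentially. g n \<le> g (Suc n)" and lim: "filterlim g at_top sequentially"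
  shows "f \<in> O(g)"
proof -
  obtain c where c: "c > 0" "\<forall>\<^sub>F n in sequentially. norm (f (Suc n) - f n) \<le> c * norm (g (Suc n) - g n)"
    using assms(1) by (elim landau_o.bigE)
  from eventually_conj[OF c(2) mono] obtain N where
    N: "\<And>n. n \<ge> N \<Longrightarrow> norm (f (Suc n) - f n) \<le> c * norm (g (Suc n) - g n) \<and> g n \<le> g (Suc n)"
    unfolding eventually_at_top_linorder by blast
  have bound: "\<bar>f n - f N\<bar> \<le> c * (g n - g N)" if "n \<ge> N" for n
    using that
  proof (induction n rule: dec_induct)
    case (step n)
    have "\<bar>f (Suc n) - f n\<bar> \<le> c * (g (Suc n) - g n)" using N[of n] step.hyps abs_of_nonneg[of "g (Suc n) - g n"] by auto
    then have "\<bar>f (Suc n) - f N\<bar> \<le> c * (g n - g N) + c * (g (Suc n) - g n)" using step.IH by linarith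
    then show ?case by (simp add: algebra_simps)
  qed simp
  define D where "D = \<bar>f N\<bar> + c * \<bar>g N\<bar>"
  have "\<forall>\<^sub>F n in sequentially. g n \<ge> 1" using lim by (auto simp: filterlim_at_top)
  then have "\<forall>\<^sub>F n in sequentially. norm (f n) \<le> (c + D) * norm (g n)"
    using eventually_ge_at_top[of N]
  proof eventually_elim
    case (elim n)
    have "\<bar>f n\<bar> \<le> c * (g n - g N) + \<bar>f N\<bar>" using bound[of n] elim by linarith
    also have "\<dots> \<le> c * g n + D"
    proof -
      have "c * (- g N) \<le> c * \<bar>g N\<bar>" using c(1) by (intro mult_left_mono) auto
      then show ?thesis unfolding D_def right_diff_distrib by linarith
    qed
    finally have "\<bar>f n\<bar> \<le> c * g n + D" .
    moreover have "D * 1 \<le> D * g n" using elim c(1) by (intro mult_left_mono) (auto simp: D_def)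
    ultimately show ?case using elim by (simp add: algebra_simps)
  qed
  then show ?thesis by (rule bigoI)
qed

section \<open>The smoothed sum by Perron's formula\<close>

lemma perron_divide_nat:
  assumes "x > 0" "n \<ge> (1::nat)"
  shows "perron (x / real n) s = of_nat n powr (-s) * perron x s"
proof -
  have "of_real x powr s = (of_real (x / real n) * of_real (real n) :: complex) powr s"
    using assms unfolding of_real_mult[symmetric] by simp
  also have "\<dots> = of_real (x / real n) powr s * of_real (real n) powr s"
    using assms by (intro powr_times_real) auto
  finally have "of_real (x / real n) powr s = of_nat n powr (-s) * of_real x powr s"
    using assms by (simp add: powr_minus field_simps del: of_real_divide)
  then show ?thesis by (simp add: perron_def)
qed

lemma perron_dser:
  fixes b :: "nat \<Rightarrow> real"
  assumes b: "subpoly (\<lambda>n. of_real (b n))" and \<sigma>: "\<sigma> > 1" and x: "x > 0"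
  shows "integrable lborel (\<lambda>t. dser (\<lambda>n. of_real (b n)) (Complex \<sigma> t) * perron x (Complex \<sigma> t))"
    and "(\<integral>t. dser (\<lambda>n. of_real (b n)) (Complex \<sigma> t) * perron x (Complex \<sigma> t) \<partial>lborel)
      = of_real (2 * pi * (\<Sum>n\<in>{1..nat \<lfloor>x\<rfloor>}. b n * (1 - real n / x)))"
proof -
  define f where "f = (\<lambda>n t. of_real (b n) * of_nat n powr (- Complex \<sigma> t) * perron x (Complex \<sigma> t))"
  have f_eq: "f n t = of_real (b n) * perron (x / real n) (Complex \<sigma> t)" if "n \<ge> 1" for n t
    using perron_divide_nat[OF x that] by (simp add: f_def)
  have int: "integrable lborel (f n)" for n
  proof (cases "n = 0")
    case False
    then have "f n = (\<lambda>t. of_real (b n) * perron (x / real n) (Complex \<sigma> t))" by (intro ext f_eq) simp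
    then show ?thesis using \<sigma> x False by (simp add: perron_integrable del: of_real_divide)
  qed (simp add: f_def)
  \<comment> \<open>The norm splits into a summable factor in \<open>n\<close> and an integrable
    factor in \<open>t\<close>, so sum and integral may be interchanged.\<close>
  have nf: "norm (f n t) = \<bar>b n\<bar> * real n powr (-\<sigma>) * norm (perron x (Complex \<sigma> t))" for n t
    by (simp add: f_def norm_mult norm_of_nat_powr)
  have sm: "summable (\<lambda>n. \<bar>b n\<bar> * real n powr (-\<sigma>))"
    using dser_abs_summable[OF b, of "of_real \<sigma>"] \<sigma> by (simp add: norm_mult norm_of_nat_powr)
  have AE: "AE t in lborel. summable (\<lambda>n. norm (f n t))"
    unfolding nf by (intro AE_I2 summable_mult2 sm)
  have sm2: "summable (\<lambda>n. \<integral>t. norm (f n t) \<partial>lborel)"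
    unfolding nf by (simp add: summable_mult2 sm)
  have dser_eq: "(\<Sum>n. f n t) = dser (\<lambda>n. of_real (b n)) (Complex \<sigma> t) * perron x (Complex \<sigma> t)" for t
  proof -
    have "(\<lambda>n. of_real (b n) * of_nat n powr (- Complex \<sigma> t)) sums dser (\<lambda>n. of_real (b n)) (Complex \<sigma> t)"
      by (rule dser_sums[OF b]) (use \<sigma> in simp)
    from sums_mult2[OF this, of "perron x (Complex \<sigma> t)"] show ?thesis by (simp add: f_def sums_iff)
  qed
  show "integrable lborel (\<lambda>t. dser (\<lambda>n. of_real (b n)) (Complex \<sigma> t) * perron x (Complex \<sigma> t))"
    using integrable_suminf[OF int AE sm2] unfolding dser_eq .
  have fpos: "(\<integral>t. f n t \<partial>lborel) = of_real (2 * pi * (b n * max 0 (1 - real n / x)))" if "n \<ge> 1" for n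
    using that \<sigma> x by (simp add: f_eq perron_formula)
  moreover have "(\<integral>t. f 0 t \<partial>lborel) = 0" by (simp add: f_def)
  ultimately have fi: "(\<integral>t. f n t \<partial>lborel) = (if n \<in> {1..nat \<lfloor>x\<rfloor>} then of_real (2 * pi * (b n * (1 - real n / x))) else 0)" for n
  proof (cases "n = 0")
    case False
    have "n \<le> nat \<lfloor>x\<rfloor> \<longleftrightarrow> real n \<le> x" using x by (simp add: le_nat_iff le_floor_iff)
    then show ?thesis using False x fpos[of n] by (auto simp: max_def field_simps)
  qed auto
  have "(\<lambda>n. \<integral>t. f n t \<partial>lborel) sums (\<integral>t. (\<Sum>n. f n t) \<partial>lborel)"
    by (rule sums_integral[OF int AE sm2])
  moreover have "(\<lambda>n. \<integral>t. f n t \<partial>lborel) sums (\<Sum>n\<in>{1..nat \<lfloor>x\<rfloor>}. of_real (2 * pi * (b n * (1 - real n / x))))"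
    unfolding fi by (rule sums_If_finite_set) simp
  ultimately show "(\<integral>t. dser (\<lambda>n. of_real (b n)) (Complex \<sigma> t) * perron x (Complex \<sigma> t) \<partial>lborel)
      = of_real (2 * pi * (\<Sum>n\<in>{1..nat \<lfloor>x\<rfloor>}. b n * (1 - real n / x)))"
    unfolding dser_eq using sums_unique2 by (fastforce simp: sum_distrib_left)
qed

text \<open>On the abscissa \<open>1 + 1 / ln N\<close> the factor \<open>N powr \<sigma>\<close> is
  only \<open>exp 1 * N\<close>, while the bound for the series is uniform down to the line. The
  second factor \<open>N\<close> comes from turning \<open>1 - n / N\<close> into
  \<open>N - n\<close>; \<open>exp 4\<close> makes \<open>1 / ln N \<le> 1/4\<close>, the width of
  the strip.\<close>

lemma pnt_smoothed_bound:
  obtains K where "K > 0" "\<And>N::nat. real N \<ge> exp 4 \<Longrightarrow> \<bar>\<Sum>n\<in>{1..N}. pnt_coeff n * (real N - real n)\<bar> \<le> K * real N ^ 2"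
proof -
  obtain K where K: "K \<ge> 0" "\<And>s. 1 < Re s \<Longrightarrow> Re s \<le> 5/4 \<Longrightarrow>
    norm (dser (\<lambda>n. of_real (pnt_coeff n)) s) \<le> K * (2 + \<bar>Im s\<bar>) powr (1/2)"
    using pnt_dser_bound by metis
  define W where "W = (\<integral>t. (2 + \<bar>t::real\<bar>) powr (-3/2) \<partial>lborel)"
  have W: "W \<ge> 0" unfolding W_def by (intro integral_nonneg_AE) auto
  have "\<bar>\<Sum>n\<in>{1..N}. pnt_coeff n * (real N - real n)\<bar> \<le> (K * 9 * exp 1 * W) * real N ^ 2"
    if N: "real N \<ge> exp 4" for N :: nat
  proof -
    have N0: "real N > 0" using N exp_gt_zero[of 4] by linarith
    have lnN: "ln (real N) \<ge> 4" using N N0 by (simp add: ln_ge_iff)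
    define \<sigma> where "\<sigma> = 1 + 1 / ln (real N)"
    have \<sigma>: "\<sigma> > 1" "\<sigma> \<le> 5/4" using lnN by (auto simp: \<sigma>_def field_simps)
    have N\<sigma>: "real N powr \<sigma> = exp 1 * real N"
    proof -
      have "l \<ge> 4 \<Longrightarrow> 1 / l * l = 1" for l :: real by simp
      from this[OF lnN] have "real N powr (1 / ln (real N)) = exp 1"
        using N0 unfolding powr_def by simp
      then show ?thesis using N0 by (simp add: \<sigma>_def powr_add)
    qed
    let ?A = "\<Sum>n\<in>{1..N}. pnt_coeff n * (1 - real n / real N)"
    let ?h = "\<lambda>t. dser (\<lambda>n. of_real (pnt_coeff n)) (Complex \<sigma> t) * perron (real N) (Complex \<sigma> t)"
    have "norm (\<integral>t. ?h t \<partial>lborel) \<le> (\<integral>t. (K * 9 * real N powr \<sigma>) * (2 + \<bar>t\<bar>) powr (-3/2) \<partial>lborel)"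
    proof (rule Bochner_Integration.integral_norm_bound_integral)
      show "integrable lborel ?h" by (rule perron_dser(1)[OF subpoly_pnt_coeff \<sigma>(1) N0])
      show "integrable lborel (\<lambda>t. (K * 9 * real N powr \<sigma>) * (2 + \<bar>t\<bar>) powr (-3/2))"
        by (intro integrable_mult_right integrable_powr_abs)
      fix t
      have "norm (?h t) \<le> (K * (2 + \<bar>t\<bar>) powr (1/2)) * (9 * real N powr \<sigma> * (2 + \<bar>t\<bar>) powr (-2))"
        unfolding norm_mult using K(2)[of "Complex \<sigma> t"] \<sigma> N0 norm_perron_line_le[of \<sigma> "real N" t] K(1)
        by (intro mult_mono) auto
      also have "\<dots> = (K * 9 * real N powr \<sigma>) * ((2 + \<bar>t\<bar>) powr (1/2) * (2 + \<bar>t\<bar>) powr (-2))" by simp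
      also have "(2 + \<bar>t\<bar>) powr (1/2) * (2 + \<bar>t\<bar>) powr (-2) = (2 + \<bar>t\<bar>) powr (-3/2)"
        by (simp flip: powr_add)
      finally show "norm (?h t) \<le> (K * 9 * real N powr \<sigma>) * (2 + \<bar>t\<bar>) powr (-3/2)" .
    qed
    also have "(\<integral>t. ?h t \<partial>lborel) = of_real (2 * pi * ?A)"
      using perron_dser(2)[OF subpoly_pnt_coeff \<sigma>(1) N0] by simp
    also have "(\<integral>t. (K * 9 * real N powr \<sigma>) * (2 + \<bar>t\<bar>) powr (-3/2) \<partial>lborel) = K * 9 * exp 1 * real N * W"
      by (simp add: W_def N\<sigma>)
    finally have "2 * pi * \<bar>?A\<bar> \<le> K * 9 * exp 1 * real N * W"
      by (simp only: norm_of_real abs_mult) simp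
    moreover have "1 * \<bar>?A\<bar> \<le> 2 * pi * \<bar>?A\<bar>" using pi_ge_two by (intro mult_right_mono) auto
    ultimately have "\<bar>?A\<bar> \<le> K * 9 * exp 1 * real N * W" by linarith
    then have "real N * \<bar>?A\<bar> \<le> real N * (K * 9 * exp 1 * real N * W)" by (intro mult_left_mono) auto
    moreover have "real N * \<bar>?A\<bar> = \<bar>real N * ?A\<bar>" by (simp add: abs_mult)
    moreover have "real N * ?A = (\<Sum>n\<in>{1..N}. pnt_coeff n * (real N - real n))"
      unfolding sum_distrib_left using N0 by (intro sum.cong refl) (simp add: field_simps)
    ultimately show ?thesis by (simp add: power2_eq_square mult_ac)
  qed
  then have "\<bar>\<Sum>n\<in>{1..N}. pnt_coeff n * (real N - real n)\<bar> \<le> (K * 9 * exp 1 * W + 1) * real N ^ 2"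
    if "real N \<ge> exp 4" for N :: nat
    by (rule order.trans[OF _ mult_right_mono]) (use that in auto)
  moreover have "K * 9 * exp 1 * W + 1 > 0" using K W by (intro add_nonneg_pos) auto
  ultimately show thesis using that by blast
qed

section \<open>Removing the smoothing and the weight\<close>

definition pnt_sum :: "nat \<Rightarrow> real" where
  "pnt_sum N = (\<Sum>n\<in>{1..N}. pnt_coeff n)"

text \<open>Only the lower side is this good: \<open>mangoldt n\<close> may be as large as
  \<open>ln n\<close>, so an upper bound would cost \<open>ln M ^ 5\<close>. The differencing
  argument therefore works with lower bounds alone.\<close>

lemma pnt_coeff_ge: "n \<ge> 1 \<Longrightarrow> n \<le> M \<Longrightarrow> - pnt_coeff n \<le> ln (real M) ^ 4"
proof -
  assume n: "n \<ge> 1" "n \<le> M"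
  have "- pnt_coeff n = (1 - mangoldt n) * ln (real n) ^ 4" by (simp add: pnt_coeff_def algebra_simps)
  also have "\<dots> \<le> 1 * ln (real n) ^ 4" using mangoldt_nonneg[of n] by (intro mult_right_mono) auto
  also have "\<dots> \<le> 1 * ln (real M) ^ 4" using n by (intro mult_left_mono power_mono) auto
  finally show ?thesis by simp
qed

text \<open>The smoothed sum is a discrete primitive of \<open>pnt_sum\<close>. Differencing it with step \<open>H\<close>
  recovers \<open>pnt_sum\<close> because the coefficients are bounded below.\<close>
lemma pnt_sum_difference:
  assumes K: "\<And>N::nat. N \<ge> N0 \<Longrightarrow> \<bar>\<Sum>n\<in>{1..N}. pnt_coeff n * (real N - real n)\<bar> \<le> K * real N ^ 2"
    and K0: "K > 0" and N: "N \<ge> 2 * N0" and H: "1 \<le> H" "2 * H \<le> N"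
  shows "\<bar>pnt_sum N\<bar> \<le> 5 * K * real N ^ 2 / real H + real H * ln (2 * real N) ^ 4"
proof -
  define U where "U = (\<lambda>N::nat. \<Sum>n\<in>{1..N}. pnt_coeff n * (real N - real n))"
  define l where "l = ln (2 * real N) ^ 4"
  have step: "U (M + H) - U M = real H * pnt_sum M + (\<Sum>n\<in>{M<..M+H}. pnt_coeff n * (real (M + H) - real n))" for M
  proof -
    have un: "{1..M + H} = {1..M} \<union> {M<..M+H}" "{1..M} \<inter> {M<..M+H} = {}" by auto
    have "U (M + H) = (\<Sum>n\<in>{1..M}. pnt_coeff n * (real (M + H) - real n)) + (\<Sum>n\<in>{M<..M+H}. pnt_coeff n * (real (M + H) - real n))"
      unfolding U_def un(1) by (rule sum.union_disjoint) (use un(2) in auto)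
    moreover have "(\<Sum>n\<in>{1..M}. pnt_coeff n * (real (M + H) - real n)) = U M + real H * pnt_sum M"
      by (simp add: U_def pnt_sum_def sum_distrib_left sum.distrib[symmetric] algebra_simps)
    ultimately show ?thesis by simp
  qed
  have neg: "- (\<Sum>n\<in>{M<..M+H}. pnt_coeff n * w n) \<le> real H * (real H * l)"
    if w: "\<And>n. n \<in> {M<..M+H} \<Longrightarrow> 0 \<le> w n \<and> w n \<le> real H" and M: "M + H \<le> 2 * N" for M and w :: "nat \<Rightarrow> real"
  proof -
    have "- (\<Sum>n\<in>{M<..M+H}. pnt_coeff n * w n) = (\<Sum>n\<in>{M<..M+H}. (- pnt_coeff n) * w n)"
      by (simp add: sum_negf)
    also have "\<dots> \<le> (\<Sum>n\<in>{M<..M+H}. real H * l)"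
    proof (rule sum_mono)
      fix n assume n: "n \<in> {M<..M+H}"
      have "- pnt_coeff n \<le> l" using pnt_coeff_ge[of n "2 * N"] n M by (auto simp: l_def)
      moreover have "l \<ge> 0" by (simp add: l_def)
      ultimately have "(- pnt_coeff n) * w n \<le> l * real H"
        using w[OF n] by (meson mult_left_mono mult_right_mono order.trans)
      then show "(- pnt_coeff n) * w n \<le> real H * l" by (simp add: mult.commute)
    qed
    also have "\<dots> = real H * (real H * l)" by simp
    finally show ?thesis .
  qed
  have UN: "\<bar>U N\<bar> \<le> K * real N ^ 2" using K[of N] N by (simp add: U_def)
  have UNH: "\<bar>U (N + H)\<bar> \<le> 4 * K * real N ^ 2"
  proof -
    have "\<bar>U (N + H)\<bar> \<le> K * real (N + H) ^ 2" using K[of "N + H"] N by (simp add: U_def)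
    also have "\<dots> \<le> K * (2 * real N) ^ 2" using K0 H by (intro mult_left_mono power_mono) auto
    finally show ?thesis by (simp add: power_mult_distrib)
  qed
  \<comment> \<open>\<open>2 * H \<le> N\<close> and \<open>N \<ge> 2 * N0\<close> keep
    \<open>N - H\<close> in the range of the hypothesis on smoothed sums.\<close>
  have UNH': "\<bar>U (N - H)\<bar> \<le> K * real N ^ 2"
  proof -
    have "\<bar>U (N - H)\<bar> \<le> K * real (N - H) ^ 2" using K[of "N - H"] N H by (simp add: U_def)
    also have "\<dots> \<le> K * real N ^ 2" using K0 by (intro mult_left_mono power_mono) auto
    finally show ?thesis .
  qed
  have Hp: "real H > 0" using H by simp
  \<comment> \<open>A forward difference bounds \<open>pnt_sum N\<close> from above and a backward
    one from below: in each case the block of length \<open>H\<close> enters with the sign for which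
    a lower bound on the coefficients is enough.\<close>
  have upper: "real H * pnt_sum N \<le> 5 * K * real N ^ 2 + real H * (real H * l)"
    using step[of N] neg[of N "\<lambda>n. real (N + H) - real n"] UN UNH H by auto
  have lower: "- (real H * pnt_sum N) \<le> 5 * K * real N ^ 2 + real H * (real H * l)"
  proof -
    have NH: "N - H + H = N" using H by simp
    have un: "{1..N} = {1..N-H} \<union> {N-H<..N}" "{1..N-H} \<inter> {N-H<..N} = {}" using H by auto
    have "pnt_sum N = pnt_sum (N - H) + (\<Sum>n\<in>{N-H<..N}. pnt_coeff n)"
      unfolding pnt_sum_def un(1) by (rule sum.union_disjoint) (use un(2) in auto)
    then have "U N - U (N - H) = real H * pnt_sum N - real H * (\<Sum>n\<in>{N-H<..N}. pnt_coeff n)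
        + (\<Sum>n\<in>{N-H<..N}. pnt_coeff n * (real N - real n))"
      using step[of "N - H"] unfolding NH by (simp add: algebra_simps)
    also have "\<dots> = real H * pnt_sum N - (\<Sum>n\<in>{N-H<..N}. pnt_coeff n * (real H - (real N - real n)))"
      by (simp add: sum_distrib_left sum_subtractf[symmetric] algebra_simps)
        (simp add: sum.distrib sum_subtractf)
    finally have "U N - U (N - H) = real H * pnt_sum N - (\<Sum>n\<in>{N-H<..N}. pnt_coeff n * (real H - (real N - real n)))" .
    moreover have "- (\<Sum>n\<in>{N-H<..N}. pnt_coeff n * (real H - (real N - real n))) \<le> real H * (real H * l)"
    proof -
      have "0 \<le> real H - (real N - real n) \<and> real H - (real N - real n) \<le> real H" if "n \<in> {N-H<..N}" for n
      proof -
        have "N \<le> n + H" "n \<le> N" using that by auto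
        then have "real N \<le> real n + real H" "real n \<le> real N" by linarith+
        then show ?thesis by simp
      qed
      then show ?thesis using neg[of "N - H" "\<lambda>n. real H - (real N - real n)"] unfolding NH by auto
    qed
    moreover have "K * real N ^ 2 \<ge> 0" using K0 by simp
    ultimately show ?thesis using UN UNH' by linarith
  qed
  have "real H * \<bar>pnt_sum N\<bar> = \<bar>real H * pnt_sum N\<bar>" by (simp add: abs_mult)
  also have "\<dots> \<le> 5 * K * real N ^ 2 + real H * (real H * l)" using upper lower by linarith
  finally show ?thesis using Hp by (simp add: l_def field_simps)
qed

lemma pnt_sum_bigo: "pnt_sum \<in> O(\<lambda>N. real N * ln (real N) ^ 2)"
proof -
  obtain K where K: "K > 0" "\<And>N::nat. real N \<ge> exp 4 \<Longrightarrow> \<bar>\<Sum>n\<in>{1..N}. pnt_coeff n * (real N - real n)\<bar> \<le> K * real N ^ 2"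
    using pnt_smoothed_bound by metis
  define N0 where "N0 = nat \<lceil>exp 4 :: real\<rceil>"
  have N0: "real N \<ge> exp 4" if "N \<ge> N0" for N using that unfolding N0_def by linarith
  have ev: "\<forall>\<^sub>F N in sequentially. 4 \<le> ln (real N) \<and> ln (real N) ^ 2 \<le> real N"
    by (intro eventually_conj) real_asymp+
  have "\<forall>\<^sub>F N in sequentially. norm (pnt_sum N) \<le> (5 * K + 32) * norm (real N * ln (real N) ^ 2)"
    using ev eventually_ge_at_top[of "2 * N0 + 2"]
  proof eventually_elim
    case (elim N)
    let ?l = "ln (real N)"
    \<comment> \<open>This \<open>H\<close> balances the two terms of
      \<open>pnt_sum_difference\<close>: both become multiples of \<open>N * ln N ^ 2\<close>.
      Rounding up at most doubles it, and \<open>ln N \<ge> 4\<close> gives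
      \<open>2 * H \<le> N\<close>. The constant 32 is \<open>2 * 2 ^ 4\<close>.\<close>
    define H where "H = nat \<lceil>real N / ?l ^ 2\<rceil>"
    have l: "?l \<ge> 4" "?l ^ 2 \<le> real N" "?l ^ 2 \<ge> 16" using elim power_mono[of 4 ?l 2] by auto
    have N: "real N > 0" using elim by simp
    have q1: "1 \<le> real N / ?l ^ 2" using l by (simp add: field_simps)
    have "real N / ?l ^ 2 \<le> real N / 16" using l N by (intro divide_left_mono) auto
    then have H: "real N / ?l ^ 2 \<le> real H" "real H \<le> 2 * (real N / ?l ^ 2)" "1 \<le> H" "2 * H \<le> N"
      using q1 unfolding H_def by linarith+
    have Hp: "H > 0" using H(3) by simp
    have ln2: "ln (2 * real N) \<le> 2 * ?l" using ln_2_less_1 l N by (simp add: ln_mult)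
    have "\<bar>pnt_sum N\<bar> \<le> 5 * K * real N ^ 2 / real H + real H * ln (2 * real N) ^ 4"
      by (rule pnt_sum_difference[of N0]) (use K N0 elim H in auto)
    also have "\<dots> \<le> 5 * K * real N ^ 2 / (real N / ?l ^ 2) + 2 * (real N / ?l ^ 2) * (2 * ?l) ^ 4"
      using H q1 K ln2 N elim Hp by (intro add_mono divide_left_mono mult_mono power_mono mult_pos_pos) auto
    also have "\<dots> = (5 * K + 32) * (real N * ?l ^ 2)"
      using N l by (simp add: field_simps eval_nat_numeral)
    finally show ?case by simp
  qed
  then show ?thesis by (rule bigoI)
qed

text \<open>The terms \<open>n = 0\<close> and \<open>n = 1\<close> vanish because \<open>ln\<close> is \<open>0\<close> there.\<close>
lemma mangoldt_sum_bigo: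
  "(\<lambda>N. \<Sum>n\<le>N. (mangoldt n - 1) / ln (real n)) \<in> O(\<lambda>N. real N / ln (real N) ^ 3)"
proof -
  define P where "P = (\<lambda>N. \<Sum>n\<le>N. (mangoldt n - 1) / ln (real n) :: real)"
  \<comment> \<open>The subtracted quotient is the boundary term of Abel summation, so the increment
    of \<open>R\<close> is \<open>pnt_sum N\<close> times a difference of order
    \<open>1 / (N * ln N ^ 6)\<close>. The exponent 5 is the weight 4 plus the denominator
    \<open>ln n\<close>.\<close>
  define R where "R = (\<lambda>N. P N - pnt_sum N / ln (real N) ^ 5)"
  have "R \<in> O(\<lambda>N. real N / ln (real N) ^ 3)"
  proof (rule stolz_bigo)
    have eq: "R (Suc N) - R N = pnt_sum N * (1 / ln (real N) ^ 5 - 1 / ln (real (Suc N)) ^ 5)" if "N \<ge> 2" for N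
    proof -
      have "ln (real (Suc N)) > 0" using that by simp
      then have "(mangoldt (Suc N) - 1) / ln (real (Suc N)) = pnt_coeff (Suc N) / ln (real (Suc N)) ^ 5"
        by (simp add: pnt_coeff_def eval_nat_numeral)
      then have "P (Suc N) - P N = pnt_coeff (Suc N) / ln (real (Suc N)) ^ 5" by (simp add: P_def)
      moreover have "pnt_sum (Suc N) = pnt_sum N + pnt_coeff (Suc N)" by (simp add: pnt_sum_def)
      ultimately show ?thesis by (simp add: R_def algebra_simps add_divide_distrib)
    qed
    have "(\<lambda>N. pnt_sum N * (1 / ln (real N) ^ 5 - 1 / ln (real (Suc N)) ^ 5))
      \<in> O(\<lambda>N. (real N * ln (real N) ^ 2) * (1 / (real N * ln (real N) ^ 6)))"
    proof (rule landau_o.big.mult[OF pnt_sum_bigo])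
      show "(\<lambda>N. 1 / ln (real N) ^ 5 - 1 / ln (real (Suc N)) ^ 5) \<in> O(\<lambda>N. 1 / (real N * ln (real N) ^ 6))"
        by real_asymp
    qed
    also have "(\<lambda>N. (real N * ln (real N) ^ 2) * (1 / (real N * ln (real N) ^ 6)))
        \<in> O(\<lambda>N. real (Suc N) / ln (real (Suc N)) ^ 3 - real N / ln (real N) ^ 3)"
      by real_asymp
    also have "(\<lambda>N. pnt_sum N * (1 / ln (real N) ^ 5 - 1 / ln (real (Suc N)) ^ 5)) \<in> O(\<lambda>N. real (Suc N) / ln (real (Suc N)) ^ 3 - real N / ln (real N) ^ 3)
        \<longleftrightarrow> (\<lambda>N. R (Suc N) - R N) \<in> O(\<lambda>N. real (Suc N) / ln (real (Suc N)) ^ 3 - real N / ln (real N) ^ 3)"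
      by (rule landau_o.big.in_cong, rule eventually_mono[OF eventually_ge_at_top[of 2]]) (simp add: eq)
    finally show "(\<lambda>N. R (Suc N) - R N) \<in> O(\<lambda>N. real (Suc N) / ln (real (Suc N)) ^ 3 - real N / ln (real N) ^ 3)" .
    show "\<forall>\<^sub>F N in sequentially. real N / ln (real N) ^ 3 \<le> real (Suc N) / ln (real (Suc N)) ^ 3" by real_asymp
    show "filterlim (\<lambda>N. real N / ln (real N) ^ 3) at_top sequentially" by real_asymp
  qed
  moreover have "(\<lambda>N. pnt_sum N * (1 / ln (real N) ^ 5)) \<in> O(\<lambda>N. (real N * ln (real N) ^ 2) * (1 / ln (real N) ^ 5))"
    by (rule landau_o.big.mult[OF pnt_sum_bigo]) simp
  moreover have "(\<lambda>N. (real N * ln (real N) ^ 2) * (1 / ln (real N) ^ 5)) \<in> O(\<lambda>N. real N / ln (real N) ^ 3)"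
    by real_asymp
  ultimately have "(\<lambda>N. R N + pnt_sum N * (1 / ln (real N) ^ 5)) \<in> O(\<lambda>N. real N / ln (real N) ^ 3)"
    by (intro sum_in_bigo) (auto elim: landau_o.big_trans)
  then show ?thesis by (simp add: R_def P_def)
qed

section \<open>The prime number theorem\<close>

lemma inverse_ln_continuous: "a > 1 \<Longrightarrow> continuous_on {a..b} (\<lambda>t::real. 1 / ln t)"
  by (intro continuous_intros) auto

lemma inverse_ln_integrable: "a > 1 \<Longrightarrow> (\<lambda>t::real. 1 / ln t) integrable_on {a..b}"
  by (intro integrable_continuous_interval inverse_ln_continuous)

lemma inverse_ln_integrable_0: 
  assumes "0 < b" "b < 1"
  shows "(\<lambda>t::real. 1 / ln t) integrable_on {0..b}"
proof (rule integrable_continuous_interval, rule continuous_on_IccI)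
  have "((\<lambda>t::real. 1 / ln t) \<longlongrightarrow> 0) (at_right 0)" by real_asymp
  then show "((\<lambda>t::real. 1 / ln t) \<longlongrightarrow> 1 / ln 0) (at_right 0)" by simp
  have "isCont (\<lambda>t::real. 1 / ln t) t" if "0 < t" "t < 1" for t
    using that by (intro continuous_intros) auto
  then have *: "((\<lambda>t::real. 1 / ln t) \<longlongrightarrow> 1 / ln t) (at t)" if "0 < t" "t < 1" for t
    using that by (simp add: isCont_def)
  show "((\<lambda>t::real. 1 / ln t) \<longlongrightarrow> 1 / ln b) (at_left b)"
    using *[of b] assms by (simp add: filterlim_at_split)
  show "((\<lambda>t::real. 1 / ln t) \<longlongrightarrow> 1 / ln t) (at t)" if "0 < t" "t < b" for t
    using * that assms by auto
qed (use assms in auto)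

text \<open>The principal value folds the two sides of the singularity onto each other. At \<open>v = 1\<close> the second
  summand is \<open>1 / ln 0 = 0\<close>, which is also its limit.\<close>
definition li_kernel :: "real \<Rightarrow> real" where
  "li_kernel v = (if v = 0 then 1 else 1 / ln (1 + v) + 1 / ln (1 - v))"

text \<open>Near 0, \<open>1 / ln (1 + v) = 1 / v + 1/2 + O(v)\<close> and
  \<open>1 / ln (1 - v) = - 1 / v + 1/2 + O(v)\<close>: the poles cancel and the limit is 1.\<close>

lemma li_kernel_continuous: "continuous_on {0..1} li_kernel"
proof (rule continuous_on_IccI)
  have "((\<lambda>v::real. 1 / ln (1 + v) + 1 / ln (1 - v)) \<longlongrightarrow> 1) (at_right 0)" by real_asymp
  moreover have "\<forall>\<^sub>F v::real in at_right 0. 1 / ln (1 + v) + 1 / ln (1 - v) = li_kernel v"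
    by (rule eventually_mono[OF eventually_at_right_less]) (auto simp: li_kernel_def)
  ultimately show "(li_kernel \<longlongrightarrow> li_kernel 0) (at_right 0)"
    by (simp add: li_kernel_def[of 0] filterlim_cong)
  have "((\<lambda>v::real. 1 / ln (1 + v) + 1 / ln (1 - v)) \<longlongrightarrow> inverse (ln 2)) (at_left 1)" by real_asymp
  moreover have "\<forall>\<^sub>F v::real in at_left 1. 1 / ln (1 + v) + 1 / ln (1 - v) = li_kernel v"
    using eventually_at_left_real[of 0 "1::real"] by (rule eventually_mono) (auto simp: li_kernel_def)
  ultimately show "(li_kernel \<longlongrightarrow> li_kernel 1) (at_left 1)"
    by (simp add: li_kernel_def[of 1] filterlim_cong inverse_eq_divide)
  fix v :: real assume v: "0 < v" "v < 1"
  have "isCont (\<lambda>v. 1 / ln (1 + v) + 1 / ln (1 - v)) v"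
    using v by (intro continuous_intros) auto
  then have "((\<lambda>v. 1 / ln (1 + v) + 1 / ln (1 - v)) \<longlongrightarrow> li_kernel v) (at v)"
    using v by (simp add: isCont_def li_kernel_def)
  moreover have "\<forall>\<^sub>F w in at v. 1 / ln (1 + w) + 1 / ln (1 - w) = li_kernel w"
    using eventually_at_in_open'[of "{0<..}" v] v by (auto simp: li_kernel_def elim!: eventually_mono)
  ultimately show "(li_kernel \<longlongrightarrow> li_kernel v) (at v)" by (rule Lim_transform_eventually)
qed simp

text \<open>Cutting at 2 makes the reflection about 1 carry \<open>{0..1 - e}\<close> onto
  \<open>{1 + e..2}\<close>. These two pieces combine into \<open>li_kernel\<close>, and the rest is
  nonsingular.\<close>

lemma li_truncated:
  fixes e x :: real
  assumes e: "0 < e" "e < 1" and x: "x \<ge> 2"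
  shows "integral ({0..x} - {1 - e<..<1 + e}) (\<lambda>t. 1 / ln t) = integral {e..1} li_kernel + integral {2..x} (\<lambda>t. 1 / ln t)"
proof -
  let ?f = "\<lambda>t::real. 1 / ln t"
  have un: "{0..x} - {1 - e<..<1 + e} = {0..1 - e} \<union> {1 + e..x}" using e x by auto
  have "integral ({0..1 - e} \<union> {1 + e..x}) ?f = integral {0..1 - e} ?f + integral {1 + e..x} ?f"
    using e by (intro integral_Un inverse_ln_integrable_0 inverse_ln_integrable)
      (auto simp: Int_absorb2 intro: negligible_subset[OF negligible_empty])
  also have "integral {1 + e..x} ?f = integral {1 + e..2} ?f + integral {2..x} ?f"
    using e x by (intro Henstock_Kurzweil_Integration.integral_combine[symmetric] inverse_ln_integrable) auto
  also have "integral {1 + e..2} ?f = integral {e..1} (\<lambda>v. ?f (1 + v))"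
    using integral_shift_Icc_real[of e 1 ?f 1] by (simp add: o_def add.commute)
  also have "integral {0..1 - e} ?f = integral {-1..-e} (\<lambda>v. ?f (1 + v))"
    using integral_shift_Icc_real[of "-1" "-e" ?f 1] by (simp add: o_def add.commute)
  also have "\<dots> = integral {e..1} (\<lambda>v. ?f (1 - v))"
    using Henstock_Kurzweil_Integration.integral_reflect_real[of 1 e "\<lambda>v. ?f (1 - v)"] by simp
  also have "integral {e..1} (\<lambda>v. ?f (1 - v)) + (integral {e..1} (\<lambda>v. ?f (1 + v)) + integral {2..x} ?f)
     = integral {e..1} (\<lambda>v. ?f (1 + v) + ?f (1 - v)) + integral {2..x} ?f"
  proof -
    have "(\<lambda>v. ?f (1 + v)) integrable_on {e..1}"
      using e by (intro integrable_continuous_interval continuous_intros) auto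
    moreover have "li_kernel integrable_on {e..1}"
      using e by (intro integrable_continuous_interval continuous_on_subset[OF li_kernel_continuous]) auto
    ultimately have "(\<lambda>v. li_kernel v - ?f (1 + v)) integrable_on {e..1}" by (intro integrable_diff)
    then have "(\<lambda>v. ?f (1 - v)) integrable_on {e..1}"
      by (rule integrable_eq) (use e in \<open>auto simp: li_kernel_def\<close>)
    then show ?thesis
      using \<open>(\<lambda>v. ?f (1 + v)) integrable_on {e..1}\<close> by (simp add: Henstock_Kurzweil_Integration.integral_add)
  qed
  also have "integral {e..1} (\<lambda>v. ?f (1 + v) + ?f (1 - v)) = integral {e..1} li_kernel"
    by (rule integral_cong) (use e in \<open>auto simp: li_kernel_def\<close>)
  finally show ?thesis unfolding un .
qed

text \<open>After folding, the truncated integral depends on \<open>e\<close> only through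
  \<open>integral {e..1} li_kernel\<close>, which is continuous down to \<open>e = 0\<close>; so the
  limit that defines \<open>li\<close> exists.\<close>

lemma li_eq:
  assumes x: "x \<ge> 2"
  shows "li x = integral {0..1} li_kernel + integral {2..x} (\<lambda>t. 1 / ln t)"
proof -
  have int: "li_kernel integrable_on {0..1}"
    by (intro integrable_continuous_interval li_kernel_continuous)
  have "continuous_on {0..1} (\<lambda>e. integral {0..e} li_kernel)"
    by (rule indefinite_integral_continuous_1[OF int])
  then have "((\<lambda>e. integral {0..e} li_kernel) \<longlongrightarrow> integral {0..0} li_kernel) (at_right 0)"
    by (rule continuous_on_Icc_at_rightD) simp
  then have "((\<lambda>e. integral {0..1} li_kernel - integral {0..e} li_kernel + integral {2..x} (\<lambda>t. 1 / ln t)) \<longlongrightarrow>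
     integral {0..1} li_kernel - 0 + integral {2..x} (\<lambda>t. 1 / ln t)) (at_right 0)"
    by (intro tendsto_intros) simp
  moreover have "\<forall>\<^sub>F e in at_right 0. integral {0..1} li_kernel - integral {0..e} li_kernel + integral {2..x} (\<lambda>t. 1 / ln t)
      = integral ({0..x} - {1 - e<..<1 + e}) (\<lambda>t. 1 / ln t)"
    using eventually_at_right_real[of 0 1, simplified]
  proof eventually_elim
    case (elim e)
    have "integral {0..e} li_kernel + integral {e..1} li_kernel = integral {0..1} li_kernel"
      using elim int by (intro Henstock_Kurzweil_Integration.integral_combine) auto
    then show ?case using li_truncated[of e x] elim x by simp
  qed
  ultimately have "((\<lambda>e. integral ({0..x} - {1 - e<..<1 + e}) (\<lambda>t. 1 / ln t)) \<longlongrightarrow>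
     integral {0..1} li_kernel - 0 + integral {2..x} (\<lambda>t. 1 / ln t)) (at_right 0)"
    by (rule Lim_transform_eventually)
  then show ?thesis unfolding li_def by (subst tendsto_Lim) auto
qed

lemma li_diff:
  assumes "2 \<le> a" "a \<le> b"
  shows "li b - li a = integral {a..b} (\<lambda>t. 1 / ln t)"
  using Henstock_Kurzweil_Integration.integral_combine[of 2 a b "\<lambda>t. 1 / ln t"] assms
  by (simp add: li_eq inverse_ln_integrable)

lemma li_diff_bounds:
  assumes "2 \<le> a" "a \<le> b"
  shows "(b - a) / ln b \<le> li b - li a" "li b - li a \<le> (b - a) / ln a"
proof -
  have int: "(\<lambda>t. 1 / ln t) integrable_on {a..b}" using assms by (intro inverse_ln_integrable) auto
  have "integral {a..b} (\<lambda>t. 1 / ln b) \<le> integral {a..b} (\<lambda>t. 1 / ln t)"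
    by (intro integral_le int) (use assms in \<open>auto intro!: divide_left_mono mult_pos_pos\<close>)
  then show "(b - a) / ln b \<le> li b - li a" using assms by (simp add: li_diff)
  have "integral {a..b} (\<lambda>t. 1 / ln t) \<le> integral {a..b} (\<lambda>t. 1 / ln a)"
    by (intro integral_le int) (use assms in \<open>auto intro!: divide_left_mono mult_pos_pos\<close>)
  then show "li b - li a \<le> (b - a) / ln a" using assms by (simp add: li_diff)
qed

section \<open>Comparison of \<open>prime_pi\<close> with \<open>li\<close>\<close>

lemma sum_inverse_ln_bigo:
  "(\<lambda>N. (\<Sum>n\<le>N. 1 / ln (real n)) - li (real N)) \<in> O(\<lambda>N. real N / ln (real N) ^ 3)"
proof (rule stolz_bigo)
  let ?D = "\<lambda>N. (\<Sum>n\<le>N. 1 / ln (real n)) - li (real N)"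
  have "(\<lambda>N. ?D (Suc N) - ?D N) \<in> O(\<lambda>N. 1 / ln (real N) - 1 / ln (real (Suc N)))"
  proof (rule bigoI[where c = 1])
    show "\<forall>\<^sub>F N in sequentially. norm (?D (Suc N) - ?D N) \<le> 1 * norm (1 / ln (real N) - 1 / ln (real (Suc N)))"
      using eventually_ge_at_top[of 2]
    proof eventually_elim
      case (elim N)
      then show ?case using li_diff_bounds[of "real N" "real (Suc N)"] by simp
    qed
  qed
  also have "(\<lambda>N. 1 / ln (real N) - 1 / ln (real (Suc N))) \<in> O(\<lambda>N. real (Suc N) / ln (real (Suc N)) ^ 3 - real N / ln (real N) ^ 3)"
    by real_asymp
  finally show "(\<lambda>N. ?D (Suc N) - ?D N) \<in> O(\<lambda>N. real (Suc N) / ln (real (Suc N)) ^ 3 - real N / ln (real N) ^ 3)" .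
  show "\<forall>\<^sub>F N in sequentially. real N / ln (real N) ^ 3 \<le> real (Suc N) / ln (real (Suc N)) ^ 3" by real_asymp
  show "filterlim (\<lambda>N. real N / ln (real N) ^ 3) at_top sequentially" by real_asymp
qed

text \<open>A proper prime power \<open>p ^ k\<close> has \<open>k \<ge> 2\<close>, hence
  \<open>p \<le> sqrt N\<close>, and \<open>p \<ge> 2\<close> forces
  \<open>k \<le> ln N / ln 2\<close>.\<close>

lemma card_proper_prime_powers:
  assumes N: "N \<ge> 1"
  shows "real (card {n. n \<le> N \<and> primepow n \<and> \<not> prime n}) \<le> sqrt (real N) * (ln (real N) / ln 2)"
proof -
  define m where "m = nat \<lfloor>sqrt (real N)\<rfloor>"
  define k0 where "k0 = nat \<lfloor>ln (real N) / ln 2\<rfloor>"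
  have "{n. n \<le> N \<and> primepow n \<and> \<not> prime n} \<subseteq> (\<lambda>(p, k). p ^ k) ` ({1..m} \<times> {1..k0})"
  proof
    fix n assume n: "n \<in> {n. n \<le> N \<and> primepow n \<and> \<not> prime n}"
    then obtain p k where pk: "prime p" "k > 0" "n = p ^ k" by (auto simp: primepow_def)
    with n have k: "k \<ge> 2" by (cases "k = 1") auto
    have p: "p \<ge> 2" using pk prime_ge_2_nat by blast
    have le: "p ^ k \<le> N" using n pk by simp
    have "p ^ 2 \<le> p ^ k" using p k by (intro power_increasing) auto
    with le have "p ^ 2 \<le> N" by linarith
    then have "real p \<le> sqrt (real N)" by (intro real_le_rsqrt) (metis of_nat_le_iff of_nat_power)
    then have "p \<le> m" by (simp add: m_def le_nat_floor)
    have "2 ^ k \<le> p ^ k" using p by (intro power_mono) auto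
    with le have "2 ^ k \<le> N" by linarith
    then have "(2::real) ^ k \<le> real N" by (metis of_nat_le_iff of_nat_numeral of_nat_power)
    then have "ln (2 ^ k) \<le> ln (real N)" by (intro ln_mono) auto
    then have "real k \<le> ln (real N) / ln 2" by (simp add: ln_realpow field_simps)
    then have "k \<le> k0" by (simp add: k0_def le_nat_floor)
    with \<open>p \<le> m\<close> p k show "n \<in> (\<lambda>(p, k). p ^ k) ` ({1..m} \<times> {1..k0})"
      by (intro image_eqI[of _ _ "(p, k)"]) (auto simp: pk)
  qed
  then have "card {n. n \<le> N \<and> primepow n \<and> \<not> prime n} \<le> card ({1..m} \<times> {1..k0})"
    by (meson card_image_le card_mono finite_SigmaI finite_atLeastAtMost finite_imageI order.trans)
  then have "real (card {n. n \<le> N \<and> primepow n \<and> \<not> prime n}) \<le> real m * real k0"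
    by (simp flip: of_nat_mult)
  also have "\<dots> \<le> sqrt (real N) * (ln (real N) / ln 2)"
    using N by (intro mult_mono) (auto simp: m_def k0_def)
  finally show ?thesis .
qed

lemma prime_pi_mangoldt:
  assumes N: "N \<ge> 1"
  shows "\<bar>(\<Sum>n\<le>N. mangoldt n / ln (real n)) - real (prime_pi (real N))\<bar> \<le> sqrt (real N) * (ln (real N) / ln 2)"
proof -
  let ?Q = "{n. n \<le> N \<and> primepow n \<and> \<not> prime n}"
  let ?P = "{n. n \<le> N \<and> prime n}"
  have "(\<Sum>n\<le>N. mangoldt n / ln (real n)) = (\<Sum>n\<in>?P \<union> ?Q. mangoldt n / ln (real n))"
    by (rule sum.mono_neutral_right) (auto simp: mangoldt_def)
  also have "\<dots> = (\<Sum>n\<in>?P. mangoldt n / ln (real n)) + (\<Sum>n\<in>?Q. mangoldt n / ln (real n))"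
    by (rule sum.union_disjoint) auto
  also have "(\<Sum>n\<in>?P. mangoldt n / ln (real n)) = (\<Sum>n\<in>?P. 1 :: real)"
    by (rule sum.cong) (auto dest: prime_gt_1_nat)
  also have "\<dots> = real (prime_pi (real N))" by (simp add: prime_pi_def conj_commute)
  finally have eq: "(\<Sum>n\<le>N. mangoldt n / ln (real n)) - real (prime_pi (real N)) = (\<Sum>n\<in>?Q. mangoldt n / ln (real n))" by simp
  have "0 \<le> (\<Sum>n\<in>?Q. mangoldt n / ln (real n))"
    using mlog_nonneg by (intro sum_nonneg) (auto simp: mlog_def)
  moreover have "(\<Sum>n\<in>?Q. mangoldt n / ln (real n)) \<le> (\<Sum>n\<in>?Q. 1 :: real)"
  proof (rule sum_mono)
    fix n assume "n \<in> ?Q"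
    then have "n > 1" using primepow_gt_Suc_0[of n] by auto
    then show "mangoldt n / ln (real n) \<le> 1" using mangoldt_le[of n] by (simp add: field_simps)
  qed
  moreover have "(\<Sum>n\<in>?Q. 1 :: real) = real (card ?Q)" by simp
  ultimately show ?thesis using card_proper_prime_powers[OF N] unfolding eq by linarith
qed

lemma prime_pi_nat_bigo:
  "(\<lambda>N. real (prime_pi (real N)) - li (real N)) \<in> O(\<lambda>N::nat. real N / ln (real N) ^ 3)"
proof -
  let ?g = "\<lambda>N::nat. real N / ln (real N) ^ 3"
  have "(\<lambda>N. (\<Sum>n\<le>N. mangoldt n / ln (real n)) - real (prime_pi (real N))) \<in> O(\<lambda>N. sqrt (real N) * (ln (real N) / ln 2))"
    by (rule bigoI[where c = 1], rule eventually_mono[OF eventually_ge_at_top[of 1]])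
       (use prime_pi_mangoldt in \<open>auto intro: order.trans[OF _ abs_ge_self]\<close>)
  also have "(\<lambda>N. sqrt (real N) * (ln (real N) / ln 2)) \<in> O(?g)" by real_asymp
  finally have A: "(\<lambda>N. (\<Sum>n\<le>N. mangoldt n / ln (real n)) - real (prime_pi (real N))) \<in> O(?g)" .
  have "(\<lambda>N. (\<Sum>n\<le>N. (mangoldt n - 1) / ln (real n)) + ((\<Sum>n\<le>N. 1 / ln (real n)) - li (real N))
     - ((\<Sum>n\<le>N. mangoldt n / ln (real n)) - real (prime_pi (real N)))) \<in> O(?g)"
    by (intro sum_in_bigo mangoldt_sum_bigo sum_inverse_ln_bigo A)
  then show ?thesis by (simp add: diff_divide_distrib sum_subtractf)
qed

text \<open>Passing from \<open>nat \<lfloor>x\<rfloor>\<close> to real \<open>x\<close> leaves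
  \<open>prime_pi\<close> unchanged and moves \<open>li\<close> by at most
  \<open>1 / ln 2\<close>.\<close>

theorem prime_number_theorem:
  "(\<lambda>x. li x - real (prime_pi x)) \<in> O(\<lambda>x. x / ln x ^ 3)"
proof -
  let ?N = "\<lambda>x::real. nat \<lfloor>x\<rfloor>"
  have N: "filterlim ?N at_top at_top"
    by (rule filterlim_compose[OF filterlim_nat_sequentially filterlim_floor_sequentially])
  have "(\<lambda>x. real (prime_pi (real (?N x))) - li (real (?N x))) \<in> O(\<lambda>x. real (?N x) / ln (real (?N x)) ^ 3)"
    by (rule landau_o.big.compose[OF prime_pi_nat_bigo N])
  also have "(\<lambda>x. real (?N x) / ln (real (?N x)) ^ 3) \<in> O(\<lambda>x. x / ln x ^ 3)"
    by real_asymp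
  finally have A: "(\<lambda>x. real (prime_pi (real (?N x))) - li (real (?N x))) \<in> O(\<lambda>x. x / ln x ^ 3)" .
  have "(\<lambda>x. li x - li (real (?N x))) \<in> O(\<lambda>x. 1)"
  proof (rule bigoI[where c = "1 / ln 2"], rule eventually_mono[OF eventually_ge_at_top[of 2]])
    fix x :: real assume x: "x \<ge> 2"
    define n where "n = real (?N x)"
    have "n = of_int \<lfloor>x\<rfloor>" "2 \<le> \<lfloor>x\<rfloor>" using x by (simp_all add: n_def le_floor_iff)
    then have n: "2 \<le> n" "n \<le> x" "x - n \<le> 1" by linarith+
    have "0 \<le> (x - n) / ln x" using n by simp
    moreover have "(x - n) / ln n \<le> 1 / ln 2" using n by (intro frac_le) auto
    ultimately have "\<bar>li x - li n\<bar> \<le> 1 / ln 2"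
      using li_diff_bounds[of n x] n by linarith
    then show "norm (li x - li (real (?N x))) \<le> 1 / ln 2 * norm (1::real)"
      by (simp only: n_def real_norm_def norm_one mult_1_right)
  qed
  also have "(\<lambda>x. 1) \<in> O(\<lambda>x::real. x / ln x ^ 3)" by real_asymp
  finally have B: "(\<lambda>x. li x - li (real (?N x))) \<in> O(\<lambda>x. x / ln x ^ 3)" .
  have "(\<lambda>x. (li x - li (real (?N x))) - (real (prime_pi (real (?N x))) - li (real (?N x)))) \<in> O(\<lambda>x. x / ln x ^ 3)"
    by (intro sum_in_bigo A B)
  also have "?this \<longleftrightarrow> ?thesis"
  proof (rule landau_o.big.in_cong, rule eventually_mono[OF eventually_ge_at_top[of 0]])
    fix x :: real assume x: "x \<ge> 0"
    have "real p \<le> x \<longleftrightarrow> real p \<le> real (?N x)" for p :: nat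
    proof -
      have "p \<le> ?N x \<longleftrightarrow> real p \<le> x"
        using x le_nat_iff[of "\<lfloor>x\<rfloor>" p] by (simp add: le_floor_iff)
      then show ?thesis by (simp only: of_nat_le_iff)
    qed
    then have "prime_pi (real (?N x)) = prime_pi x" by (simp add: prime_pi_def)
    then show "(li x - li (real (?N x))) - (real (prime_pi (real (?N x))) - li (real (?N x))) = li x - real (prime_pi x)"
      by simp
  qed
  finally show ?thesis .
qed

section \<open>The endpoint sums\<close>

text \<open>Here \<open>1 / ln t - 1 / ln b = ln (b / t) / (ln t * ln b)\<close> and
  \<open>(b - t) / b \<le> ln (b / t) \<le> (b - t) / t\<close>. With the other factors frozen at an
  endpoint, the integral of a linear function remains, whence the factor 1/2.\<close>

lemma li_endpoint_error:
  assumes "2 \<le> a" "a \<le> b"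
  shows "(b - a)\<^sup>2 / (2 * b * ln b ^ 2) \<le> li b - li a - (b - a) / ln b"
    and "li b - li a - (b - a) / ln b \<le> (b - a)\<^sup>2 / (2 * a * ln a ^ 2)"
proof -
  have lin: "((\<lambda>t. (b - t) / k) has_integral ((b - a)\<^sup>2 / (2 * k))) {a..b}" for k
  proof -
    have "((\<lambda>t. b - t) has_integral (- ((b - b)\<^sup>2 / 2) - (- ((b - a)\<^sup>2 / 2)))) {a..b}"
      using assms(2)
      by (intro fundamental_theorem_of_calculus)
         (auto intro!: derivative_eq_intros simp: field_simps simp flip: has_real_derivative_iff_has_vector_derivative)
    from has_integral_divide[OF this, of k] show ?thesis by simp
  qed
  have eq: "((\<lambda>t. 1 / ln t - 1 / ln b) has_integral (li b - li a - (b - a) / ln b)) {a..b}"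
  proof -
    have "((\<lambda>t. 1 / ln t) has_integral (li b - li a)) {a..b}"
      unfolding li_diff[OF assms] by (rule integrable_integral, rule inverse_ln_integrable) (use assms in auto)
    from has_integral_diff[OF this has_integral_const_real[of "1 / ln b" a b]] show ?thesis
      using assms by simp
  qed
  have bounds: "(b - t) / (b * ln b ^ 2) \<le> 1 / ln t - 1 / ln b" "1 / ln t - 1 / ln b \<le> (b - t) / (a * ln a ^ 2)"
    if t: "a \<le> t" "t \<le> b" for t
  proof -
    have pos: "0 < ln a" "ln a \<le> ln t" "ln t \<le> ln b" "0 < t" "0 < b" using t assms by auto
    then have pos2: "0 < ln t" "0 < ln b" "0 < ln t * ln b" "1 \<le> a" "1 \<le> t" "1 \<le> b" using t assms by auto
    have e: "1 / ln t - 1 / ln b = ln (b / t) / (ln t * ln b)"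
      using pos t assms by (simp add: ln_div field_simps)
    have "ln (b / t) \<le> b / t - 1" using pos by (intro ln_le_minus_one) auto
    also have "\<dots> = (b - t) / t" using pos by (simp add: field_simps)
    also have "\<dots> \<le> (b - t) / a" using t assms by (intro divide_left_mono) auto
    finally have 1: "ln (b / t) \<le> (b - t) / a" .
    have "ln (t / b) \<le> t / b - 1" using pos by (intro ln_le_minus_one) auto
    then have 2: "(b - t) / b \<le> ln (b / t)" using pos by (simp add: ln_div field_simps)
    have "0 \<le> ln (b / t)" using pos t by (simp add: ln_div)
    have "(b - t) / (b * ln b ^ 2) = (b - t) / b / (ln b * ln b)" by (simp add: power2_eq_square)
    also have "\<dots> \<le> ln (b / t) / (ln t * ln b)"
      using 2 pos pos2 t \<open>0 \<le> ln (b / t)\<close> by (intro frac_le mult_mono) auto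
    finally show "(b - t) / (b * ln b ^ 2) \<le> 1 / ln t - 1 / ln b" unfolding e .
    have "ln (b / t) / (ln t * ln b) \<le> (b - t) / a / (ln a * ln a)"
      using 1 pos pos2 t assms by (intro frac_le mult_mono) auto
    then show "1 / ln t - 1 / ln b \<le> (b - t) / (a * ln a ^ 2)" unfolding e by (simp add: power2_eq_square)
  qed
  show "(b - a)\<^sup>2 / (2 * b * ln b ^ 2) \<le> li b - li a - (b - a) / ln b"
    using has_integral_le[OF lin[of "b * ln b ^ 2"] eq] bounds(1) by (simp add: mult.assoc)
  show "li b - li a - (b - a) / ln b \<le> (b - a)\<^sup>2 / (2 * a * ln a ^ 2)"
    using has_integral_le[OF eq lin[of "a * ln a ^ 2"]] bounds(2) by (simp add: mult.assoc)
qed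

text \<open>A quantity at real \<open>x\<close> between two consecutive values of
  \<open>L_seq\<close> is enclosed by functions of the index alone, whose asymptotics are
  explicit.\<close>

lemma bigo_sandwich:
  fixes f g1 g2 h :: "'a \<Rightarrow> real"
  assumes "g1 \<in> O[F](h)" "g2 \<in> O[F](h)" "\<forall>\<^sub>F x in F. g1 x \<le> f x \<and> f x \<le> g2 x"
  shows "f \<in> O[F](h)"
proof -
  obtain c1 where c1: "\<forall>\<^sub>F x in F. norm (g1 x) \<le> c1 * norm (h x)" using assms(1) by (elim landau_o.bigE)
  obtain c2 where c2: "\<forall>\<^sub>F x in F. norm (g2 x) \<le> c2 * norm (h x)" using assms(2) by (elim landau_o.bigE)
  have "\<forall>\<^sub>F x in F. norm (f x) \<le> max c1 c2 * norm (h x)"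
    using c1 c2 assms(3)
  proof eventually_elim
    case (elim x)
    have "c1 * norm (h x) \<le> max c1 c2 * norm (h x)" "c2 * norm (h x) \<le> max c1 c2 * norm (h x)"
      by (intro mult_right_mono; simp)+
    with elim show ?case by (simp only: real_norm_def) linarith
  qed
  then show ?thesis by (rule bigoI)
qed

lemma L_seq_Suc: "L_seq l (Suc n) - L_seq l n = 1 + real l * real n"
  using h_seq_eq[of l n] by (simp add: h_seq_def)

lemma L_seq_mono:
  assumes "m \<le> n"
  shows "L_seq l m \<le> L_seq l n"
proof (rule lift_Suc_mono_le[OF _ assms])
  have "0 \<le> 1 + real l * real n" for n by simp
  then show "L_seq l n \<le> L_seq l (Suc n)" for n using L_seq_Suc[of l n] by (metis diff_ge_0_iff_ge)
qed

lemma L_seq_ge_2: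
  assumes "l \<ge> 1" "n \<ge> 2"
  shows "L_seq l n \<ge> 2"
proof -
  have "L_seq l 2 \<le> L_seq l n" using assms by (intro L_seq_mono) auto
  moreover have "L_seq l 2 = real l + 2" by (simp add: L_seq_def)
  ultimately show ?thesis by simp
qed

text \<open>\<open>nu l\<close> inverts \<open>L_seq l\<close>: by the completed square
  \<open>L\<close> in the proof, comparing \<open>x\<close> with \<open>L_seq l n\<close> amounts to
  comparing \<open>D\<close> with \<open>2 * r * n - r + 2\<close>. The hypothesis on
  \<open>x\<close> gives \<open>D > r + 2\<close>, that is, \<open>nu l x > 1\<close>.\<close>

lemma n_idx_bounds:
  assumes l: "l \<ge> 1" and x: "x \<ge> 2"
  obtains m where "n_idx l x = Suc m" "m \<ge> 1" "L_seq l m < x" "x \<le> L_seq l (Suc m)"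
proof -
  define r where "r = real l"
  define D where "D = sqrt (8 * r * x + (r - 2)\<^sup>2)"
  have r: "r \<ge> 1" using l by (simp add: r_def)
  have D2: "D\<^sup>2 = 8 * r * x + (r - 2)\<^sup>2" and D0: "D \<ge> 0" using r x by (simp_all add: D_def)
  have nu: "nu l x = (D + r - 2) / (2 * r)" by (simp add: nu_def D_def r_def)
  have L: "8 * r * L_seq l n + (r - 2)\<^sup>2 = (2 * r * real n - r + 2)\<^sup>2" for n
    by (simp add: L_seq_def r_def power2_eq_square field_simps)
  have "(r + 2)\<^sup>2 < D\<^sup>2" unfolding D2 using r x mult_left_mono[of 2 x "8 * r"] by (simp add: power2_eq_square algebra_simps)
  then have "r + 2 < D" using D0 by (rule power_less_imp_less_base)
  then have nu1: "nu l x > 1" unfolding nu using r by (simp add: field_simps)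
  define n where "n = n_idx l x"
  have n: "real n \<ge> nu l x" "real n - 1 < nu l x" using nu1 unfolding n_def n_idx_def by linarith+
  then have "n \<ge> 2" using nu1 by linarith
  then obtain m where m: "n = Suc m" "m \<ge> 1" by (cases n) auto
  show thesis
  proof (rule that[of m])
    show "n_idx l x = Suc m" "m \<ge> 1" using m by (simp_all add: n_def)
    have "D \<le> 2 * r * real n - r + 2" using n(1) r unfolding nu by (simp add: field_simps)
    then have "D\<^sup>2 \<le> (2 * r * real n - r + 2)\<^sup>2" using D0 by (intro power_mono) auto
    then have "r * x \<le> r * L_seq l n" unfolding D2 L[symmetric] by simp
    then show "x \<le> L_seq l (Suc m)" using r m by simp
    have "2 * r * real m - r + 2 < D" using n(2) m r unfolding nu by (simp add: field_simps)
    moreover have "r * 1 \<le> r * real m" using r m by (intro mult_left_mono) auto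
    then have "0 \<le> 2 * r * real m - r + 2" using r by linarith
    ultimately have "(2 * r * real m - r + 2)\<^sup>2 < D\<^sup>2" by (intro power_strict_mono) auto
    then have "r * L_seq l m < r * x" unfolding D2 L[symmetric] by simp
    then show "L_seq l m < x" using r by simp
  qed
qed

lemma filterlim_n_idx:
  assumes "l \<ge> 1"
  shows "filterlim (n_idx l) at_top at_top"
proof -
  have "real l > 0" using assms by simp
  then have "filterlim (nu l) at_top at_top" unfolding nu_def[abs_def] by real_asymp
  then have "filterlim (\<lambda>x. nat \<lfloor>nu l x\<rfloor>) at_top at_top"
    by (intro filterlim_compose[OF filterlim_nat_sequentially] filterlim_compose[OF filterlim_floor_sequentially])
  then show ?thesis
    by (rule filterlim_at_top_mono) (auto simp: n_idx_def intro!: always_eventually nat_mono floor_le_ceiling)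
qed

text \<open>Each step contributes \<open>l / ln (L n) ^ 2\<close> up to lower order, and so does the increment of
  \<open>l * n / ln (L n) ^ 2\<close>.\<close>
lemma Sigma_seq_li_bigo:
  assumes l: "l \<ge> 1"
  shows "(\<lambda>n. (li (L_seq l n) - Sigma_seq l n) - real l * (real n / ln (L_seq l n) ^ 2)) \<in> O(\<lambda>n. real n / ln (real n) ^ 3)"
proof (rule stolz_bigo)
  define r where "r = real l"
  have r: "r > 0" using l by (simp add: r_def)
  define L where "L = (\<lambda>n::nat. real n * (r * (real n - 1) + 2) / 2)"
  have L_eq: "L_seq l = L" by (simp add: L_def r_def L_seq_def fun_eq_iff)
  let ?v = "\<lambda>n::nat. 1 / ln (real n) ^ 3"
  have v: "?v \<in> O(\<lambda>n. real (Suc n) / ln (real (Suc n)) ^ 3 - real n / ln (real n) ^ 3)" by real_asymp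
  \<comment> \<open>\<open>w\<close> is the increment of the main term, split into the leading
    \<open>r / ln (L (Suc n)) ^ 2\<close> and a remainder of lower order.\<close>
  define w where "w = (\<lambda>n. r * (1 / ln (L (Suc n)) ^ 2 - real n * (1 / ln (L n) ^ 2 - 1 / ln (L (Suc n)) ^ 2)))"
  have w: "w n = r * (real (Suc n) / ln (L (Suc n)) ^ 2 - real n / ln (L n) ^ 2)" for n
    by (simp add: w_def algebra_simps add_divide_distrib)
  have t1: "(\<lambda>n. real n * (1 / ln (L n) ^ 2 - 1 / ln (L (Suc n)) ^ 2)) \<in> O(?v)"
    using r unfolding L_def by real_asymp
  have t3: "(\<lambda>n. 1 / ln (L n) ^ 2 - 1 / ln (L (Suc n)) ^ 2) \<in> O(?v)"
    using r unfolding L_def by real_asymp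
  have t2: "(\<lambda>n::nat. (1 + r ^ 2 * n) / (real n * (r * (real n - 1) + 2)) * (1 / ln (L n) ^ 2)) \<in> O(?v)"
    using r unfolding L_def by real_asymp
  have t4: "(\<lambda>n::nat. (1 - r ^ 2 * n - 2 * r) / (real (Suc n) * (r * (real (Suc n) - 1) + 2)) * (1 / ln (L (Suc n)) ^ 2)) \<in> O(?v)"
    using r unfolding L_def by real_asymp
  have rw: "(\<lambda>n. r * f n) \<in> O(?v)" if "f \<in> O(?v)" for f using that r by simp
  \<comment> \<open>The two bounds of \<open>li_endpoint_error\<close> for one step of length
    \<open>1 + r * n\<close>, less \<open>w\<close>. Both are \<open>O(?v)\<close>, since the square
    divided by \<open>2 * L n\<close> or \<open>2 * L (Suc n)\<close> is
    \<open>r + O(1 / n)\<close>.\<close>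
  define up where "up = (\<lambda>n. (1 + r * real n)\<^sup>2 / (2 * L n * ln (L n) ^ 2) - w n)"
  define lo where "lo = (\<lambda>n. (1 + r * real n)\<^sup>2 / (2 * L (Suc n) * ln (L (Suc n)) ^ 2) - w n)"
  have up: "up \<in> O(?v)"
  proof -
    have "(\<lambda>n. (1 + r ^ 2 * n) / (real n * (r * (real n - 1) + 2)) * (1 / ln (L n) ^ 2)
       + r * (1 / ln (L n) ^ 2 - 1 / ln (L (Suc n)) ^ 2) + r * (real n * (1 / ln (L n) ^ 2 - 1 / ln (L (Suc n)) ^ 2))) \<in> O(?v)"
      by (intro sum_in_bigo rw t1 t2 t3)
    also have "?this \<longleftrightarrow> ?thesis"
    proof (rule landau_o.big.in_cong, rule eventually_mono[OF eventually_ge_at_top[of 1]])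
      fix n :: nat assume n: "n \<ge> 1"
      define M where "M = real n * (r * (real n - 1) + 2)"
      have M: "M > 0" unfolding M_def using n r by (intro mult_pos_pos add_nonneg_pos) auto
      have "2 * L n = M" by (simp add: L_def M_def)
      \<comment> \<open>Division of the square by \<open>M = 2 * L n\<close> with remainder: the
        quotient \<open>r\<close> meets the leading term of \<open>w\<close>, and the remainder is
        \<open>t2\<close>.\<close>
      moreover have "(1 + r * real n)\<^sup>2 = (1 + r ^ 2 * n) + r * M" by (simp add: M_def power2_eq_square algebra_simps)
      ultimately have "(1 + r * real n)\<^sup>2 / (2 * L n * ln (L n) ^ 2) = ((1 + r ^ 2 * n) / M + r) * (1 / ln (L n) ^ 2)"
        using M by (simp add: field_simps)
      then show "(1 + r ^ 2 * n) / (real n * (r * (real n - 1) + 2)) * (1 / ln (L n) ^ 2)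
       + r * (1 / ln (L n) ^ 2 - 1 / ln (L (Suc n)) ^ 2) + r * (real n * (1 / ln (L n) ^ 2 - 1 / ln (L (Suc n)) ^ 2)) = up n"
        unfolding up_def w_def M_def[symmetric] by (simp add: algebra_simps)
    qed
    finally show ?thesis .
  qed
  have lo: "lo \<in> O(?v)"
  proof -
    have "(\<lambda>n. (1 - r ^ 2 * n - 2 * r) / (real (Suc n) * (r * (real (Suc n) - 1) + 2)) * (1 / ln (L (Suc n)) ^ 2)
       + r * (real n * (1 / ln (L n) ^ 2 - 1 / ln (L (Suc n)) ^ 2))) \<in> O(?v)"
      by (intro sum_in_bigo rw t1 t4)
    also have "?this \<longleftrightarrow> ?thesis"
    proof (rule landau_o.big.in_cong, rule eventually_mono[OF eventually_ge_at_top[of 1]])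
      fix n :: nat assume n: "n \<ge> 1"
      define M where "M = real (Suc n) * (r * (real (Suc n) - 1) + 2)"
      have M: "M > 0" unfolding M_def using n r by (intro mult_pos_pos add_nonneg_pos) auto
      have "2 * L (Suc n) = M" by (simp add: L_def M_def)
      moreover have "(1 + r * real n)\<^sup>2 = (1 - r ^ 2 * n - 2 * r) + r * M" by (simp add: M_def power2_eq_square algebra_simps)
      ultimately have "(1 + r * real n)\<^sup>2 / (2 * L (Suc n) * ln (L (Suc n)) ^ 2) = ((1 - r ^ 2 * n - 2 * r) / M + r) * (1 / ln (L (Suc n)) ^ 2)"
        using M by (simp add: field_simps)
      then show "(1 - r ^ 2 * n - 2 * r) / (real (Suc n) * (r * (real (Suc n) - 1) + 2)) * (1 / ln (L (Suc n)) ^ 2)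
       + r * (real n * (1 / ln (L n) ^ 2 - 1 / ln (L (Suc n)) ^ 2)) = lo n"
        unfolding lo_def w_def M_def[symmetric] by (simp add: algebra_simps)
    qed
    finally show ?thesis .
  qed
  let ?D = "\<lambda>n. (li (L_seq l n) - Sigma_seq l n) - real l * (real n / ln (L_seq l n) ^ 2)"
  have "(\<lambda>n. ?D (Suc n) - ?D n) \<in> O(?v)"
  proof (rule bigo_sandwich[OF lo up], rule eventually_mono[OF eventually_ge_at_top[of 2]])
    fix n :: nat assume n: "n \<ge> 2"
    have "Sigma_seq l (Suc n) - Sigma_seq l n = (1 + r * real n) / ln (L (Suc n))"
      using n by (simp add: Sigma_seq_def s_seq_def h_seq_eq L_eq r_def)
    then have "?D (Suc n) - ?D n = li (L (Suc n)) - li (L n) - (1 + r * real n) / ln (L (Suc n)) - w n"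
      unfolding w by (simp add: L_eq r_def algebra_simps)
    moreover have "L (Suc n) - L n = 1 + r * real n" using L_seq_Suc[of l n] by (simp add: L_eq r_def)
    moreover have "2 \<le> L n" "L n \<le> L (Suc n)"
      using L_seq_ge_2[OF l n] L_seq_mono[of n "Suc n" l] by (simp_all add: L_eq)
    ultimately show "lo n \<le> ?D (Suc n) - ?D n \<and> ?D (Suc n) - ?D n \<le> up n"
      using li_endpoint_error[of "L n" "L (Suc n)"] by (simp add: lo_def up_def)
  qed
  then show "(\<lambda>n. ?D (Suc n) - ?D n) \<in> O(\<lambda>n. real (Suc n) / ln (real (Suc n)) ^ 3 - real n / ln (real n) ^ 3)"
    using v landau_o.big_trans by blast
  show "\<forall>\<^sub>F N in sequentially. real N / ln (real N) ^ 3 \<le> real (Suc N) / ln (real (Suc N)) ^ 3" by real_asymp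
  show "filterlim (\<lambda>N. real N / ln (real N) ^ 3) at_top sequentially" by real_asymp
qed

section \<open>Asymptotics along the index\<close>

lemma sqrt_ratio_bigo:
  fixes r c :: real
  assumes "r > 0"
  shows "(\<lambda>n::nat. r * real n / (1 + r * real n) * sqrt (1 + c / real n) - 1) \<in> O(\<lambda>n. 1 / real n)"
  using assms by real_asymp

lemma sqrt_ratio_Suc_bigo:
  fixes r c :: real
  assumes "r > 0"
  shows "(\<lambda>n::nat. r * real (Suc n) / (1 + r * real n) * sqrt (1 + c / real (Suc n)) - 1) \<in> O(\<lambda>n. 1 / real n)"
  using assms by real_asymp

text \<open>Consecutive values differ by a relative amount \<open>O(1 / n)\<close>, which
  \<open>ln b - ln a \<le> (b - a) / a\<close> passes on to the logarithms; the denominator is at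
  least 1 once the argument reaches \<open>exp 1\<close>.\<close>

lemma ln_quadratic_ratio_bigo:
  fixes r :: real
  assumes r: "r > 0"
  shows "(\<lambda>n::nat. ln (real (Suc n) * (r * (real (Suc n) - 1) + 2) / 2) / ln (real n * (r * (real n - 1) + 2) / 2) - 1)
    \<in> O(\<lambda>n. 1 / real n)"
proof (rule bigo_sandwich)
  let ?L = "\<lambda>n::nat. real n * (r * (real n - 1) + 2) / 2"
  show "(\<lambda>n. 0) \<in> O(\<lambda>n. 1 / real n)" by simp
  show "(\<lambda>n. (1 + r * real n) / ?L n) \<in> O(\<lambda>n. 1 / real n)" using r by real_asymp
  have "filterlim ?L at_top sequentially" using r by real_asymp
  then have "\<forall>\<^sub>F n in sequentially. ?L n \<ge> exp 1" by (auto simp: filterlim_at_top)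
  then show "\<forall>\<^sub>F n in sequentially. 0 \<le> ln (?L (Suc n)) / ln (?L n) - 1 \<and> ln (?L (Suc n)) / ln (?L n) - 1 \<le> (1 + r * real n) / ?L n"
  proof eventually_elim
    case (elim n)
    define a where "a = ?L n"
    define b where "b = ?L (Suc n)"
    have a: "a \<ge> exp 1" using elim by (simp add: a_def)
    then have a0: "a > 0" using exp_gt_zero[of 1] by linarith
    have b: "b = a + (1 + r * real n)" by (simp add: a_def b_def field_simps)
    have h: "0 \<le> 1 + r * real n" using r by (simp add: add_nonneg_nonneg)
    have b0: "b > 0" using b h a0 by linarith
    have lna: "ln a \<ge> 1" using a a0 by (simp add: ln_ge_iff)
    have lnb: "ln a \<le> ln b" using b h a0 by simp
    have "ln (b / a) \<le> b / a - 1" using b h a0 by (intro ln_le_minus_one divide_pos_pos) auto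
    moreover have "ln (b / a) = ln b - ln a" using b0 a0 by (simp add: ln_div)
    moreover have "b / a - 1 = (1 + r * real n) / a" using a0 unfolding b by (simp add: field_simps)
    ultimately have d: "ln b - ln a \<le> (1 + r * real n) / a" by linarith
    have "ln b / ln a - 1 = (ln b - ln a) / ln a" using lna by (simp add: field_simps)
    moreover have "0 \<le> (ln b - ln a) / ln a" using lna lnb by simp
    moreover have "(ln b - ln a) / ln a \<le> (ln b - ln a) / 1" using lna lnb by (intro divide_left_mono) auto
    ultimately show ?case using d unfolding a_def[symmetric] b_def[symmetric] by simp
  qed
qed

lemma endpoint_error_bigo:
  fixes r :: real
  assumes "r > 0"
  shows "(\<lambda>n::nat. (1 + r * real n)\<^sup>2 / (2 * (real n * (r * (real n - 1) + 2) / 2) * ln (real n * (r * (real n - 1) + 2) / 2) ^ 2))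
    \<in> O(\<lambda>n. real n / ln (real n) ^ 3)"
  using assms by real_asymp

text \<open>Up to the factor \<open>sqrt r\<close>, the first term is the main part of
  \<open>(li x - S_hat l x) / q_fun l x\<close>: the product of \<open>r * n / ln (L n) ^ 2\<close>
  and \<open>ln (L (Suc n)) / (1 + r * n)\<close>.\<close>

lemma inverse_ln_quadratic_bigo:
  fixes r :: real
  assumes "r > 0"
  shows "(\<lambda>n::nat. r * real n / (1 + r * real n) * (ln (real (Suc n) * (r * (real (Suc n) - 1) + 2) / 2) / ln (real n * (r * (real n - 1) + 2) / 2) ^ 2)
      - 1 / ln (real n * (r * (real n - 1) + 2) / 2)) \<in> O(\<lambda>n. 1 / ln (real n) ^ 2)"
  using assms by real_asymp

lemma inverse_ln_quadratic_diff_bigo: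
  fixes r :: real
  assumes "r > 0"
  shows "(\<lambda>n::nat. 1 / ln (real n * (r * (real n - 1) + 2) / 2) - 1 / ln (real (Suc n) * (r * (real (Suc n) - 1) + 2) / 2)) \<in> O(\<lambda>n. 1 / ln (real n) ^ 2)"
  using assms by real_asymp

lemma ln_quadratic_div_linear_bigo:
  fixes r :: real
  assumes "r > 0"
  shows "(\<lambda>n::nat. real n / ln (real n) ^ 3 * (ln (real (Suc n) * (r * (real (Suc n) - 1) + 2) / 2) / (1 + r * real n))) \<in> O(\<lambda>n. 1 / ln (real n) ^ 2)"
  using assms by real_asymp

section \<open>The two asymptotic formulas\<close>

theorem theorem4p7:
  fixes l :: nat
  assumes "l \<ge> 1"
  shows "(\<exists>A B :: real \<Rightarrow> real.
            A \<in> O[at_top](\<lambda>x. x powr (-1/2)) \<and>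
            B \<in> O[at_top](\<lambda>x. 1 / (ln x)\<^sup>2) \<and>
            (\<forall>\<^sub>F x in at_top.
               Z_fun l x = (1 / sqrt 2 + A x) * E_fun x - sqrt (real l) / ln x + B x))
       \<and> (\<exists>B :: real \<Rightarrow> real.
            B \<in> O[at_top](\<lambda>x. 1 / (ln x)\<^sup>2) \<and>
            (\<forall>\<^sub>F x in at_top.
               Z_fun l x = 1 / sqrt 2 * E_fun x - sqrt (real l) / ln x + B x))"
proof -
  define r where "r = real l"
  have r: "r > 0" using assms by (simp add: r_def)
  define L where "L = (\<lambda>n::nat. real n * (r * (real n - 1) + 2) / 2)"
  have L_eq: "L_seq l = L" by (simp add: L_def r_def L_seq_def fun_eq_iff)
  \<comment> \<open>For large \<open>x\<close>, \<open>M x\<close> is the index with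
    \<open>L (M x) < x \<le> L (Suc (M x))\<close>. Errors are first measured along it and then
    converted by \<open>M_ln\<close> and \<open>M_sqrt\<close>.\<close>
  define M where "M = (\<lambda>x. n_idx l x - 1)"
  have M: "filterlim M at_top at_top" unfolding M_def
    by (rule filterlim_compose[OF filterlim_minus_const_nat_at_top filterlim_n_idx[OF assms]])
  have M_props: "\<forall>\<^sub>F x in at_top. x \<ge> 3 \<and> M x \<ge> 2 \<and> n_idx l x = Suc (M x) \<and> L (M x) \<ge> 3 \<and> L (M x) \<le> x \<and> x \<le> L (Suc (M x))"
  proof -
    have "\<forall>\<^sub>F x in at_top. M x \<ge> 2" using M by (auto simp: filterlim_at_top)
    moreover have "\<forall>\<^sub>F x in at_top. L (M x) \<ge> 3"
    proof (rule eventually_compose_filterlim[OF _ M])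
      have "filterlim L at_top sequentially" using r unfolding L_def by real_asymp
      then show "\<forall>\<^sub>F n in sequentially. L n \<ge> 3" by (auto simp: filterlim_at_top)
    qed
    ultimately show ?thesis using eventually_ge_at_top[of 3]
    proof eventually_elim
      case (elim x)
      then have "x \<ge> 2" by simp
      then obtain m where m: "n_idx l x = Suc m" "L_seq l m < x" "x \<le> L_seq l (Suc m)"
        using n_idx_bounds[OF assms] by metis
      then have "M x = m" by (simp add: M_def)
      with m elim show ?case by (simp add: L_eq)
    qed
  qed
  have M_ln: "(\<lambda>x. 1 / ln (real (M x)) ^ 2) \<in> O(\<lambda>x. 1 / ln x ^ 2)"
  proof -
    have "(\<lambda>n. ln (L (Suc n))) \<in> O(\<lambda>n. ln (real n))" using r unfolding L_def by real_asymp
    then have "(\<lambda>x. ln (L (Suc (M x)))) \<in> O(\<lambda>x. ln (real (M x)))" by (rule landau_o.big.compose[OF _ M])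
    moreover have "ln \<in> O(\<lambda>x. ln (L (Suc (M x))))"
      by (rule bigoI[where c = 1], rule eventually_mono[OF M_props]) auto
    ultimately have "ln \<in> O(\<lambda>x. ln (real (M x)))" by (rule landau_o.big_trans[rotated])
    then have "(\<lambda>x. ln x ^ 2) \<in> O(\<lambda>x. ln (real (M x)) ^ 2)" by (rule landau_o.big_power)
    then have "(\<lambda>x. inverse (ln (real (M x)) ^ 2)) \<in> O(\<lambda>x. inverse (ln x ^ 2))"
    proof (rule landau_o.big.inverse[rotated 2])
      show "\<forall>\<^sub>F x::real in at_top. ln x ^ 2 \<noteq> 0"
        by (rule eventually_mono[OF eventually_gt_at_top[of 1]]) auto
      show "\<forall>\<^sub>F x in at_top. ln (real (M x)) ^ 2 \<noteq> 0"
        by (rule eventually_mono[OF M_props]) auto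
    qed
    then show ?thesis by (simp add: inverse_eq_divide)
  qed
  have M_sqrt: "(\<lambda>x. 1 / real (M x)) \<in> O(\<lambda>x. x powr (-1/2))"
  proof -
    have "(\<lambda>n. sqrt (L (Suc n))) \<in> O(\<lambda>n. real n)" using r unfolding L_def by real_asymp
    then have "(\<lambda>x. sqrt (L (Suc (M x)))) \<in> O(\<lambda>x. real (M x))" by (rule landau_o.big.compose[OF _ M])
    moreover have "sqrt \<in> O(\<lambda>x. sqrt (L (Suc (M x))))"
      by (rule bigoI[where c = 1], rule eventually_mono[OF M_props]) auto
    ultimately have "sqrt \<in> O(\<lambda>x. real (M x))" by (rule landau_o.big_trans[rotated])
    then have "(\<lambda>x. inverse (real (M x))) \<in> O(\<lambda>x. inverse (sqrt x))"
    proof (rule landau_o.big.inverse[rotated 2])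
      show "\<forall>\<^sub>F x::real in at_top. sqrt x \<noteq> 0"
        by (rule eventually_mono[OF eventually_gt_at_top[of 0]]) auto
      show "\<forall>\<^sub>F x in at_top. real (M x) \<noteq> 0"
        by (rule eventually_mono[OF M_props]) auto
    qed
    also have "(\<lambda>x::real. inverse (sqrt x)) \<in> O(\<lambda>x. x powr (-1/2))" by real_asymp
    finally show ?thesis by (simp add: inverse_eq_divide)
  qed
  have q: "\<forall>\<^sub>F x in at_top. q_fun l x = (1 + r * real (M x)) / (sqrt r * ln (L (Suc (M x))))"
    by (rule eventually_mono[OF M_props]) (auto simp: q_fun_def h_seq_eq L_eq r_def)

  \<comment> \<open>Chosen so that \<open>(1 / sqrt 2 + A x) * E_fun x\<close> is exactly
    \<open>(li x - prime_pi x) / q_fun l x\<close> for large \<open>x\<close>.\<close>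
  define A where "A = (\<lambda>x. sqrt x / (ln x * q_fun l x) - 1 / sqrt 2)"
  have A: "A \<in> O(\<lambda>x. x powr (-1/2))"
  proof -
    define c where "c = (2 - r) / r"
    define u where "u = (\<lambda>n::nat. r * real n / (1 + r * real n) * sqrt (1 + c / real n))"
    define u' where "u' = (\<lambda>n::nat. r * real (Suc n) / (1 + r * real n) * sqrt (1 + c / real (Suc n)))"
    define k where "k = (\<lambda>n. ln (L (Suc n)) / ln (L n))"
    \<comment> \<open>The factor \<open>1 / sqrt 2\<close> of the theorem arises here:
      \<open>L n\<close> is \<open>(r / 2) * n ^ 2\<close> to leading order, so
      \<open>sqrt r * sqrt (L n)\<close> is about \<open>r * n / sqrt 2\<close>.\<close>
    have sqrtL: "sqrt r * sqrt (L n) = 1 / sqrt 2 * (r * real n * sqrt (1 + c / real n))" if "n \<ge> 1" for n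
    proof -
      have "L n = (r / 2) * real n ^ 2 * (1 + c / real n)"
        using that r by (simp add: L_def c_def power2_eq_square field_simps)
      then have "sqrt (L n) = sqrt (r / 2) * real n * sqrt (1 + c / real n)"
        by (simp only: real_sqrt_mult real_sqrt_abs abs_of_nat)
      then show ?thesis using r by (simp add: real_sqrt_divide)
    qed
    have u1: "(\<lambda>n. u n - 1) \<in> O(\<lambda>n. 1 / real n)" unfolding u_def by (rule sqrt_ratio_bigo[OF r])
    have u2: "(\<lambda>n. u' n - 1) \<in> O(\<lambda>n. 1 / real n)" unfolding u'_def by (rule sqrt_ratio_Suc_bigo[OF r])
    have k: "(\<lambda>n. k n - 1) \<in> O(\<lambda>n. 1 / real n)" unfolding k_def L_def by (rule ln_quadratic_ratio_bigo[OF r])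
    have uk: "(\<lambda>n. u' n * k n - 1) \<in> O(\<lambda>n. 1 / real n)"
    proof -
      have "(\<lambda>n. 1 / real n) \<in> O(\<lambda>n. 1)" by real_asymp
      then have "(\<lambda>n. k n - 1) \<in> O(\<lambda>n. 1)" by (rule landau_o.big_trans[OF k])
      then have "(\<lambda>n. (u' n - 1) * (k n - 1)) \<in> O(\<lambda>n. 1 / real n * 1)"
        by (rule landau_o.big.mult[OF u2])
      then have "(\<lambda>n. (u' n - 1) * (k n - 1)) \<in> O(\<lambda>n. 1 / real n)" by simp
      from sum_in_bigo(1)[OF sum_in_bigo(1)[OF this u2] k] show ?thesis by (simp add: algebra_simps)
    qed
    \<comment> \<open>\<open>sqrt x\<close> and \<open>ln x\<close> are bounded separately at the
      ends of \<open>{L (M x)..L (Suc (M x))}\<close>; in the lower bound the ratio of logarithms is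
      replaced by 1.\<close>
    have "A \<in> O(\<lambda>x. 1 / real (M x))"
    proof (rule bigo_sandwich)
      show "(\<lambda>x. 1 / sqrt 2 * (u (M x) - 1)) \<in> O(\<lambda>x. 1 / real (M x))"
        using landau_o.big.compose[OF u1 M] by simp
      show "(\<lambda>x. 1 / sqrt 2 * (u' (M x) * k (M x) - 1)) \<in> O(\<lambda>x. 1 / real (M x))"
        using landau_o.big.compose[OF uk M] by simp
      show "\<forall>\<^sub>F x in at_top. 1 / sqrt 2 * (u (M x) - 1) \<le> A x \<and> A x \<le> 1 / sqrt 2 * (u' (M x) * k (M x) - 1)"
        using M_props q
      proof eventually_elim
        case (elim x)
        define m where "m = M x"
        have m: "m \<ge> 2" "L m \<ge> 3" "L m \<le> x" "x \<le> L (Suc m)" "x \<ge> 3" using elim by (simp_all add: m_def)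
        have lns: "0 < ln (L m)" "ln (L m) \<le> ln x" "ln x \<le> ln (L (Suc m))" "0 < ln x" "0 < ln (L (Suc m))"
          using m by auto
        have h: "1 + r * real m > 0" using r by (simp add: add_pos_nonneg)
        have cf: "sqrt x / (ln x * q_fun l x) = (sqrt r * sqrt x) / (1 + r * real m) * (ln (L (Suc m)) / ln x)"
        proof -
          have "q_fun l x = (1 + r * real m) / (sqrt r * ln (L (Suc m)))" using elim by (simp add: m_def)
          then show ?thesis by (simp add: mult_ac)
        qed
        have "1 / sqrt 2 * u m = (sqrt r * sqrt (L m)) / (1 + r * real m) * 1"
          using sqrtL[of m] m by (simp add: u_def)
        also have "\<dots> \<le> (sqrt r * sqrt x) / (1 + r * real m) * (ln (L (Suc m)) / ln x)"
          using m lns h r by (intro mult_mono divide_right_mono mult_left_mono) auto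
        finally have 1: "1 / sqrt 2 * u m \<le> sqrt x / (ln x * q_fun l x)" unfolding cf .
        have "(sqrt r * sqrt x) / (1 + r * real m) * (ln (L (Suc m)) / ln x)
            \<le> (sqrt r * sqrt (L (Suc m))) / (1 + r * real m) * (ln (L (Suc m)) / ln (L m))"
          using m lns h r by (intro mult_mono divide_right_mono mult_left_mono divide_left_mono mult_pos_pos) auto
        also have "\<dots> = 1 / sqrt 2 * (u' m * k m)"
          using sqrtL[of "Suc m"] by (simp add: u'_def k_def)
        finally have 2: "sqrt x / (ln x * q_fun l x) \<le> 1 / sqrt 2 * (u' m * k m)" unfolding cf .
        show ?case using 1 2 by (simp add: A_def right_diff_distrib flip: m_def)
      qed
    qed
    from landau_o.big_trans[OF this M_sqrt] show ?thesis .
  qed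

  define R where "R = (\<lambda>x. (li x - S_hat l x) - r * (real (M x) / ln (L (M x)) ^ 2))"
  have R: "R \<in> O(\<lambda>x. real (M x) / ln (real (M x)) ^ 3)"
  proof -
    define D where "D = (\<lambda>n. li (L n) - Sigma_seq l n)"
    define e where "e = (\<lambda>n. (1 + r * real n)\<^sup>2 / (2 * L n * ln (L n) ^ 2))"
    have D: "(\<lambda>n. D n - r * (real n / ln (L n) ^ 2)) \<in> O(\<lambda>n. real n / ln (real n) ^ 3)"
      using Sigma_seq_li_bigo[OF assms] by (simp add: D_def L_eq r_def)
    have "e \<in> O(\<lambda>n. real n / ln (real n) ^ 3)" unfolding e_def L_def by (rule endpoint_error_bigo[OF r])
    from sum_in_bigo(1)[OF D this] 
    have De: "(\<lambda>n. D n - r * (real n / ln (L n) ^ 2) + e n) \<in> O(\<lambda>n. real n / ln (real n) ^ 3)" .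
    show ?thesis
    proof (rule bigo_sandwich[OF landau_o.big.compose[OF D M] landau_o.big.compose[OF De M]],
        rule eventually_mono[OF M_props])
      fix x assume x: "x \<ge> 3 \<and> M x \<ge> 2 \<and> n_idx l x = Suc (M x) \<and> L (M x) \<ge> 3 \<and> L (M x) \<le> x \<and> x \<le> L (Suc (M x))"
      define m where "m = M x"
      have m: "m \<ge> 2" "n_idx l x = Suc m" "L m \<ge> 3" "L m \<le> x" "x \<le> L (Suc m)" "x \<ge> 3" using x by (simp_all add: m_def)
      have step: "L (Suc m) - L m = 1 + r * real m" using L_seq_Suc[of l m] by (simp add: L_eq r_def)
      have "Sigma_seq l (Suc m) = Sigma_seq l m + (L (Suc m) - L m) / ln (L (Suc m))"
        using m by (simp add: Sigma_seq_def s_seq_def h_seq_eq L_eq r_def step)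
      then have S: "S_hat l x = Sigma_seq l m + (x - L m) / ln (L (Suc m))"
        using m by (simp add: S_hat_def L_eq diff_divide_distrib)
      have lns: "0 < ln x" "ln x \<le> ln (L (Suc m))" using m by auto
      \<comment> \<open>Within a step \<open>S_hat\<close> is affine with slope
        \<open>1 / ln (L (Suc m))\<close>, at most the slope of \<open>li\<close>. Hence
        \<open>li - S_hat\<close> only grows from \<open>L m\<close> on, and by no more than the
        error \<open>e m\<close> of the full step.\<close>
      have "(x - L m) / ln (L (Suc m)) \<le> (x - L m) / ln x"
        using lns m by (intro divide_left_mono mult_pos_pos) auto
      also have "\<dots> \<le> li x - li (L m)" using m by (intro li_diff_bounds) auto
      finally have 1: "(x - L m) / ln (L (Suc m)) \<le> li x - li (L m)" .
      have "(L (Suc m) - x) / ln (L (Suc m)) \<le> li (L (Suc m)) - li x" using m by (intro li_diff_bounds) auto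
      moreover have "li (L (Suc m)) - li (L m) - (L (Suc m) - L m) / ln (L (Suc m)) \<le> e m"
        using li_endpoint_error(2)[of "L m" "L (Suc m)"] m by (simp add: e_def step)
      ultimately have 2: "li x - li (L m) - (x - L m) / ln (L (Suc m)) \<le> e m"
        by (simp add: diff_divide_distrib)
      show "D (M x) - r * (real (M x) / ln (L (M x)) ^ 2) \<le> R x \<and> R x \<le> D (M x) - r * (real (M x) / ln (L (M x)) ^ 2) + e (M x)"
        using 1 2 by (simp add: R_def D_def S flip: m_def)
    qed
  qed

  \<comment> \<open>\<open>Z_fun l x\<close> is \<open>(li x - prime_pi x) / q_fun l x\<close> minus
    \<open>(li x - S_hat l x) / q_fun l x\<close>; \<open>B\<close> is what remains when the second
    quotient is replaced by \<open>sqrt r / ln x\<close>.\<close>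
  define B where "B = (\<lambda>x. sqrt r / ln x - (li x - S_hat l x) / q_fun l x)"
  have B: "B \<in> O(\<lambda>x. 1 / ln x ^ 2)"
  proof -
    define p where "p = (\<lambda>n. ln (L (Suc n)) / (1 + r * real n))"
    define G where "G = (\<lambda>n. r * real n / (1 + r * real n) * (ln (L (Suc n)) / ln (L n) ^ 2) - 1 / ln (L n))"
    define K where "K = (\<lambda>n. 1 / ln (L n) - 1 / ln (L (Suc n)))"
    have G: "G \<in> O(\<lambda>n. 1 / ln (real n) ^ 2)" unfolding G_def L_def by (rule inverse_ln_quadratic_bigo[OF r])
    have K: "K \<in> O(\<lambda>n. 1 / ln (real n) ^ 2)" unfolding K_def L_def by (rule inverse_ln_quadratic_diff_bigo[OF r])
    have Rp: "(\<lambda>x. R x * p (M x)) \<in> O(\<lambda>x. 1 / ln (real (M x)) ^ 2)"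
    proof -
      have "(\<lambda>n. real n / ln (real n) ^ 3 * p n) \<in> O(\<lambda>n. 1 / ln (real n) ^ 2)"
        unfolding p_def L_def by (rule ln_quadratic_div_linear_bigo[OF r])
      then have "(\<lambda>x. real (M x) / ln (real (M x)) ^ 3 * p (M x)) \<in> O(\<lambda>x. 1 / ln (real (M x)) ^ 2)"
        by (rule landau_o.big.compose[OF _ M])
      moreover have "(\<lambda>x. R x * p (M x)) \<in> O(\<lambda>x. real (M x) / ln (real (M x)) ^ 3 * p (M x))"
        by (rule landau_o.big.mult[OF R]) simp
      ultimately show ?thesis by (rule landau_o.big_trans[rotated])
    qed
    define d where "d = (\<lambda>x. 1 / ln x - 1 / ln (L (M x)))"
    have d: "d \<in> O(\<lambda>x. 1 / ln (real (M x)) ^ 2)"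
    proof (rule bigo_sandwich)
      show "(\<lambda>x. - K (M x)) \<in> O(\<lambda>x. 1 / ln (real (M x)) ^ 2)" using landau_o.big.compose[OF K M] by simp
      show "(\<lambda>x. 0) \<in> O(\<lambda>x. 1 / ln (real (M x)) ^ 2)" by simp
      show "\<forall>\<^sub>F x in at_top. - K (M x) \<le> d x \<and> d x \<le> 0"
        using M_props
      proof eventually_elim
        case (elim x)
        then have "0 < ln (L (M x))" "ln (L (M x)) \<le> ln x" "ln x \<le> ln (L (Suc (M x)))" by auto
        then show ?case by (auto simp: K_def d_def intro!: divide_left_mono mult_pos_pos)
      qed
    qed
    \<comment> \<open>Three sources of error: replacing \<open>ln x\<close> by
      \<open>ln (L (M x))\<close>, the main term along the index, and the remainder
      \<open>R\<close>. The factor \<open>sqrt r * p (M x)\<close> is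
      \<open>1 / q_fun l x\<close>.\<close>
    have "(\<lambda>x. sqrt r * (d x - G (M x) - R x * p (M x))) \<in> O(\<lambda>x. 1 / ln (real (M x)) ^ 2)"
      using sum_in_bigo(2)[OF sum_in_bigo(2)[OF d landau_o.big.compose[OF G M]] Rp] by simp
    also have "?this \<longleftrightarrow> B \<in> O(\<lambda>x. 1 / ln (real (M x)) ^ 2)"
    proof (rule landau_o.big.in_cong)
      show "\<forall>\<^sub>F x in at_top. sqrt r * (d x - G (M x) - R x * p (M x)) = B x"
        using M_props q
      proof eventually_elim
        case (elim x)
        have "1 / q_fun l x = sqrt r * p (M x)" using elim by (simp add: p_def)
        define W where "W = r * (real (M x) / ln (L (M x)) ^ 2)"
        have "B x = sqrt r / ln x - (R x + W) * (sqrt r * p (M x))"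
          by (simp add: B_def R_def W_def flip: \<open>1 / q_fun l x = _\<close>)
        then have "B x = sqrt r / ln x - sqrt r * (R x * p (M x)) - sqrt r * (W * p (M x))"
          by (simp add: algebra_simps)
        moreover have "W * p (M x) = G (M x) + 1 / ln (L (M x))"
          by (simp add: W_def p_def G_def)
        ultimately have "B x = sqrt r / ln x - sqrt r * (R x * p (M x)) - sqrt r * (G (M x) + 1 / ln (L (M x)))"
          by simp
        then show ?case by (simp add: d_def algebra_simps)
      qed
    qed
    finally have "B \<in> O(\<lambda>x. 1 / ln (real (M x)) ^ 2)" .
    from landau_o.big_trans[OF this M_ln] show ?thesis .
  qed

  have Z: "\<forall>\<^sub>F x in at_top. Z_fun l x = (1 / sqrt 2 + A x) * E_fun x - sqrt (real l) / ln x + B x"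
    using M_props q
  proof eventually_elim
    case (elim x)
    have x: "sqrt x \<noteq> 0" "ln x \<noteq> 0" using elim by auto
    have "(1 / sqrt 2 + A x) * E_fun x = (li x - real (prime_pi x)) / q_fun l x"
      using x by (simp add: A_def E_fun_def)
    then show ?case by (simp add: Z_fun_def B_def r_def diff_divide_distrib)
  qed

  \<comment> \<open>\<open>E_fun\<close> is \<open>O(sqrt x / ln x ^ 2)\<close>, and
    \<open>A\<close> cancels exactly the square root.\<close>
  have AE: "(\<lambda>x. A x * E_fun x) \<in> O(\<lambda>x. 1 / ln x ^ 2)"
  proof -
    have "E_fun \<in> O(\<lambda>x. ln x / sqrt x * (x / ln x ^ 3))"
      unfolding E_fun_def[abs_def] by (rule landau_o.big.mult[OF _ prime_number_theorem]) simp
    from landau_o.big.mult[OF A this]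
    have "(\<lambda>x. A x * E_fun x) \<in> O(\<lambda>x. x powr (-1/2) * (ln x / sqrt x * (x / ln x ^ 3)))" .
    also have "(\<lambda>x. x powr (-1/2) * (ln x / sqrt x * (x / ln x ^ 3))) \<in> O(\<lambda>x::real. 1 / ln x ^ 2)"
      by real_asymp
    finally show ?thesis .
  qed
  have Z': "\<forall>\<^sub>F x in at_top. Z_fun l x = 1 / sqrt 2 * E_fun x - sqrt (real l) / ln x + (B x + A x * E_fun x)"
    using Z by eventually_elim (simp add: algebra_simps)
  show ?thesis
  proof (rule conjI, goal_cases)
    case 1
    show ?case by (rule exI[of _ A], rule exI[of _ B], rule conjI[OF A conjI[OF B Z]])
  next
    case 2
    show ?case
      by (rule exI[of _ "\<lambda>x. B x + A x * E_fun x"], rule conjI[OF sum_in_bigo(1)[OF B AE] Z'])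
  qed
qed

end
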